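(* For any $u\in\mathcal{D}_{p,\infty}^{\boldsymbol{k},b}$, there exists a unique positive Radon measure $\Gamma_p^{\boldsymbol{k}}\langle u\rangle$ on $K$ such that for any $\{u_n\}_{n\in\mathbb{N}}\subseteq B_{p,\infty}^{\boldsymbol{k}}\cap C_b(K)$ with $\lim_{n\to\infty}\mathcal{E}_p^{\boldsymbol{k}}(u-u_n)=0$ and any Borel measurable function $\varphi\colon K\to[0,\infty)$ with $\|\varphi\|_{\sup}<\infty$, $$\int_K\varphi\,d\Gamma_p^{\boldsymbol{k}}\langle u\rangle=\lim_{n\to\infty}\int_K\varphi\,d\Gamma_p^{\boldsymbol{k}}\langle u_n\rangle,$$ and $\Gamma_p^{\boldsymbol{k}}\langle u\rangle$ further satisfies $\Gamma_p^{\boldsymbol{k}}\langle u\rangle(K)\le\mathcal{E}_p^{\boldsymbol{k}}(u)$. Moreover, for each such $\varphi$, $\bigl(\int_K\varphi\,d\Gamma_p^{\boldsymbol{k}}\langle\,\cdot\,\rangle,\mathcal{D}_{p,\infty}^{\boldsymbol{k},b}\bigr)$ is a $p$-energy form on $(K,m)$ satisfying $(\mathrm{GC})_p$.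
   Context: Setting. $p\in(1,\infty)$; $(K,d)$ is a locally compact separable metric space with at least two points; $m$ is a $\sigma$-finite Borel measure on $K$ with full topological support; $B_d(x,r)=\{y: d(x,y)<r\}$. $C_b(K)$, $C_c(K)$ are the bounded, respectively compactly supported, continuous real functions on $K$, identified with their $m$-equivalence classes. A Radon measure is a Borel measure finite on compact sets. $\boldsymbol{k}=\{k_r\}_{r>0}$ is a family of $[0,\infty]$-valued Borel functions on $K\times K$; $J_{p,r}^{\boldsymbol{k}}(f)=\int_K\int_K|f(x)-f(y)|^pk_r(x,y)\,m(dy)\,m(dx)$ for $f\in L^p(K,m)$; $B_{p,\infty}^{\boldsymbol{k}}=\{f\in L^p(K,m):\sup_{r>0}J_{p,r}^{\boldsymbol{k}}(f)<\infty\}$ with norm $\|f\|_{B_{p,\infty}^{\boldsymbol{k}}}=\|f\|_{L^p(K,m)}+(\sup_{r>0}J_{p,r}^{\boldsymbol{k}}(f))^{1/p}$. Standing assumptions: (1) $(\mathrm{WM})_{p,\boldsymbol{k}}$: there is $C\in[1,\infty)$ with $\sup_{r>0}J_{p,r}^{\boldsymbol{k}}(f)\le C\liminf_{r\downarrow0}J_{p,r}^{\boldsymbol{k}}(f)$ for all $f\in B_{p,\infty}^{\boldsymbol{k}}$; (2) $\boldsymbol{k}$ is asymptotically local: there is $\{\delta(r)\}_{r>0}\subseteq(0,\infty)$ with $\lim_{r\downarrow0}\delta(r)=0$ and $\lim_{r\downarrow0}\int_K\int_{K\setminus B_d(x,\delta(r))}k_r(x,y)\,m(dy)\,m(dx)=0$;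 (3) $B_{p,\infty}^{\boldsymbol{k}}\cap C_c(K)$ is dense in $(C_c(K),\|\cdot\|_{\sup})$. Fix a sequence $r_n>0$, $r_n\to0$, such that $\mathcal{E}_p^{\boldsymbol{k}}(f):=\lim_{n\to\infty}J_{p,r_n}^{\boldsymbol{k}}(f)$ exists in $[0,\infty)$ for every $f\in B_{p,\infty}^{\boldsymbol{k}}$ (such sequences exist under (1)); $\mathcal{E}_p^{\boldsymbol{k}}(f;g):=\frac1p\frac{d}{dt}\mathcal{E}_p^{\boldsymbol{k}}(f+tg)|_{t=0}$, which exists. $\mathcal{D}_{p,\infty}^{\boldsymbol{k},b}$ is the closure of $B_{p,\infty}^{\boldsymbol{k}}\cap C_b(K)$ in $B_{p,\infty}^{\boldsymbol{k}}$. For $u\in B_{p,\infty}^{\boldsymbol{k}}\cap C_b(K)$, $\Gamma_p^{\boldsymbol{k}}\langle u\rangle$ denotes the unique positive Radon measure on $K$ (known to exist, with total mass at most $\mathcal{E}_p^{\boldsymbol{k}}(u)$) with $\int_K\varphi\,d\Gamma_p^{\boldsymbol{k}}\langle u\rangle=\mathcal{E}_p^{\boldsymbol{k}}(u;u\varphi)-(\frac{p-1}{p})^{p-1}\mathcal{E}_p^{\boldsymbol{k}}(|u|^{p/(p-1)};\varphi)$ for all $\varphi\in B_{p,\infty}^{\boldsymbol{k}}\cap C_c(K)$. A pair $(\mathcal{E},\mathcal{F})$, with $\mathcal{F}$ a linear space of $m$-equivalence classes of real measurable functions and $\mathcal{E}\colon\mathcal{F}\to[0,\infty)$, $\mathcal{E}(au)=|a|^p\mathcal{E}(u)$,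 is a $p$-energy form on $(K,m)$ if $\mathcal{E}^{1/p}$ is a seminorm. It satisfies $(\mathrm{GC})_p$ if: whenever $n_1,n_2\in\mathbb{N}$, $q_1\in(0,p]$, $q_2\in[p,\infty]$ and $T=(T_1,\dots,T_{n_2})\colon\mathbb{R}^{n_1}\to\mathbb{R}^{n_2}$ satisfies $T(0)=0$ and $\|T(x)-T(y)\|_{\ell^{q_2}}\le\|x-y\|_{\ell^{q_1}}$ for all $x,y$, then for all $\boldsymbol{u}=(u_1,\dots,u_{n_1})\in\mathcal{F}^{n_1}$ one has $T(\boldsymbol{u})\in\mathcal{F}^{n_2}$ and $\|(\mathcal{E}(T_l(\boldsymbol{u}))^{1/p})_{l}\|_{\ell^{q_2}}\le\|(\mathcal{E}(u_k)^{1/p})_{k}\|_{\ell^{q_1}}$, where $\|x\|_{\ell^q}=(\sum_k|x_k|^q)^{1/q}$ for $q<\infty$ and $\|x\|_{\ell^\infty}=\max_k|x_k|$. *)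

theory Defs
  imports "HOL-Analysis.Analysis"
begin

text \<open>
  The spaces of \<open>m\<close>-equivalence classes are rendered by Borel functions \<open>f :: 'a \<Rightarrow> real\<close> representing
  their classes.  All spaces below that stand for spaces of classes are saturated with respect to
  \<open>m\<close>-almost everywhere equality (this is part of \<open>p_energy_form\<close>).  Elements of \<open>C_b\<close> and \<open>C_c\<close> are the
  continuous functions themselves: as \<open>m\<close> has full support, a class has at most one continuous
  representative.  Separability of the metric space is the class \<open>second_countable_topology\<close>.
\<close>

definition full_support :: "'a::topological_space measure \<Rightarrow> bool" where
  "full_support m \<longleftrightarrow> (\<forall>U. open U \<and> U \<noteq> {} \<longrightarrow> emeasure m U > 0)"

definition radon_measure :: "'a::topological_space measure \<Rightarrow> bool" where
  "radon_measure \<mu> \<longleftrightarrow> sets \<mu> = sets borel \<and> (\<forall>C. compact C \<longrightarrow> emeasure \<mu> C < \<infinity>)"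

definition Cb :: "('a::topological_space \<Rightarrow> real) set" where
  "Cb = {f. continuous_on UNIV f \<and> bounded (range f)}"

definition Cc :: "('a::topological_space \<Rightarrow> real) set" where
  "Cc = {f. continuous_on UNIV f \<and> compact (closure {x. f x \<noteq> 0})}"

definition Lp :: "real \<Rightarrow> 'a measure \<Rightarrow> ('a \<Rightarrow> real) set" where
  "Lp p m = {f \<in> borel_measurable m. (\<integral>\<^sup>+x. ennreal (\<bar>f x\<bar> powr p) \<partial>m) < \<infinity>}"

definition Lp_norm :: "real \<Rightarrow> 'a measure \<Rightarrow> ('a \<Rightarrow> real) \<Rightarrow> real" where
  "Lp_norm p m f = (LINT x|m. \<bar>f x\<bar> powr p) powr (1 / p)"

text \<open>The kernel \<open>k r x y\<close> is only relevant for \<open>r > 0\<close>.\<close>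

definition kernel_energy ::
    "real \<Rightarrow> 'a measure \<Rightarrow> (real \<Rightarrow> 'a \<Rightarrow> 'a \<Rightarrow> ennreal) \<Rightarrow> real \<Rightarrow> ('a \<Rightarrow> real) \<Rightarrow> ennreal" where
  "kernel_energy p m k r f =
     (\<integral>\<^sup>+x. (\<integral>\<^sup>+y. ennreal (\<bar>f x - f y\<bar> powr p) * k r x y \<partial>m) \<partial>m)"

definition sup_energy ::
    "real \<Rightarrow> 'a measure \<Rightarrow> (real \<Rightarrow> 'a \<Rightarrow> 'a \<Rightarrow> ennreal) \<Rightarrow> ('a \<Rightarrow> real) \<Rightarrow> ennreal" where
  "sup_energy p m k f = (SUP r\<in>{0<..}. kernel_energy p m k r f)"

definition Bspace ::
    "real \<Rightarrow> 'a measure \<Rightarrow> (real \<Rightarrow> 'a \<Rightarrow> 'a \<Rightarrow> ennreal) \<Rightarrow> ('a \<Rightarrow> real) set" where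
  "Bspace p m k = {f \<in> Lp p m. sup_energy p m k f < \<infinity>}"

definition Bnorm ::
    "real \<Rightarrow> 'a measure \<Rightarrow> (real \<Rightarrow> 'a \<Rightarrow> 'a \<Rightarrow> ennreal) \<Rightarrow> ('a \<Rightarrow> real) \<Rightarrow> real" where
  "Bnorm p m k f = Lp_norm p m f + enn2real (sup_energy p m k f) powr (1 / p)"

definition Db ::
    "real \<Rightarrow> 'a::topological_space measure \<Rightarrow> (real \<Rightarrow> 'a \<Rightarrow> 'a \<Rightarrow> ennreal) \<Rightarrow> ('a \<Rightarrow> real) set" where
  "Db p m k = {u \<in> Bspace p m k.
     \<forall>\<epsilon>>0. \<exists>v \<in> Bspace p m k \<inter> Cb. Bnorm p m k (\<lambda>x. u x - v x) < \<epsilon>}"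

definition weak_monotonicity ::
    "real \<Rightarrow> 'a measure \<Rightarrow> (real \<Rightarrow> 'a \<Rightarrow> 'a \<Rightarrow> ennreal) \<Rightarrow> bool" where
  "weak_monotonicity p m k \<longleftrightarrow> (\<exists>C::real. C \<ge> 1 \<and> (\<forall>f \<in> Bspace p m k.
     sup_energy p m k f \<le> ennreal C * Liminf (at_right 0) (\<lambda>r. kernel_energy p m k r f)))"

definition asymptotically_local ::
    "'a::metric_space measure \<Rightarrow> (real \<Rightarrow> 'a \<Rightarrow> 'a \<Rightarrow> ennreal) \<Rightarrow> bool" where
  "asymptotically_local m k \<longleftrightarrow> (\<exists>\<delta> :: real \<Rightarrow> real.
     (\<forall>r>0. \<delta> r > 0) \<and> (\<delta> \<longlongrightarrow> 0) (at_right 0) \<and>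
     ((\<lambda>r. \<integral>\<^sup>+x. (\<integral>\<^sup>+y\<in>UNIV - ball x (\<delta> r). k r x y \<partial>m) \<partial>m) \<longlongrightarrow> 0) (at_right 0))"

definition regular_Bspace ::
    "real \<Rightarrow> 'a::topological_space measure \<Rightarrow> (real \<Rightarrow> 'a \<Rightarrow> 'a \<Rightarrow> ennreal) \<Rightarrow> bool" where
  "regular_Bspace p m k \<longleftrightarrow>
     (\<forall>f \<in> Cc. \<forall>\<epsilon>>0. \<exists>g \<in> Bspace p m k \<inter> Cc. \<forall>x. \<bar>f x - g x\<bar> < \<epsilon>)"

text \<open>The form \<open>\<E>\<close> obtained along the sequence \<open>rs\<close> of scales; the value is meaningful on \<open>Bspace p m k\<close>
  when \<open>admissible_scales p m k rs\<close> holds.\<close>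

definition admissible_scales ::
    "real \<Rightarrow> 'a measure \<Rightarrow> (real \<Rightarrow> 'a \<Rightarrow> 'a \<Rightarrow> ennreal) \<Rightarrow> (nat \<Rightarrow> real) \<Rightarrow> bool" where
  "admissible_scales p m k rs \<longleftrightarrow> (\<forall>n. rs n > 0) \<and> rs \<longlonglongrightarrow> 0 \<and>
     (\<forall>f \<in> Bspace p m k. \<exists>c::real. c \<ge> 0 \<and> (\<lambda>n. kernel_energy p m k (rs n) f) \<longlonglongrightarrow> ennreal c)"

definition energy ::
    "real \<Rightarrow> 'a measure \<Rightarrow> (real \<Rightarrow> 'a \<Rightarrow> 'a \<Rightarrow> ennreal) \<Rightarrow> (nat \<Rightarrow> real) \<Rightarrow> ('a \<Rightarrow> real) \<Rightarrow> real" where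
  "energy p m k rs f = enn2real (lim (\<lambda>n. kernel_energy p m k (rs n) f))"

definition energy2 ::
    "real \<Rightarrow> 'a measure \<Rightarrow> (real \<Rightarrow> 'a \<Rightarrow> 'a \<Rightarrow> ennreal) \<Rightarrow> (nat \<Rightarrow> real)
      \<Rightarrow> ('a \<Rightarrow> real) \<Rightarrow> ('a \<Rightarrow> real) \<Rightarrow> real" where
  "energy2 p m k rs f g = 1 / p * deriv (\<lambda>t. energy p m k rs (\<lambda>x. f x + t * g x)) 0"

text \<open>Only meaningful for \<open>u \<in> Bspace p m k \<inter> Cb\<close>, where the measure exists and is unique.\<close>

definition energy_measure ::
    "real \<Rightarrow> 'a::topological_space measure \<Rightarrow> (real \<Rightarrow> 'a \<Rightarrow> 'a \<Rightarrow> ennreal) \<Rightarrow> (nat \<Rightarrow> real)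
      \<Rightarrow> ('a \<Rightarrow> real) \<Rightarrow> 'a measure" where
  "energy_measure p m k rs u = (THE \<mu>. radon_measure \<mu> \<and>
     (\<forall>\<phi> \<in> Bspace p m k \<inter> Cc.
        (\<integral>x. \<phi> x \<partial>\<mu>) = energy2 p m k rs u (\<lambda>x. u x * \<phi> x)
          - ((p - 1) / p) powr (p - 1) * energy2 p m k rs (\<lambda>x. \<bar>u x\<bar> powr (p / (p - 1))) \<phi>))"

definition bounded_nonneg_borel :: "('a::topological_space \<Rightarrow> real) \<Rightarrow> bool" where
  "bounded_nonneg_borel \<phi> \<longleftrightarrow> \<phi> \<in> borel_measurable borel \<and> (\<forall>x. 0 \<le> \<phi> x) \<and> bounded (range \<phi>)"

text \<open>The convergence property that characterizes the extended energy measure of \<open>u \<in> Db p m k\<close>.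
  Since \<open>\<phi> \<ge> 0\<close> and the Radon measure \<open>\<mu>\<close> is a priori possibly infinite, the integrals are
  \<open>[0,\<infinity>]\<close>-valued, which avoids the default value of the Bochner integral.\<close>

definition energy_measure_limit ::
    "real \<Rightarrow> 'a::topological_space measure \<Rightarrow> (real \<Rightarrow> 'a \<Rightarrow> 'a \<Rightarrow> ennreal) \<Rightarrow> (nat \<Rightarrow> real)
      \<Rightarrow> ('a \<Rightarrow> real) \<Rightarrow> 'a measure \<Rightarrow> bool" where
  "energy_measure_limit p m k rs u \<mu> \<longleftrightarrow>
     (\<forall>us \<phi>. (\<forall>n. us n \<in> Bspace p m k \<inter> Cb) \<and>
        (\<lambda>n. energy p m k rs (\<lambda>x. u x - us n x)) \<longlonglongrightarrow> 0 \<and> bounded_nonneg_borel \<phi> \<longrightarrow>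
        (\<lambda>n. \<integral>\<^sup>+x. ennreal (\<phi> x) \<partial>energy_measure p m k rs (us n))
          \<longlonglongrightarrow> (\<integral>\<^sup>+x. ennreal (\<phi> x) \<partial>\<mu>))"

text \<open>The first block of conditions states that \<open>F\<close> is a linear space of \<open>m\<close>-equivalence classes and
  that \<open>E\<close> is well defined on classes.\<close>

definition p_energy_form ::
    "real \<Rightarrow> 'a measure \<Rightarrow> (('a \<Rightarrow> real) \<Rightarrow> real) \<Rightarrow> ('a \<Rightarrow> real) set \<Rightarrow> bool" where
  "p_energy_form p m E F \<longleftrightarrow>
     (F \<subseteq> borel_measurable m \<and>
      (\<forall>u\<in>F. \<forall>v\<in>borel_measurable m. (AE x in m. u x = v x) \<longrightarrow> v \<in> F \<and> E v = E u) \<and>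
      (\<lambda>x. 0) \<in> F \<and>
      (\<forall>u\<in>F. \<forall>v\<in>F. (\<lambda>x. u x + v x) \<in> F) \<and>
      (\<forall>a. \<forall>u\<in>F. (\<lambda>x. a * u x) \<in> F)) \<and>
     (\<forall>u\<in>F. 0 \<le> E u) \<and>
     (\<forall>a. \<forall>u\<in>F. E (\<lambda>x. a * u x) = \<bar>a\<bar> powr p * E u) \<and>
     (\<forall>a. \<forall>u\<in>F. E (\<lambda>x. a * u x) powr (1 / p) = \<bar>a\<bar> * E u powr (1 / p)) \<and>
     (\<forall>u\<in>F. \<forall>v\<in>F. E (\<lambda>x. u x + v x) powr (1 / p) \<le> E u powr (1 / p) + E v powr (1 / p))"

text \<open>Vectors in \<open>\<real>\<^sup>n\<close> are functions on \<open>nat\<close> of which only the values at \<open>i < n\<close> matter; \<open>n \<ge> 1\<close> and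
  \<open>0 < q \<le> \<infinity>\<close>.\<close>

definition lq_norm :: "ereal \<Rightarrow> nat \<Rightarrow> (nat \<Rightarrow> real) \<Rightarrow> real" where
  "lq_norm q n x =
     (if q = \<infinity> then Max ((\<lambda>i. \<bar>x i\<bar>) ` {..<n})
      else (\<Sum>i<n. \<bar>x i\<bar> powr real_of_ereal q) powr (1 / real_of_ereal q))"

text \<open>The contraction inequality for \<open>T\<close> forces the components \<open>T x l\<close>, \<open>l < n2\<close>, to depend on
  \<open>x 0, \<dots>, x (n1 - 1)\<close> only, so these \<open>T\<close> are exactly the maps \<open>\<real>\<^sup>n\<^sup>1 \<rightarrow> \<real>\<^sup>n\<^sup>2\<close> in question.\<close>

definition generalized_contraction ::
    "real \<Rightarrow> (('a \<Rightarrow> real) \<Rightarrow> real) \<Rightarrow> ('a \<Rightarrow> real) set \<Rightarrow> bool" where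
  "generalized_contraction p E F \<longleftrightarrow>
     (\<forall>(n1::nat) (n2::nat) (q1::real) (q2::ereal) (T :: (nat \<Rightarrow> real) \<Rightarrow> (nat \<Rightarrow> real)).
        1 \<le> n1 \<and> 1 \<le> n2 \<and> 0 < q1 \<and> q1 \<le> p \<and> ereal p \<le> q2 \<and>
        (\<forall>l<n2. T (\<lambda>i. 0) l = 0) \<and>
        (\<forall>x y. lq_norm q2 n2 (\<lambda>l. T x l - T y l) \<le> lq_norm (ereal q1) n1 (\<lambda>i. x i - y i))
        \<longrightarrow>
        (\<forall>u :: nat \<Rightarrow> 'a \<Rightarrow> real. (\<forall>i<n1. u i \<in> F) \<longrightarrow>
          (\<forall>l<n2. (\<lambda>x. T (\<lambda>i. u i x) l) \<in> F) \<and>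
          lq_norm q2 n2 (\<lambda>l. E (\<lambda>x. T (\<lambda>i. u i x) l) powr (1 / p))
            \<le> lq_norm (ereal q1) n1 (\<lambda>i. E (u i) powr (1 / p))))"

end

theory Submission
  imports Defs
begin

text \<open>
  Write \<open>J\<^sub>n(u)\<close> for the kernel energy at scale \<open>rs n\<close> and \<open>E(u)\<close> for its limit.  The idea is to
  represent the energy measure of \<open>u\<close> as the vague limit of the localized energies
  \<open>J\<^sub>n\<^sup>\<phi>(u) = \<integral>\<integral> \<bar>u x - u y\<bar>\<^sup>p \<phi>(x) k(x, y) dy dx\<close>.  Everything claimed about the measures holds for these
  expressions at each fixed scale, where it is a statement about \<open>L\<^sup>p\<close>-norms of increments, and then
  passes to the limit.

  For bounded continuous \<open>u\<close>, the defining expression of the energy measure is a combination of two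
  derivatives of \<open>E\<close>.  A first-order expansion with a remainder that is uniform in the scale shows that
  these derivatives are limits of the derivatives at scale \<open>rs n\<close> (\<open>energy2_tendsto\<close>).  With
  \<open>v = \<bar>u\<bar> powr (p / (p - 1))\<close>, the mean value theorem and the multiplicativity of signed powers make the
  integrands of the two terms cancel up to \<open>\<bar>u x - u y\<bar>\<^sup>p\<close> times the increment of \<open>\<phi>\<close>
  (\<open>conjugate_power_cancellation\<close>), and the integral of this remainder vanishes because the kernels
  concentrate at the diagonal (\<open>local_energy_vanishes\<close>).  Hence \<open>J\<^sub>n\<^sup>\<phi>(u)\<close> converges to the defining
  expression (\<open>localized_energy_tendsto\<close>).

  Since \<open>J\<^sub>n\<^sup>\<phi>(u)\<close> depends on \<open>u\<close> continuously with respect to \<open>E\<close>, uniformly in \<open>n\<close>, it converges for every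
  compactly supported \<open>\<phi>\<close> and every \<open>u\<close> in the closure \<open>Db\<close> (\<open>J_convergent\<close>).  The limit is a positive
  functional of \<open>\<phi>\<close> bounded by \<open>E(u)\<close>, and the representation theorem for such functionals
  (\<open>bounded_positive_functional\<close>) gives a finite measure \<open>gamma u\<close> of mass at most \<open>E(u)\<close>, directly for all
  \<open>u\<close> in \<open>Db\<close>.  On bounded continuous functions it is the energy measure, because a Radon measure is
  determined by its integrals over \<open>Bspace \<inter> Cc\<close> (\<open>radon_measure_eqI_B\<close>).  The integrals of one bounded
  Borel function against finitely many of these measures can be approximated simultaneously by those of
  compactly supported functions (\<open>Cc_approximating_sequence\<close>), so closed relations such as continuity in
  \<open>u\<close>, homogeneity and contraction inequalities carry over to bounded Borel functions.

  The contraction inequality for the localized energies is the pointwise inequality for the increments,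
  integrated: the \<open>\<ell>\<^sup>q\<^sup>2\<close>-norm and the \<open>\<ell>\<^sup>q\<^sup>1\<close>-norm can be interchanged with the \<open>L\<^sup>p\<close>-norm in the needed
  directions by Hoelder's and Minkowski's inequalities (\<open>contraction_of_power_integrals\<close>).  The remaining
  point is that \<open>T(u)\<close> stays in \<open>Db\<close>.  Applying \<open>T\<close> to approximants of \<open>u\<close> gives functions that are bounded
  in energy and converge in \<open>L\<^sup>p\<close> only.  Instead of weak compactness the proof minimizes the energy over
  small \<open>L\<^sup>p\<close>-neighbourhoods of \<open>T(u)\<close>: uniform convexity makes the minimizers Cauchy, and lower
  semicontinuity together with weak monotonicity identifies the limit (\<open>Db_of_bounded_energy\<close>).
\<close>


section \<open>Elementary inequalities for powers\<close>

text \<open>The odd power function, up to the factor \<open>q + 1\<close> the derivative of \<open>z \<mapsto> \<bar>z\<bar> powr (q + 1)\<close>.\<close>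

definition spow :: "real \<Rightarrow> real \<Rightarrow> real" where
  "spow q z = sgn z * \<bar>z\<bar> powr q"

lemma abs_spow: "\<bar>spow q z\<bar> = \<bar>z\<bar> powr q"
  by (cases "z = 0") (auto simp: spow_def abs_mult abs_sgn_eq)

lemma spow_mult: "spow q (a * b) = spow q a * spow q b"
  by (simp add: spow_def sgn_mult abs_mult powr_mult)

lemma spow_mult_self: "spow (p - 1) z * z = \<bar>z\<bar> powr p"
proof (cases "z = 0")
  case False
  have "spow (p - 1) z * z = \<bar>z\<bar> powr (p - 1) * \<bar>z\<bar>"
    by (simp add: spow_def sgn_if)
  also have "\<dots> = \<bar>z\<bar> powr p"
    using False by (simp add: powr_mult_base mult.commute)
  finally show ?thesis .
qed auto

lemma abs_powr_pos_eq: "\<bar>z\<bar> powr (p - 1) * \<bar>z\<bar> = \<bar>z\<bar> powr p" for z :: real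
  by (cases "z = 0") (simp_all add: powr_mult_base mult.commute)

lemma spow_borel [measurable]: "spow q \<in> borel_measurable borel"
  unfolding spow_def by measurable

lemma spow_less: assumes "q > 0" "a < b" shows "spow q a < spow q b"
proof -
  consider "0 \<le> a" | "b \<le> 0" | "a < 0" "0 < b" by linarith
  then show ?thesis
  proof cases
    case 1
    then show ?thesis
      using assms powr_less_mono2[of q a b] by (auto simp: spow_def sgn_if)
  next
    case 2
    then show ?thesis
      using assms powr_less_mono2[of q "-b" "-a"] by (auto simp: spow_def sgn_if)
  next
    case 3
    then have "(- a) powr q > 0" "0 < b powr q" by auto
    then have "- ((- a) powr q) < b powr q" by linarith
    then show ?thesis using 3 by (simp add: spow_def)
  qed
qed

lemma abs_powr_has_derivative:
  fixes z :: real assumes p: "p > 1"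
  shows "((\<lambda>z. \<bar>z\<bar> powr p) has_real_derivative p * spow (p - 1) z) (at z)"
proof -
  consider "z > 0" | "z < 0" | "z = 0" by linarith
  then show ?thesis
  proof cases
    case 1
    have "((\<lambda>z. z powr p) has_real_derivative p * z powr (p - 1)) (at z)"
      using 1 by (auto intro!: derivative_eq_intros)
    then have "((\<lambda>z. \<bar>z\<bar> powr p) has_real_derivative p * z powr (p - 1)) (at z)"
      by (rule DERIV_cong_ev[THEN iffD1, OF refl _ refl, rotated])
         (use 1 in \<open>auto intro: eventually_mono[OF order_tendstoD(1)[OF tendsto_ident_at]]
            simp: eventually_nhds_metric dist_real_def intro!: exI[of _ z]\<close>)
    then show ?thesis using 1 by (simp add: spow_def)
  next
    case 2
    have "((\<lambda>z. (-z) powr p) has_real_derivative - (p * (-z) powr (p - 1))) (at z)"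
      using 2 by (auto intro!: derivative_eq_intros)
    then have "((\<lambda>z. \<bar>z\<bar> powr p) has_real_derivative - (p * (-z) powr (p - 1))) (at z)"
      by (rule DERIV_cong_ev[THEN iffD1, OF refl _ refl, rotated])
         (use 2 in \<open>auto simp: eventually_nhds_metric dist_real_def intro!: exI[of _ "-z"]\<close>)
    then show ?thesis using 2 by (simp add: spow_def)
  next
    case 3
    have "((\<lambda>h. \<bar>h\<bar> powr (p - 1)) \<longlongrightarrow> 0) (at (0::real))"
    proof -
      have "((\<lambda>h::real. \<bar>h\<bar>) \<longlongrightarrow> 0) (at 0)" by (rule tendsto_eq_intros refl | simp)+
      then have "((\<lambda>h::real. \<bar>h\<bar> powr (p - 1)) \<longlongrightarrow> 0 powr (p - 1)) (at 0)"
        by (rule tendsto_powr') (use p in auto)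
      then show ?thesis by simp
    qed
    then have "((\<lambda>h. \<bar>h\<bar> powr p / h) \<longlongrightarrow> 0) (at (0::real))"
    proof (rule Lim_null_comparison[rotated])
      show "\<forall>\<^sub>F h in at (0::real). norm (\<bar>h\<bar> powr p / h) \<le> \<bar>h\<bar> powr (p - 1)"
        unfolding eventually_at_filter
        by (intro always_eventually) (auto simp: powr_diff)
    qed
    then show ?thesis using 3 p by (simp add: DERIV_def spow_def)
  qed
qed

lemma mean_value_unordered:
  fixes f f' :: "real \<Rightarrow> real"
  assumes "\<And>z. (f has_real_derivative f' z) (at z)"
  obtains \<xi> where "min a b \<le> \<xi>" "\<xi> \<le> max a b" "f b - f a = f' \<xi> * (b - a)"
proof -
  consider "a < b" | "b < a" | "a = b" by linarith
  then show ?thesis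
  proof cases
    case 1
    obtain z where "a < z" "z < b" "f b - f a = (b - a) * f' z"
      using MVT2[OF 1 assms] by blast
    then show ?thesis using 1 by (intro that[of z]) (auto simp: mult.commute)
  next
    case 2
    obtain z where "b < z" "z < a" "f a - f b = (a - b) * f' z"
      using MVT2[OF 2 assms] by blast
    then show ?thesis using 2 by (intro that[of z]) (auto simp: algebra_simps)
  qed (use that in auto)
qed

text \<open>By homogeneity it suffices to treat the base point \<open>1\<close>, where \<open>spow q\<close> is continuous: small
  increments are absorbed by \<open>\<eta>\<close> and the others are comparable to their own size.\<close>

lemma spow_increment_bound:
  assumes q: "q > 0" and \<eta>: "\<eta> > 0"
  obtains C where "C \<ge> 0" "\<And>a c. \<bar>spow q (a + c) - spow q a\<bar> \<le> \<eta> * \<bar>a\<bar> powr q + C * \<bar>c\<bar> powr q"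
proof -
  have "isCont (spow q) 1"
    unfolding spow_def by (intro continuous_intros) auto
  then obtain \<delta> where \<delta>: "\<delta> > 0" "\<And>z. \<bar>z - 1\<bar> < \<delta> \<Longrightarrow> \<bar>spow q z - spow q 1\<bar> < \<eta>"
    using \<eta> unfolding continuous_at_eps_delta dist_real_def by meson
  define C where "C = 2 * (1 / \<delta> + 1) powr q"
  have C: "C \<ge> 2"
    using \<delta> q by (simp add: C_def ge_one_powr_ge_zero)
  have one: "\<bar>spow q (1 + z) - spow q 1\<bar> \<le> \<eta> + C * \<bar>z\<bar> powr q" for z
  proof (cases "\<bar>z\<bar> < \<delta>")
    case True
    then have "\<bar>spow q (1 + z) - spow q 1\<bar> \<le> \<eta>" using \<delta>(2)[of "1 + z"] by simp
    moreover have "0 \<le> C * \<bar>z\<bar> powr q" using C by simp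
    ultimately show ?thesis by linarith
  next
    case False
    have "\<bar>spow q (1 + z) - spow q 1\<bar> \<le> \<bar>1 + z\<bar> powr q + 1"
      using abs_triangle_ineq4[of "spow q (1 + z)" "spow q 1"] by (simp add: abs_spow)
    also have "\<dots> \<le> (1 + \<bar>z\<bar>) powr q + (1 + \<bar>z\<bar>) powr q"
      using q by (intro add_mono powr_mono2) (auto intro: ge_one_powr_ge_zero)
    also have "\<dots> \<le> 2 * ((1 / \<delta> + 1) * \<bar>z\<bar>) powr q"
    proof -
      have "1 + \<bar>z\<bar> \<le> (1 / \<delta> + 1) * \<bar>z\<bar>" using False \<delta>(1) by (simp add: field_simps)
      then show ?thesis using q by (simp add: powr_mono2)
    qed
    also have "\<dots> = C * \<bar>z\<bar> powr q"
      using \<delta>(1) by (simp add: C_def powr_mult)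
    finally show ?thesis using \<eta> by linarith
  qed
  show ?thesis
  proof
    fix a c :: real
    show "\<bar>spow q (a + c) - spow q a\<bar> \<le> \<eta> * \<bar>a\<bar> powr q + C * \<bar>c\<bar> powr q"
    proof (cases "a = 0")
      case True
      have "\<bar>c\<bar> powr q \<le> C * \<bar>c\<bar> powr q" using C by (simp add: mult_right_mono mult_le_cancel_right1)
      moreover have "spow q 0 = 0" by (simp add: spow_def)
      ultimately show ?thesis using True by (simp add: abs_spow)
    next
      case False
      define z where "z = c / a"
      have c: "c = a * z" and ac: "a + c = a * (1 + z)" using False by (auto simp: z_def field_simps)
      have "\<bar>spow q (a + c) - spow q a\<bar> = \<bar>spow q a * (spow q (1 + z) - spow q 1)\<bar>"
        unfolding ac spow_mult by (simp add: spow_def algebra_simps)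
      also have "\<dots> \<le> \<bar>a\<bar> powr q * (\<eta> + C * \<bar>z\<bar> powr q)"
        unfolding abs_mult abs_spow by (intro mult_left_mono one) auto
      also have "\<dots> = \<eta> * \<bar>a\<bar> powr q + C * \<bar>c\<bar> powr q"
        by (simp add: c abs_mult powr_mult algebra_simps)
      finally show ?thesis .
    qed
  qed (use C in simp)
qed

text \<open>Continuity of \<open>p\<close>-th powers of norms without extracting roots: the inequality can be integrated
  against any measure and then multiplied by bounded weights of either sign.\<close>

lemma powr_increment_bound:
  fixes p \<eta> :: real
  assumes "p > 0" "\<eta> > 0"
  obtains C where "C \<ge> 0" "\<And>a b. abs (\<bar>a\<bar> powr p - \<bar>b\<bar> powr p) \<le> \<eta> * \<bar>b\<bar> powr p + C * \<bar>a - b\<bar> powr p"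
proof -
  obtain C where C: "C \<ge> 0"
    "\<And>a c. \<bar>spow p (a + c) - spow p a\<bar> \<le> \<eta> * \<bar>a\<bar> powr p + C * \<bar>c\<bar> powr p"
    using spow_increment_bound[OF assms] by metis
  show ?thesis
  proof (rule that[OF C(1)])
    fix a b :: real
    have "abs (\<bar>a\<bar> powr p - \<bar>b\<bar> powr p) \<le> \<bar>spow p a - spow p b\<bar>"
      using abs_triangle_ineq3[of "spow p a" "spow p b"] by (simp add: abs_spow)
    then show "abs (\<bar>a\<bar> powr p - \<bar>b\<bar> powr p) \<le> \<eta> * \<bar>b\<bar> powr p + C * \<bar>a - b\<bar> powr p"
      using C(2)[of b "a - b"] by simp
  qed
qed

lemma powr_young: 
  fixes a b :: real assumes "p \<ge> 1"
  shows "\<bar>a\<bar> powr (p - 1) * \<bar>b\<bar> \<le> \<bar>a\<bar> powr p + \<bar>b\<bar> powr p"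
proof -
  have "\<bar>a\<bar> powr (p - 1) * \<bar>b\<bar> \<le> max \<bar>a\<bar> \<bar>b\<bar> powr (p - 1) * max \<bar>a\<bar> \<bar>b\<bar>"
    using assms by (intro mult_mono powr_mono2) auto
  also have "\<dots> = max \<bar>a\<bar> \<bar>b\<bar> powr p"
    using abs_powr_pos_eq[of "max \<bar>a\<bar> \<bar>b\<bar>" p] by simp
  also have "\<dots> \<le> \<bar>a\<bar> powr p + \<bar>b\<bar> powr p"
    by (auto simp: max_def)
  finally show ?thesis .
qed

text \<open>The remainder of the first-order expansion is small relative to \<open>t\<close>, uniformly when
  \<open>\<bar>a\<bar> powr p\<close> and \<open>\<bar>b\<bar> powr p\<close> are replaced by integrals over different measures.  This is what
  allows differentiating a limit of energies.\<close>

lemma powr_taylor_bound: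
  assumes p: "p > 1" and \<eta>: "\<eta> > 0"
  obtains C where "C \<ge> 0" "\<And>a b t. \<bar>t\<bar> \<le> 1 \<Longrightarrow>
    abs (\<bar>a + t * b\<bar> powr p - \<bar>a\<bar> powr p - p * t * (spow (p - 1) a * b))
      \<le> \<bar>t\<bar> * (\<eta> + C * \<bar>t\<bar> powr (p - 1)) * (\<bar>a\<bar> powr p + \<bar>b\<bar> powr p)"
proof -
  obtain C where C: "C \<ge> 0"
    "\<And>a c. \<bar>spow (p - 1) (a + c) - spow (p - 1) a\<bar> \<le> \<eta> / p * \<bar>a\<bar> powr (p - 1) + C * \<bar>c\<bar> powr (p - 1)"
    using spow_increment_bound[of "p - 1" "\<eta> / p"] p \<eta> by auto
  show ?thesis
  proof (rule that[of "p * C"])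
    fix a b t :: real assume t: "\<bar>t\<bar> \<le> 1"
    obtain \<xi> where \<xi>: "min a (a + t * b) \<le> \<xi>" "\<xi> \<le> max a (a + t * b)"
      "\<bar>a + t * b\<bar> powr p - \<bar>a\<bar> powr p = p * spow (p - 1) \<xi> * ((a + t * b) - a)"
      using mean_value_unordered[OF abs_powr_has_derivative[OF p], of a "a + t * b"] by blast
    have "\<bar>\<xi> - a\<bar> \<le> \<bar>t * b\<bar>" using \<xi>(1,2) by linarith
    then have *: "\<bar>\<xi> - a\<bar> powr (p - 1) \<le> \<bar>t * b\<bar> powr (p - 1)"
      using p by (intro powr_mono2) auto
    have "\<bar>spow (p - 1) \<xi> - spow (p - 1) a\<bar> \<le> \<eta> / p * \<bar>a\<bar> powr (p - 1) + C * \<bar>t * b\<bar> powr (p - 1)"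
      using C(2)[of a "\<xi> - a"] mult_left_mono[OF * C(1)] by simp
    then have "p * \<bar>t * b\<bar> * \<bar>spow (p - 1) \<xi> - spow (p - 1) a\<bar>
        \<le> p * \<bar>t * b\<bar> * (\<eta> / p * \<bar>a\<bar> powr (p - 1) + C * \<bar>t * b\<bar> powr (p - 1))"
      using p by (intro mult_left_mono) auto
    also have "\<dots> = \<bar>t\<bar> * (\<eta> * (\<bar>a\<bar> powr (p - 1) * \<bar>b\<bar>)
        + p * C * \<bar>t\<bar> powr (p - 1) * (\<bar>b\<bar> powr (p - 1) * \<bar>b\<bar>))"
      using p by (simp add: abs_mult powr_mult algebra_simps)
    also have "\<dots> \<le> \<bar>t\<bar> * (\<eta> * (\<bar>a\<bar> powr p + \<bar>b\<bar> powr p)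
        + p * C * \<bar>t\<bar> powr (p - 1) * (\<bar>a\<bar> powr p + \<bar>b\<bar> powr p))"
      unfolding abs_powr_pos_eq using \<eta> p C(1)
      by (intro mult_left_mono add_mono powr_young) auto
    also have "\<dots> = \<bar>t\<bar> * (\<eta> + p * C * \<bar>t\<bar> powr (p - 1)) * (\<bar>a\<bar> powr p + \<bar>b\<bar> powr p)"
      by (simp add: algebra_simps)
    finally have "p * \<bar>t * b\<bar> * \<bar>spow (p - 1) \<xi> - spow (p - 1) a\<bar>
      \<le> \<bar>t\<bar> * (\<eta> + p * C * \<bar>t\<bar> powr (p - 1)) * (\<bar>a\<bar> powr p + \<bar>b\<bar> powr p)" .
    moreover have "abs (\<bar>a + t * b\<bar> powr p - \<bar>a\<bar> powr p - p * t * (spow (p - 1) a * b))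
      = \<bar>p * (t * b) * (spow (p - 1) \<xi> - spow (p - 1) a)\<bar>"
      unfolding \<xi>(3) by (simp add: algebra_simps)
    moreover have "\<dots> = p * \<bar>t * b\<bar> * \<bar>spow (p - 1) \<xi> - spow (p - 1) a\<bar>"
      using p by (simp add: abs_mult)
    ultimately show "abs (\<bar>a + t * b\<bar> powr p - \<bar>a\<bar> powr p - p * t * (spow (p - 1) a * b))
      \<le> \<bar>t\<bar> * (\<eta> + p * C * \<bar>t\<bar> powr (p - 1)) * (\<bar>a\<bar> powr p + \<bar>b\<bar> powr p)" by linarith
  qed (use C p in auto)
qed

text \<open>The derivative \<open>spow (p - 1)\<close> is strictly increasing, so the increase over the right half of the
  interval exceeds the one over the left half.\<close>

lemma powr_midpoint_less:
  fixes a b :: real assumes p: "p > 1" and "a \<noteq> b"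
  shows "\<bar>(a + b) / 2\<bar> powr p < (\<bar>a\<bar> powr p + \<bar>b\<bar> powr p) / 2"
proof -
  have *: "\<bar>(a + b) / 2\<bar> powr p < (\<bar>a\<bar> powr p + \<bar>b\<bar> powr p) / 2" if "a < b" for a b :: real
  proof -
    define c where "c = (a + b) / 2"
    have c: "a < c" "c < b" "b - c = c - a" using that by (auto simp: c_def field_simps)
    obtain \<xi> where \<xi>: "a < \<xi>" "\<xi> < c" "\<bar>c\<bar> powr p - \<bar>a\<bar> powr p = (c - a) * (p * spow (p - 1) \<xi>)"
      using MVT2[OF c(1) abs_powr_has_derivative[OF p]] by blast
    obtain \<zeta> where \<zeta>: "c < \<zeta>" "\<zeta> < b" "\<bar>b\<bar> powr p - \<bar>c\<bar> powr p = (b - c) * (p * spow (p - 1) \<zeta>)"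
      using MVT2[OF c(2) abs_powr_has_derivative[OF p]] by blast
    have "spow (p - 1) \<xi> < spow (p - 1) \<zeta>"
      using spow_less[of "p - 1" \<xi> \<zeta>] p \<xi> \<zeta> by auto
    then have "(c - a) * (p * spow (p - 1) \<xi>) < (c - a) * (p * spow (p - 1) \<zeta>)"
      using p c by simp
    then have "\<bar>c\<bar> powr p - \<bar>a\<bar> powr p < \<bar>b\<bar> powr p - \<bar>c\<bar> powr p"
      by (simp only: \<xi>(3) \<zeta>(3) c(3))
    then show ?thesis unfolding c_def[symmetric] by simp
  qed
  show ?thesis
    using *[of a b] *[of b a] assms(2) by (cases "a < b") (auto simp: add.commute)
qed

lemma powr_midpoint_le:
  fixes a b :: real assumes p: "p > 1"
  shows "\<bar>(a + b) / 2\<bar> powr p \<le> (\<bar>a\<bar> powr p + \<bar>b\<bar> powr p) / 2"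
  using powr_midpoint_less[OF p, of a b] by (cases "a = b") auto

text \<open>Uniform convexity, in a form that survives integration.  On the compact set where
  \<open>\<bar>a\<bar> powr p + \<bar>b\<bar> powr p = 1\<close> and \<open>\<bar>a - b\<bar> powr p \<ge> \<eta>\<close> the convexity defect of the midpoint has a
  positive minimum; homogeneity does the rest.\<close>

lemma powr_uniformly_convex:
  assumes p: "p > 1" and \<eta>: "\<eta> > 0"
  obtains C where "C \<ge> 0" "\<And>a b :: real. \<bar>a - b\<bar> powr p \<le> \<eta> * (\<bar>a\<bar> powr p + \<bar>b\<bar> powr p)
    + C * ((\<bar>a\<bar> powr p + \<bar>b\<bar> powr p) / 2 - \<bar>(a + b) / 2\<bar> powr p)"
proof -
  define def where "def z = (\<bar>fst z\<bar> powr p + \<bar>snd z\<bar> powr p) / 2 - \<bar>(fst z + snd z) / 2\<bar> powr p"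
    for z :: "real \<times> real"
  define S where "S = {z :: real \<times> real. \<bar>fst z\<bar> powr p + \<bar>snd z\<bar> powr p = 1 \<and> \<bar>fst z - snd z\<bar> powr p \<ge> \<eta>}"
  have c1: "continuous_on UNIV (\<lambda>z :: real \<times> real. \<bar>fst z\<bar> powr p + \<bar>snd z\<bar> powr p)"
    and c2: "continuous_on UNIV (\<lambda>z :: real \<times> real. \<bar>fst z - snd z\<bar> powr p)"
    and c3: "continuous_on UNIV def"
    using p unfolding def_def by (auto intro!: continuous_intros continuous_on_powr')
  have le1: "\<bar>x\<bar> \<le> 1" if "\<bar>x\<bar> powr p \<le> 1" for x :: real
    using that p powr_less_mono2[of p 1 "\<bar>x\<bar>"] by fastforce
  have "closed S"
  proof -
    have "S = {z. \<bar>fst z\<bar> powr p + \<bar>snd z\<bar> powr p = 1} \<inter> {z. \<eta> \<le> \<bar>fst z - snd z\<bar> powr p}"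
      by (auto simp: S_def)
    then show ?thesis using c1 c2 by (auto intro!: closed_Int closed_Collect_eq closed_Collect_le)
  qed
  moreover have "bounded S"
  proof -
    have "S \<subseteq> {-1..1} \<times> {-1..1}"
    proof
      fix z assume z: "z \<in> S"
      have "\<bar>fst z\<bar> powr p \<le> 1" "\<bar>snd z\<bar> powr p \<le> 1"
        using z powr_ge_zero[of "\<bar>fst z\<bar>" p] powr_ge_zero[of "\<bar>snd z\<bar>" p] unfolding S_def mem_Collect_eq
        by linarith+
      then have "\<bar>fst z\<bar> \<le> 1" "\<bar>snd z\<bar> \<le> 1" using le1 by auto
      then show "z \<in> {-1..1} \<times> {-1..1}" by (cases z) auto
    qed
    then show ?thesis by (rule bounded_subset[rotated]) (auto intro: bounded_Times)
  qed
  ultimately have "compact S" by (simp add: compact_eq_bounded_closed)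
  have pos: "def z > 0" if "z \<in> S" for z
  proof -
    have "fst z \<noteq> snd z" using that \<eta> by (auto simp: S_def)
    then show ?thesis using powr_midpoint_less[OF p, of "fst z" "snd z"] by (simp add: def_def)
  qed
  obtain \<delta> where \<delta>: "\<delta> > 0" "\<And>z. z \<in> S \<Longrightarrow> \<delta> \<le> def z"
  proof (cases "S = {}")
    case False
    then obtain z0 where "z0 \<in> S" "\<And>z. z \<in> S \<Longrightarrow> def z0 \<le> def z"
      using continuous_attains_inf[OF \<open>compact S\<close> _ continuous_on_subset[OF c3]] by blast
    then show ?thesis using pos that by blast
  qed (use that[of 1] in auto)
  define C where "C = 2 powr p / \<delta>"
  have C: "C > 0" using \<delta> by (simp add: C_def)
  have def0: "def z \<ge> 0" for z using powr_midpoint_le[OF p, of "fst z" "snd z"] by (simp add: def_def)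
  have unit: "\<bar>a - b\<bar> powr p \<le> \<eta> + C * def (a, b)" if 1: "\<bar>a\<bar> powr p + \<bar>b\<bar> powr p = 1" for a b
  proof (cases "(a, b) \<in> S")
    case True
    have "\<bar>a\<bar> \<le> 1" "\<bar>b\<bar> \<le> 1"
    proof -
      have "\<bar>a\<bar> powr p \<le> 1" "\<bar>b\<bar> powr p \<le> 1"
        using 1 powr_ge_zero[of "\<bar>a\<bar>" p] powr_ge_zero[of "\<bar>b\<bar>" p] by linarith+
      then show "\<bar>a\<bar> \<le> 1" "\<bar>b\<bar> \<le> 1" by (auto intro: le1)
    qed
    then have "\<bar>a - b\<bar> powr p \<le> 2 powr p" using p by (intro powr_mono2) auto
    also have "\<dots> = C * \<delta>" using \<delta> by (simp add: C_def)
    also have "\<dots> \<le> C * def (a, b)" using \<delta>(2)[OF True] C by simp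
    finally show ?thesis using \<eta> by linarith
  next
    case False
    then have "\<bar>a - b\<bar> powr p < \<eta>" using 1 by (auto simp: S_def)
    moreover have "0 \<le> C * def (a, b)" using C def0 by simp
    ultimately show ?thesis by linarith
  qed
  show ?thesis
  proof (rule that[of C])
    fix a b :: real
    define s where "s = \<bar>a\<bar> powr p + \<bar>b\<bar> powr p"
    have s0: "s \<ge> 0" by (simp add: s_def)
    show "\<bar>a - b\<bar> powr p \<le> \<eta> * (\<bar>a\<bar> powr p + \<bar>b\<bar> powr p)
      + C * ((\<bar>a\<bar> powr p + \<bar>b\<bar> powr p) / 2 - \<bar>(a + b) / 2\<bar> powr p)"
    proof (cases "s = 0")
      case True
      then have "\<bar>a\<bar> powr p = 0" "\<bar>b\<bar> powr p = 0"
        unfolding s_def using powr_ge_zero[of "\<bar>a\<bar>" p] powr_ge_zero[of "\<bar>b\<bar>" p] by linarith+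
      then show ?thesis by simp
    next
      case False
      define l where "l = s powr (1 / p)"
      have l: "l > 0" "l powr p = s" using False s0 p by (auto simp: l_def powr_powr)
      have sc: "\<bar>x / l\<bar> powr p = \<bar>x\<bar> powr p / s" for x
        using l by (simp add: powr_divide)
      have "\<bar>a / l\<bar> powr p + \<bar>b / l\<bar> powr p = 1"
        unfolding sc using False by (simp add: s_def add_divide_distrib[symmetric])
      from unit[OF this] have "\<bar>(a - b) / l\<bar> powr p \<le> \<eta> + C * def (a / l, b / l)"
        by (simp add: diff_divide_distrib)
      moreover have "def (a / l, b / l) = def (a, b) / s"
      proof -
        have "(a / l + b / l) / 2 = ((a + b) / 2) / l" by (simp add: add_divide_distrib)
        then show ?thesis unfolding def_def fst_conv snd_conv
          by (simp only: sc) (simp add: diff_divide_distrib add_divide_distrib)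
      qed
      ultimately have "\<bar>a - b\<bar> powr p / s \<le> \<eta> + C * (def (a, b) / s)" by (simp only: sc)
      then have "\<bar>a - b\<bar> powr p \<le> \<eta> * s + C * def (a, b)"
        using False s0 by (simp add: field_simps)
      then show ?thesis by (simp add: def_def s_def)
    qed
  qed (use C in simp)
qed

text \<open>The exact cancellation behind the formula for the energy measure: with \<open>v = \<bar>u\<bar> powr (p / (p - 1))\<close>,
  the mean value theorem gives \<open>v a - v b = v' \<xi> * (a - b)\<close>, and \<open>spow (p - 1)\<close> turns the factor
  \<open>v' \<xi>\<close> into a constant multiple of \<open>\<xi>\<close> itself.\<close>

lemma conjugate_power_cancellation:
  fixes a b p :: real
  assumes p: "p > 1"
  defines "v \<equiv> \<lambda>z. \<bar>z\<bar> powr (p / (p - 1))"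
  shows "\<bar>b * spow (p - 1) (a - b) - ((p - 1) / p) powr (p - 1) * spow (p - 1) (v a - v b)\<bar>
    \<le> \<bar>a - b\<bar> powr p"
proof -
  define q where "q = p / (p - 1)"
  have q: "q > 1" and q1: "(q - 1) * (p - 1) = 1" "q > 0" and qp: "(p - 1) / p = 1 / q"
    using p by (auto simp: q_def field_simps)
  obtain \<xi> where \<xi>: "min b a \<le> \<xi>" "\<xi> \<le> max b a" "v a - v b = q * spow (q - 1) \<xi> * (a - b)"
    using mean_value_unordered[OF abs_powr_has_derivative[OF q], of b a]
    unfolding v_def q_def by blast
  have "spow (p - 1) (q * spow (q - 1) \<xi>) = q powr (p - 1) * \<xi>"
  proof -
    have "spow (p - 1) (spow (q - 1) \<xi>) = \<xi>"
    proof -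
      have "sgn (spow (q - 1) \<xi>) = sgn \<xi>"
        by (cases "\<xi> = 0") (auto simp: spow_def sgn_mult sgn_if)
      then have "spow (p - 1) (spow (q - 1) \<xi>) = sgn \<xi> * (\<bar>\<xi>\<bar> powr (q - 1)) powr (p - 1)"
        by (simp add: spow_def[of "p - 1"] abs_spow)
      also have "\<dots> = \<xi>" using q1(1) by (simp add: powr_powr sgn_mult_abs)
      finally show ?thesis .
    qed
    moreover have "spow (p - 1) q = q powr (p - 1)" using q1 by (simp add: spow_def)
    ultimately show ?thesis by (simp add: spow_mult)
  qed
  then have "((p - 1) / p) powr (p - 1) * spow (p - 1) (v a - v b) = \<xi> * spow (p - 1) (a - b)"
    unfolding \<xi>(3) spow_mult[of _ _ "a - b"] qp using q1
    by (simp add: powr_divide)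
  then have "\<bar>b * spow (p - 1) (a - b) - ((p - 1) / p) powr (p - 1) * spow (p - 1) (v a - v b)\<bar>
    = \<bar>b - \<xi>\<bar> * \<bar>a - b\<bar> powr (p - 1)"
    by (simp add: left_diff_distrib[symmetric] abs_mult abs_spow)
  also have "\<dots> \<le> \<bar>a - b\<bar> * \<bar>a - b\<bar> powr (p - 1)"
    using \<xi>(1,2) by (intro mult_right_mono) auto
  also have "\<dots> = \<bar>a - b\<bar> powr p" using abs_powr_pos_eq[of "a - b" p] by (simp add: mult.commute)
  finally show ?thesis .
qed

lemma powr_sum_bound:
  fixes b :: "nat \<Rightarrow> real"
  assumes p: "p > 0" and C: "C \<ge> 0" and "\<bar>a\<bar> \<le> C * (\<Sum>i<n. \<bar>b i\<bar>)"
  shows "\<bar>a\<bar> powr p \<le> (C * n) powr p * (\<Sum>i<n. \<bar>b i\<bar> powr p)"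
proof (cases "n = 0")
  case False
  define M where "M = Max ((\<lambda>i. \<bar>b i\<bar>) ` {..<n})"
  have fin: "finite ((\<lambda>i. \<bar>b i\<bar>) ` {..<n})" "(\<lambda>i. \<bar>b i\<bar>) ` {..<n} \<noteq> {}" using False by auto
  have le: "\<bar>b i\<bar> \<le> M" if "i < n" for i unfolding M_def using that by (intro Max_ge) auto
  have "M \<in> (\<lambda>i. \<bar>b i\<bar>) ` {..<n}" unfolding M_def using fin by (rule Max_in)
  then obtain j where j: "j < n" "M = \<bar>b j\<bar>" by auto
  have "(\<Sum>i<n. \<bar>b i\<bar>) \<le> n * M" using sum_bounded_above[of "{..<n}" "\<lambda>i. \<bar>b i\<bar>" M] le by auto
  then have "\<bar>a\<bar> \<le> C * (n * M)" using assms(3) C by (meson mult_left_mono order_trans)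
  then have "\<bar>a\<bar> powr p \<le> (C * (n * M)) powr p" using p by (intro powr_mono2) auto
  also have "\<dots> = (C * n) powr p * M powr p" using C j by (simp add: powr_mult)
  also have "M powr p \<le> (\<Sum>i<n. \<bar>b i\<bar> powr p)"
    unfolding j(2) using j(1) by (intro member_le_sum) auto
  finally show ?thesis by (simp add: mult_left_mono)
qed (use assms in auto)


section \<open>Integrals of powers\<close>

lemma Lp_iff_integrable:
  "F \<in> Lp p N \<longleftrightarrow> F \<in> borel_measurable N \<and> integrable N (\<lambda>z. \<bar>F z\<bar> powr p)"
  by (auto simp: Lp_def integrable_iff_bounded)

lemma LpD:
  assumes "F \<in> Lp p N"
  shows "F \<in> borel_measurable N" "integrable N (\<lambda>z. \<bar>F z\<bar> powr p)"
  using assms by (simp_all add: Lp_iff_integrable)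

lemma Lp_dominated:
  fixes G :: "nat \<Rightarrow> 'b \<Rightarrow> real"
  assumes p: "p > 0" and F: "F \<in> borel_measurable N" and G: "\<And>i. i < n \<Longrightarrow> G i \<in> Lp p N"
    and C: "C \<ge> 0" and le: "\<And>z. \<bar>F z\<bar> \<le> C * (\<Sum>i<n. \<bar>G i z\<bar>)"
  shows "F \<in> Lp p N"
    and "(LINT z|N. \<bar>F z\<bar> powr p) \<le> (C * n) powr p * (\<Sum>i<n. LINT z|N. \<bar>G i z\<bar> powr p)"
proof -
  have int: "integrable N (\<lambda>z. (C * n) powr p * (\<Sum>i<n. \<bar>G i z\<bar> powr p))"
    using G by (intro integrable_mult_right Bochner_Integration.integrable_sum) (auto dest: LpD)
  have le': "\<bar>F z\<bar> powr p \<le> (C * n) powr p * (\<Sum>i<n. \<bar>G i z\<bar> powr p)" for z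
    by (rule powr_sum_bound[OF p C le])
  have intF: "integrable N (\<lambda>z. \<bar>F z\<bar> powr p)"
    by (rule Bochner_Integration.integrable_bound[OF int])
       (use F le' in \<open>auto intro!: AE_I2 order_trans[OF le' abs_ge_self]\<close>)
  then show "F \<in> Lp p N" using F by (simp add: Lp_iff_integrable)
  have "(LINT z|N. \<bar>F z\<bar> powr p) \<le> (LINT z|N. (C * n) powr p * (\<Sum>i<n. \<bar>G i z\<bar> powr p))"
    by (rule integral_mono[OF intF int]) (rule le')
  also have "\<dots> = (C * n) powr p * (\<Sum>i<n. LINT z|N. \<bar>G i z\<bar> powr p)"
    using G by (subst integral_mult_right_zero, subst Bochner_Integration.integral_sum) (auto dest: LpD)
  finally show "(LINT z|N. \<bar>F z\<bar> powr p) \<le> (C * n) powr p * (\<Sum>i<n. LINT z|N. \<bar>G i z\<bar> powr p)" .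
qed

lemma Lp_add: 
  assumes "p > 0" "F \<in> Lp p N" "H \<in> Lp p N"
  shows "(\<lambda>z. F z + t * H z) \<in> Lp p N"
proof -
  note [measurable] = LpD(1)[OF assms(2)] LpD(1)[OF assms(3)]
  show ?thesis
  proof (rule Lp_dominated(1)[where n=2 and C="1 + \<bar>t\<bar>" and G="\<lambda>i. if i = 0 then F else H"])
  fix z
  have "\<bar>F z + t * H z\<bar> \<le> 1 * \<bar>F z\<bar> + \<bar>t\<bar> * \<bar>H z\<bar>"
    using abs_triangle_ineq[of "F z" "t * H z"] by (simp add: abs_mult)
  also have "\<dots> \<le> (1 + \<bar>t\<bar>) * \<bar>F z\<bar> + (1 + \<bar>t\<bar>) * \<bar>H z\<bar>"
    by (intro add_mono mult_right_mono) auto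
  finally show "\<bar>F z + t * H z\<bar> \<le> (1 + \<bar>t\<bar>) * (\<Sum>i<(2::nat). \<bar>(if i = 0 then F else H) z\<bar>)"
    by (simp add: numeral_2_eq_2 algebra_simps)
qed (use assms in auto)
qed

lemma integrable_spow_mult:
  assumes p: "p > 1" and F: "F \<in> Lp p N" and H: "H \<in> Lp p N"
  shows "integrable N (\<lambda>z. spow (p - 1) (F z) * H z)"
proof (rule Bochner_Integration.integrable_bound)
  show "integrable N (\<lambda>z. \<bar>F z\<bar> powr p + \<bar>H z\<bar> powr p)"
    using F H by (auto dest: LpD)
  show "(\<lambda>z. spow (p - 1) (F z) * H z) \<in> borel_measurable N"
    using LpD(1)[OF F] LpD(1)[OF H] by measurable
  show "AE z in N. norm (spow (p - 1) (F z) * H z) \<le> norm (\<bar>F z\<bar> powr p + \<bar>H z\<bar> powr p)"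
    using powr_young[of p] p by (intro AE_I2) (simp add: abs_mult abs_spow)
qed

text \<open>The derivatives at \<open>0\<close> of \<open>t \<mapsto> \<integral>\<bar>F n + t H n\<bar>\<^sup>p\<close> converge to the derivative of the limit, because
  the first-order remainder is controlled uniformly in \<open>n\<close>.  In particular the limit function is
  differentiable at \<open>0\<close>.\<close>

lemma derivative_of_power_integral_limit:
  fixes F H :: "nat \<Rightarrow> 'b \<Rightarrow> real" and N :: "nat \<Rightarrow> 'b measure"
  assumes p: "p > 1" and F: "\<And>n. F n \<in> Lp p (N n)" and H: "\<And>n. H n \<in> Lp p (N n)"
    and FM: "\<And>n. (LINT z|N n. \<bar>F n z\<bar> powr p) \<le> M" and HM: "\<And>n. (LINT z|N n. \<bar>H n z\<bar> powr p) \<le> M"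
    and lim: "\<And>t. (\<lambda>n. LINT z|N n. \<bar>F n z + t * H n z\<bar> powr p) \<longlonglongrightarrow> h t"
  obtains D where "(\<lambda>n. LINT z|N n. spow (p - 1) (F n z) * H n z) \<longlonglongrightarrow> D"
    and "(h has_real_derivative p * D) (at 0)"
proof -
  define D where "D n = (LINT z|N n. spow (p - 1) (F n z) * H n z)" for n
  define hh where "hh n t = (LINT z|N n. \<bar>F n z + t * H n z\<bar> powr p)" for n t
  have M: "M \<ge> 0" using FM[of 0] by (rule order_trans[rotated]) (simp add: integral_nonneg_AE)
  have rem: "\<exists>C\<ge>0. \<forall>n t. \<bar>t\<bar> \<le> 1 \<longrightarrow> \<bar>hh n t - hh n 0 - p * t * D n\<bar> \<le> \<bar>t\<bar> * (\<eta> + C * \<bar>t\<bar> powr (p - 1)) * (2 * M)"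
    if \<eta>: "\<eta> > 0" for \<eta>
  proof -
    obtain C where C: "C \<ge> 0" "\<And>a b t. \<bar>t\<bar> \<le> 1 \<Longrightarrow>
      abs (\<bar>a + t * b\<bar> powr p - \<bar>a\<bar> powr p - p * t * (spow (p - 1) a * b))
        \<le> \<bar>t\<bar> * (\<eta> + C * \<bar>t\<bar> powr (p - 1)) * (\<bar>a\<bar> powr p + \<bar>b\<bar> powr p)"
      by (rule powr_taylor_bound[OF p \<eta>]) blast
    have "\<bar>hh n t - hh n 0 - p * t * D n\<bar> \<le> \<bar>t\<bar> * (\<eta> + C * \<bar>t\<bar> powr (p - 1)) * (2 * M)"
      if t: "\<bar>t\<bar> \<le> 1" for n t
    proof -
      let ?c = "\<bar>t\<bar> * (\<eta> + C * \<bar>t\<bar> powr (p - 1))"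
      have c: "?c \<ge> 0" using \<eta> C by simp
      have ii: "integrable (N n) (\<lambda>z. \<bar>F n z + t * H n z\<bar> powr p)"
        using p by (intro LpD(2) Lp_add F H) simp
      note i = integrable_spow_mult[OF p F[of n] H[of n]] LpD(2)[OF F[of n]] LpD(2)[OF H[of n]]
      define \<rho> where "\<rho> z = \<bar>F n z + t * H n z\<bar> powr p - \<bar>F n z\<bar> powr p
        - p * t * (spow (p - 1) (F n z) * H n z)" for z
      have \<rho>: "integrable (N n) \<rho>" unfolding \<rho>_def
        by (intro Bochner_Integration.integrable_diff integrable_mult_right i ii)
      have "hh n t - hh n 0 - p * t * D n = (LINT z|N n. \<rho> z)"
        unfolding hh_def D_def \<rho>_def using i ii by simp
      also have "\<bar>\<dots>\<bar> \<le> (LINT z|N n. \<bar>\<rho> z\<bar>)"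
        by (rule integral_abs_bound)
      also have "\<dots> \<le> (LINT z|N n. ?c * (\<bar>F n z\<bar> powr p + \<bar>H n z\<bar> powr p))"
      proof (rule integral_mono)
        show "integrable (N n) (\<lambda>z. ?c * (\<bar>F n z\<bar> powr p + \<bar>H n z\<bar> powr p))"
          by (intro integrable_mult_right Bochner_Integration.integrable_add i)
        show "\<bar>\<rho> z\<bar> \<le> ?c * (\<bar>F n z\<bar> powr p + \<bar>H n z\<bar> powr p)" for z
          unfolding \<rho>_def by (rule C(2)[OF t])
      qed (use \<rho> in simp)
      also have "\<dots> = ?c * ((LINT z|N n. \<bar>F n z\<bar> powr p) + (LINT z|N n. \<bar>H n z\<bar> powr p))"
        by (simp only: integral_mult_right_zero Bochner_Integration.integral_add[OF i(2,3)])
      also have "\<dots> \<le> ?c * (2 * M)"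
        using FM[of n] HM[of n] by (intro mult_left_mono c) auto
      finally show ?thesis .
    qed
    then show ?thesis using C(1) by blast
  qed
  have small: "\<exists>d>0. d \<le> 1 \<and> (\<forall>n t. t \<noteq> 0 \<and> \<bar>t\<bar> < d \<longrightarrow> \<bar>(hh n t - hh n 0) / t - p * D n\<bar> \<le> e)"
    if e: "e > 0" for e
  proof -
    define \<eta> where "\<eta> = e / (4 * (M + 1))"
    have \<eta>: "\<eta> > 0" using e M by (simp add: \<eta>_def)
    obtain C where C: "C \<ge> 0" "\<And>n t. \<bar>t\<bar> \<le> 1 \<Longrightarrow>
        \<bar>hh n t - hh n 0 - p * t * D n\<bar> \<le> \<bar>t\<bar> * (\<eta> + C * \<bar>t\<bar> powr (p - 1)) * (2 * M)"
      using rem[OF \<eta>] by blast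
    have "((\<lambda>t::real. C * \<bar>t\<bar> powr (p - 1)) \<longlongrightarrow> C * 0 powr (p - 1)) (at 0)"
      using p by (intro tendsto_intros tendsto_powr') (auto intro!: tendsto_eq_intros)
    then have "\<forall>\<^sub>F t in at (0::real). C * \<bar>t\<bar> powr (p - 1) < \<eta>"
      using \<eta> p by (intro order_tendstoD(2)) auto
    then obtain d where d: "d > 0" "\<And>t. t \<noteq> 0 \<Longrightarrow> \<bar>t\<bar> < d \<Longrightarrow> C * \<bar>t\<bar> powr (p - 1) < \<eta>"
      unfolding eventually_at by (auto simp: dist_real_def)
    show ?thesis
    proof (intro exI[of _ "min d 1"] conjI allI impI)
      fix n t assume "t \<noteq> 0 \<and> \<bar>t\<bar> < min d 1"
      then have t: "t \<noteq> 0" "\<bar>t\<bar> < d" "\<bar>t\<bar> \<le> 1" by auto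
      have "t * ((hh n t - hh n 0) / t - p * D n) = hh n t - hh n 0 - p * t * D n"
        using t(1) by (simp add: field_simps)
      then have "\<bar>t\<bar> * \<bar>(hh n t - hh n 0) / t - p * D n\<bar> = \<bar>hh n t - hh n 0 - p * t * D n\<bar>"
        by (simp only: abs_mult[symmetric])
      also have "\<dots> \<le> \<bar>t\<bar> * (\<eta> + C * \<bar>t\<bar> powr (p - 1)) * (2 * M)"
        by (rule C(2)[OF t(3)])
      also have "\<dots> \<le> \<bar>t\<bar> * (\<eta> + \<eta>) * (2 * M)"
      proof -
        have "\<eta> + C * \<bar>t\<bar> powr (p - 1) \<le> \<eta> + \<eta>" using d(2)[OF t(1,2)] by linarith
        then show ?thesis using M by (intro mult_right_mono mult_left_mono) linarith+
      qed
      also have "\<dots> = \<bar>t\<bar> * (4 * M * \<eta>)" by algebra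
      finally have "\<bar>(hh n t - hh n 0) / t - p * D n\<bar> \<le> 4 * M * \<eta>"
        by (rule mult_left_le_imp_le) (use t(1) in simp)
      also have "\<dots> \<le> e" using e M by (simp add: \<eta>_def field_simps)
      finally show "\<bar>(hh n t - hh n 0) / t - p * D n\<bar> \<le> e" .
    qed (use d in auto)
  qed
  have conv: "(\<lambda>n. (hh n t - hh n 0) / t) \<longlonglongrightarrow> (h t - h 0) / t" if "t \<noteq> 0" for t
    unfolding hh_def by (intro tendsto_intros lim that)
  have "Cauchy (\<lambda>n. p * D n)"
  proof (rule metric_CauchyI)
    fix e :: real assume e: "e > 0"
    obtain d where d: "d > 0" "\<And>n t. t \<noteq> 0 \<Longrightarrow> \<bar>t\<bar> < d \<Longrightarrow> \<bar>(hh n t - hh n 0) / t - p * D n\<bar> \<le> e / 4"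
      using small[of "e / 4"] e by auto
    define t where "t = d / 2"
    have t: "t \<noteq> 0" "\<bar>t\<bar> < d" using d by (auto simp: t_def)
    have "Cauchy (\<lambda>n. (hh n t - hh n 0) / t)" using conv[OF t(1)] by (rule LIMSEQ_imp_Cauchy)
    moreover have "e / 4 > 0" using e by simp
    ultimately obtain L where L: "\<And>m n. m \<ge> L \<Longrightarrow> n \<ge> L \<Longrightarrow>
      dist ((hh m t - hh m 0) / t) ((hh n t - hh n 0) / t) < e / 4"
      unfolding Cauchy_def by blast
    show "\<exists>L. \<forall>m\<ge>L. \<forall>n\<ge>L. dist (p * D m) (p * D n) < e"
    proof (intro exI[of _ L] allI impI)
      fix m n assume "m \<ge> L" "n \<ge> L"
      then show "dist (p * D m) (p * D n) < e"
        using L[of m n] d(2)[OF t, of m] d(2)[OF t, of n] e unfolding dist_real_def by linarith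
    qed
  qed
  then obtain D1 where D1: "(\<lambda>n. p * D n) \<longlonglongrightarrow> D1"
    by (auto simp: Cauchy_convergent_iff convergent_def)
  have "(\<lambda>n. p * D n / p) \<longlonglongrightarrow> D1 / p" using p by (intro tendsto_divide D1) auto
  then have D: "D \<longlonglongrightarrow> D1 / p" using p by simp
  have "((\<lambda>t. (h (0 + t) - h 0) / t) \<longlongrightarrow> D1) (at 0)"
    unfolding LIM_eq
  proof (intro allI impI)
    fix e :: real assume e: "e > 0"
    obtain d where d: "d > 0" "\<And>n t. t \<noteq> 0 \<Longrightarrow> \<bar>t\<bar> < d \<Longrightarrow> \<bar>(hh n t - hh n 0) / t - p * D n\<bar> \<le> e / 2"
      using small[of "e / 2"] e by auto
    show "\<exists>s>0. \<forall>x. x \<noteq> 0 \<and> norm (x - 0) < s \<longrightarrow> norm ((h (0 + x) - h 0) / x - D1) < e"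
    proof (intro exI[of _ d] conjI allI impI)
      fix t :: real assume "t \<noteq> 0 \<and> norm (t - 0) < d"
      then have t: "t \<noteq> 0" "\<bar>t\<bar> < d" by auto
      have "(\<lambda>n. \<bar>(hh n t - hh n 0) / t - p * D n\<bar>) \<longlonglongrightarrow> \<bar>(h t - h 0) / t - D1\<bar>"
        by (intro tendsto_intros conv t D1)
      then have "\<bar>(h t - h 0) / t - D1\<bar> \<le> e / 2"
        by (rule LIMSEQ_le_const2) (use d(2)[OF t] in auto)
      then show "norm ((h (0 + t) - h 0) / t - D1) < e" using e by simp
    qed (rule d)
  qed
  then have "(h has_real_derivative p * (D1 / p)) (at 0)" using p by (simp add: DERIV_def)
  then show ?thesis using that[of "D1 / p"] D unfolding D_def by blast
qed

section \<open>Contraction inequalities between integrals\<close>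

text \<open>Convexity of \<open>t \<mapsto> t powr s\<close> in the form of its tangent at \<open>a\<close>; both Jensen's and Hoelder's inequality
  follow by summing it.\<close>

lemma powr_tangent:
  fixes a x :: real assumes "s \<ge> 1" "a \<ge> 0" "x \<ge> 0"
  shows "s * (a powr (s - 1) * x) \<le> (s - 1) * a powr s + x powr s"
proof (cases "a = 0 \<or> x = 0")
  case False
  then have ax: "a > 0" "x > 0" using assms by auto
  have "(a powr s) powr ((s - 1) / s) * (x powr s) powr (1 / s) \<le> (s - 1) / s * a powr s + 1 / s * x powr s"
    using assms ax by (intro Youngs_inequality_0) (auto simp: field_simps)
  then have "a powr (s - 1) * x \<le> (s - 1) / s * a powr s + 1 / s * x powr s"
    using assms ax by (simp add: powr_powr)
  then have "s * (a powr (s - 1) * x) \<le> s * ((s - 1) / s * a powr s + 1 / s * x powr s)"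
    using assms by (intro mult_left_mono) auto
  also have "\<dots> = (s - 1) * a powr s + x powr s" using assms by (simp add: distrib_left)
  finally show ?thesis .
qed (use assms in auto)

lemma powr_jensen:
  fixes w t :: "nat \<Rightarrow> real"
  assumes r: "r \<ge> 1" and l: "\<And>i. i < n \<Longrightarrow> w i \<ge> 0" "(\<Sum>i<n. w i) = 1" and t: "\<And>i. i < n \<Longrightarrow> t i \<ge> 0"
  shows "(\<Sum>i<n. w i * t i) powr r \<le> (\<Sum>i<n. w i * t i powr r)"
proof -
  define m where "m = (\<Sum>i<n. w i * t i)"
  have m: "m \<ge> 0" unfolding m_def using l t by (intro sum_nonneg) auto
  have "r * m powr r = r * (m powr (r - 1) * m)"
    using abs_powr_pos_eq[of m r] m by simp
  also have "\<dots> = (\<Sum>i<n. w i * (r * (m powr (r - 1) * t i)))"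
    by (subst (2) m_def) (simp add: sum_distrib_left algebra_simps)
  also have "\<dots> \<le> (\<Sum>i<n. w i * ((r - 1) * m powr r + t i powr r))"
    using l t m r by (intro sum_mono mult_left_mono powr_tangent) auto
  also have "\<dots> = (r - 1) * m powr r + (\<Sum>i<n. w i * t i powr r)"
  proof -
    have "(\<Sum>i<n. w i * ((r - 1) * m powr r)) = (r - 1) * m powr r"
      using l(2) by (simp add: sum_distrib_right[symmetric])
    then show ?thesis by (simp add: distrib_left sum.distrib)
  qed
  finally show ?thesis unfolding m_def[symmetric] by (simp add: algebra_simps)
qed

lemma sum_powr_holder:
  fixes a x :: "nat \<Rightarrow> real"
  assumes s: "s \<ge> 1" and a: "\<And>i. i < n \<Longrightarrow> a i \<ge> 0" and x: "\<And>i. i < n \<Longrightarrow> x i \<ge> 0"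
  shows "(\<Sum>i<n. a i powr (s - 1) * x i) \<le> ((\<Sum>i<n. a i powr s) powr (1 / s)) powr (s - 1) * (\<Sum>i<n. x i powr s) powr (1 / s)"
proof -
  define A where "A = (\<Sum>i<n. a i powr s) powr (1 / s)"
  define X where "X = (\<Sum>i<n. x i powr s) powr (1 / s)"
  have As: "A powr s = (\<Sum>i<n. a i powr s)" and Xs: "X powr s = (\<Sum>i<n. x i powr s)"
    using s by (simp_all add: A_def X_def powr_powr sum_nonneg)
  have AX: "A \<ge> 0" "X \<ge> 0" by (auto simp: A_def X_def)
  consider "A = 0" | "X = 0" | "A > 0" "X > 0" using AX by linarith
  then show ?thesis
  proof cases
    case 1
    then have "a i = 0" if "i < n" for i
      using that s As by (auto simp: sum_nonneg_eq_0_iff)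
    then show ?thesis by simp
  next
    case 2
    then have "x i = 0" if "i < n" for i
      using that s Xs by (auto simp: sum_nonneg_eq_0_iff)
    then show ?thesis by simp
  next
    case 3
    have "s * (\<Sum>i<n. (a i / A) powr (s - 1) * (x i / X)) \<le> (\<Sum>i<n. (s - 1) * (a i / A) powr s + (x i / X) powr s)"
      unfolding sum_distrib_left using s a x 3 by (intro sum_mono powr_tangent) auto
    also have "\<dots> = (s - 1) * ((\<Sum>i<n. a i powr s) / A powr s) + (\<Sum>i<n. x i powr s) / X powr s"
      using a x 3 by (simp add: sum.distrib sum_distrib_left[symmetric] powr_divide sum_divide_distrib[symmetric])
    also have "\<dots> = s" using 3 by (simp add: As[symmetric] Xs[symmetric])
    finally have "(\<Sum>i<n. (a i / A) powr (s - 1) * (x i / X)) \<le> 1" using s by simp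
    moreover have "(\<Sum>i<n. (a i / A) powr (s - 1) * (x i / X)) = (\<Sum>i<n. a i powr (s - 1) * x i) / (A powr (s - 1) * X)"
      using a 3 by (simp add: powr_divide sum_divide_distrib)
    ultimately have "(\<Sum>i<n. a i powr (s - 1) * x i) / (A powr (s - 1) * X) \<le> 1" by simp
    moreover have "A powr (s - 1) * X > 0" using 3 by simp
    ultimately have "(\<Sum>i<n. a i powr (s - 1) * x i) \<le> A powr (s - 1) * X"
      by (simp only: pos_divide_le_eq mult_1)
    then show ?thesis unfolding A_def X_def .
  qed
qed

text \<open>The \<open>\<ell>\<^sup>s\<close>-norm of the integrals is, up to normalization, their pairing with the fixed weights
  \<open>A l powr (s - 1)\<close>; under the integral, Hoelder's inequality bounds the pairing by the norm.\<close>

lemma integral_sum_powr_lower: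
  fixes f :: "nat \<Rightarrow> 'b \<Rightarrow> real"
  assumes s: "s \<ge> 1" and f: "\<And>l. l < n \<Longrightarrow> integrable N (f l)" "\<And>l z. f l z \<ge> 0"
    and h: "integrable N h" and le: "\<And>z. (\<Sum>l<n. f l z powr s) powr (1 / s) \<le> h z"
  shows "(\<Sum>l<n. (LINT z|N. f l z) powr s) powr (1 / s) \<le> (LINT z|N. h z)"
proof -
  define A where "A l = (LINT z|N. f l z)" for l
  have A: "A l \<ge> 0" for l using f(2) by (simp add: A_def)
  define S where "S = (\<Sum>l<n. A l powr s) powr (1 / s)"
  have Ss: "S powr s = (\<Sum>l<n. A l powr s)"
    using s by (simp add: S_def powr_powr sum_nonneg)
  have S0: "S \<ge> 0" by (simp add: S_def)
  have h0: "h z \<ge> 0" for z using le[of z] by (rule order_trans[rotated]) simp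
  show ?thesis
  proof (cases "S = 0")
    case True
    then show ?thesis using h0 by (simp add: S_def A_def)
  next
    case False
    have "S powr (s - 1) * S = S powr s" using abs_powr_pos_eq[of S s] S0 by simp
    also have "\<dots> = (\<Sum>l<n. A l powr (s - 1) * A l)"
      unfolding Ss using abs_powr_pos_eq[of "A _" s] A by simp
    also have "\<dots> = (LINT z|N. (\<Sum>l<n. A l powr (s - 1) * f l z))"
      using f by (subst Bochner_Integration.integral_sum) (auto simp: A_def)
    also have "\<dots> \<le> (LINT z|N. S powr (s - 1) * h z)"
    proof (rule integral_mono)
      fix z
      have "(\<Sum>l<n. A l powr (s - 1) * f l z) \<le> S powr (s - 1) * (\<Sum>l<n. f l z powr s) powr (1 / s)"
        unfolding S_def by (rule sum_powr_holder[OF s A f(2)])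
      also have "\<dots> \<le> S powr (s - 1) * h z" by (intro mult_left_mono le) simp
      finally show "(\<Sum>l<n. A l powr (s - 1) * f l z) \<le> S powr (s - 1) * h z" .
    qed (use f h in auto)
    also have "\<dots> = S powr (s - 1) * (LINT z|N. h z)" by simp
    finally show ?thesis using False S0 by (simp add: S_def A_def)
  qed
qed

text \<open>Minkowski's inequality: after normalizing by any upper bounds \<open>\<beta> i\<close> of the norms, the integrand
  is a convex combination to which Jensen's inequality applies.  Strictly positive bounds avoid a
  separate treatment of functions that vanish almost everywhere.\<close>

lemma integral_sum_powr_upper:
  fixes h :: "nat \<Rightarrow> 'b \<Rightarrow> real"
  assumes r: "r \<ge> 1" and h: "\<And>i. i < n \<Longrightarrow> integrable N (\<lambda>z. h i z powr r)" "\<And>i z. h i z \<ge> 0"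
    and meas: "\<And>i. i < n \<Longrightarrow> h i \<in> borel_measurable N"
  shows "integrable N (\<lambda>z. (\<Sum>i<n. h i z) powr r)"
    and "(LINT z|N. (\<Sum>i<n. h i z) powr r) \<le> (\<Sum>i<n. (LINT z|N. h i z powr r) powr (1 / r)) powr r"
proof -
  define \<alpha> where "\<alpha> i = (LINT z|N. h i z powr r) powr (1 / r)" for i
  have \<alpha>: "\<alpha> i \<ge> 0" "\<alpha> i powr r = (LINT z|N. h i z powr r)" for i
    using r by (auto simp: \<alpha>_def powr_powr)
  show int: "integrable N (\<lambda>z. (\<Sum>i<n. h i z) powr r)"
  proof -
    have "(\<lambda>z. \<Sum>i<n. h i z) \<in> Lp r N"
    proof (rule Lp_dominated(1)[where G=h and C=1 and n=n])
      show "h i \<in> Lp r N" if "i < n" for i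
        using h meas that by (simp add: Lp_iff_integrable)
    qed (use r h meas in \<open>auto simp: sum_nonneg\<close>)
    then have "integrable N (\<lambda>z. \<bar>\<Sum>i<n. h i z\<bar> powr r)" by (rule LpD)
    then show ?thesis using h(2) by (simp add: sum_nonneg)
  qed
  have eps: "(LINT z|N. (\<Sum>i<n. h i z) powr r) \<le> (\<Sum>i<n. \<alpha> i + e) powr r" if e: "e > 0" for e
  proof (cases "n = 0")
    case False
    define \<beta> where "\<beta> i = \<alpha> i + e" for i
    have \<beta>: "\<beta> i > 0" "\<alpha> i \<le> \<beta> i" for i using \<alpha>[of i] e by (auto simp: \<beta>_def intro: add_nonneg_pos)
    define S where "S = (\<Sum>i<n. \<beta> i)"
    have S: "S > 0" unfolding S_def using False \<beta> by (intro sum_pos) auto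
    have pt: "(\<Sum>i<n. h i z) powr r \<le> S powr r * (\<Sum>i<n. \<beta> i / S * (h i z powr r / \<beta> i powr r))" for z
    proof -
      have "(\<Sum>i<n. h i z) = S * (\<Sum>i<n. \<beta> i / S * (h i z / \<beta> i))"
        using S \<beta>(1) by (simp add: sum_distrib_left less_imp_neq[symmetric])
      then have "(\<Sum>i<n. h i z) powr r = S powr r * (\<Sum>i<n. \<beta> i / S * (h i z / \<beta> i)) powr r"
        using S \<beta>(1) h(2) by (simp add: powr_mult less_imp_le sum_nonneg)
      also have "\<dots> \<le> S powr r * (\<Sum>i<n. \<beta> i / S * (h i z / \<beta> i) powr r)"
      proof (intro mult_left_mono powr_jensen r)
        show "(\<Sum>i<n. \<beta> i / S) = 1" using S by (simp add: sum_divide_distrib[symmetric] S_def)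
      qed (use S \<beta>(1) h(2) in \<open>auto simp: less_imp_le\<close>)
      finally show ?thesis using \<beta>(1) h(2) by (simp add: powr_divide less_imp_le)
    qed
    have "(LINT z|N. (\<Sum>i<n. h i z) powr r) \<le> (LINT z|N. S powr r * (\<Sum>i<n. \<beta> i / S * (h i z powr r / \<beta> i powr r)))"
      by (rule integral_mono[OF int _ pt]) (use h in auto)
    also have "\<dots> = S powr r * (\<Sum>i<n. \<beta> i / S * (\<alpha> i powr r / \<beta> i powr r))"
      using h by (subst integral_mult_right_zero, subst Bochner_Integration.integral_sum) (auto simp: \<alpha>)
    also have "\<dots> \<le> S powr r * (\<Sum>i<n. \<beta> i / S * 1)"
    proof (intro mult_left_mono sum_mono)
      fix i
      have "\<alpha> i powr r \<le> \<beta> i powr r" using \<alpha>(1) \<beta>(2) r by (intro powr_mono2) auto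
      then show "\<alpha> i powr r / \<beta> i powr r \<le> 1" using \<beta>(1)[of i] by (simp add: divide_le_eq_1)
    qed (use S \<beta>(1) in \<open>auto simp: less_imp_le\<close>)
    also have "\<dots> = S powr r" using S by (simp add: sum_divide_distrib[symmetric] S_def)
    finally show ?thesis by (simp add: S_def \<beta>_def)
  qed (use r in simp)
  have "((\<lambda>e. (\<Sum>i<n. \<alpha> i + e) powr r) \<longlongrightarrow> (\<Sum>i<n. \<alpha> i + 0) powr r) (at_right 0)"
    using \<alpha>(1) r by (intro tendsto_powr' tendsto_sum tendsto_add tendsto_const tendsto_ident_at)
      (auto intro!: eventually_at_rightI[of 0 1] sum_nonneg add_nonneg_nonneg)
  then have "(LINT z|N. (\<Sum>i<n. h i z) powr r) \<le> (\<Sum>i<n. \<alpha> i + 0) powr r"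
    by (rule tendsto_lowerbound) (auto intro!: eventually_at_rightI[of 0 1] eps)
  then show "(LINT z|N. (\<Sum>i<n. h i z) powr r) \<le> (\<Sum>i<n. (LINT z|N. h i z powr r) powr (1 / r)) powr r"
    by (simp add: \<alpha>_def)
qed

lemma lq_norm_ereal: "lq_norm (ereal q) n x = (\<Sum>i<n. \<bar>x i\<bar> powr q) powr (1 / q)"
  by (simp add: lq_norm_def)

lemma lq_norm_infinity: "lq_norm \<infinity> n x = Max ((\<lambda>i. \<bar>x i\<bar>) ` {..<n})"
  by (simp add: lq_norm_def)

text \<open>Integrating the pointwise contraction: the \<open>\<ell>\<^sup>q\<^sup>2\<close>-norm is at least as convex as the \<open>L\<^sup>p\<close>-norm and
  the \<open>\<ell>\<^sup>q\<^sup>1\<close>-norm at most, so both norms can be interchanged with the integral in the required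
  direction.\<close>

lemma contraction_of_power_integrals:
  fixes F H :: "nat \<Rightarrow> 'b \<Rightarrow> real"
  assumes p: "p > 0" and n: "1 \<le> n1" "1 \<le> n2" and q1: "0 < q1" "q1 \<le> p" and q2: "ereal p \<le> q2"
    and F: "\<And>l. l < n2 \<Longrightarrow> F l \<in> Lp p N" and H: "\<And>i. i < n1 \<Longrightarrow> H i \<in> Lp p N"
    and le: "\<And>z. lq_norm q2 n2 (\<lambda>l. F l z) \<le> lq_norm (ereal q1) n1 (\<lambda>i. H i z)"
  shows "lq_norm q2 n2 (\<lambda>l. (LINT z|N. \<bar>F l z\<bar> powr p) powr (1 / p))
    \<le> lq_norm (ereal q1) n1 (\<lambda>i. (LINT z|N. \<bar>H i z\<bar> powr p) powr (1 / p))"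
proof -
  define R where "R = lq_norm (ereal q1) n1 (\<lambda>i. (LINT z|N. \<bar>H i z\<bar> powr p) powr (1 / p))"
  have R0: "R \<ge> 0" by (simp add: R_def lq_norm_ereal)
  define g where "g z = (\<Sum>i<n1. \<bar>H i z\<bar> powr q1) powr (p / q1)" for z
  have g: "lq_norm (ereal q1) n1 (\<lambda>i. H i z) powr p = g z" for z
    by (simp add: g_def lq_norm_ereal powr_powr)
  have hp: "(\<bar>H i z\<bar> powr q1) powr (p / q1) = \<bar>H i z\<bar> powr p" for i z
    using q1 by (simp add: powr_powr)
  have intg: "integrable N g" and gR: "(LINT z|N. g z) \<le> R powr p"
  proof -
    have r: "p / q1 \<ge> 1" using q1 by simp
    have m: "(\<lambda>z. \<bar>H i z\<bar> powr q1) \<in> borel_measurable N" if "i < n1" for i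
      using LpD(1)[OF H[OF that]] by measurable
    have i: "integrable N (\<lambda>z. (\<bar>H i z\<bar> powr q1) powr (p / q1))" if "i < n1" for i
      unfolding hp using LpD(2)[OF H[OF that]] .
    show "integrable N g" unfolding g_def
      by (rule integral_sum_powr_upper(1)[OF r]) (use i m in auto)
    have "(LINT z|N. g z) \<le> (\<Sum>i<n1. (LINT z|N. (\<bar>H i z\<bar> powr q1) powr (p / q1)) powr (1 / (p / q1))) powr (p / q1)"
      unfolding g_def by (rule integral_sum_powr_upper(2)[OF r]) (use i m in auto)
    also have "\<dots> = R powr p"
      unfolding hp using p q1 by (simp add: R_def lq_norm_ereal powr_powr)
    finally show "(LINT z|N. g z) \<le> R powr p" .
  qed
  have root: "x powr (1 / p) \<le> R" if "x \<le> R powr p" "x \<ge> 0" for x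
  proof -
    have "x powr (1 / p) \<le> (R powr p) powr (1 / p)" using that p by (intro powr_mono2) auto
    then show ?thesis using p R0 by (simp add: powr_powr)
  qed
  show ?thesis unfolding R_def[symmetric]
  proof (cases q2)
    case PInf
    have "(LINT z|N. \<bar>F l z\<bar> powr p) powr (1 / p) \<le> R" if l: "l < n2" for l
    proof (rule root)
      have "\<bar>F l z\<bar> powr p \<le> g z" for z
      proof -
        have "\<bar>F l z\<bar> \<le> lq_norm q2 n2 (\<lambda>l. F l z)"
          unfolding PInf lq_norm_infinity using l by (intro Max_ge) auto
        also note le[of z]
        finally show ?thesis unfolding g[symmetric] using p by (intro powr_mono2) auto
      qed
      then have "(LINT z|N. \<bar>F l z\<bar> powr p) \<le> (LINT z|N. g z)"
        using LpD(2)[OF F[OF l]] intg by (intro integral_mono)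
      then show "(LINT z|N. \<bar>F l z\<bar> powr p) \<le> R powr p" using gR by simp
    qed simp
    then show "lq_norm q2 n2 (\<lambda>l. (LINT z|N. \<bar>F l z\<bar> powr p) powr (1 / p)) \<le> R"
      unfolding PInf lq_norm_infinity using n by (subst Max_le_iff) (auto simp: lessThan_empty_iff bot_nat_def)
  next
    case (real q)
    then have q: "q \<ge> p" "q > 0" using q2 p by auto
    have s: "q / p \<ge> 1" using q p by simp
    have "(\<Sum>l<n2. (LINT z|N. \<bar>F l z\<bar> powr p) powr (q / p)) powr (1 / (q / p)) \<le> (LINT z|N. g z)"
    proof (rule integral_sum_powr_lower[OF s _ _ intg])
      fix z
      have "(\<Sum>l<n2. (\<bar>F l z\<bar> powr p) powr (q / p)) powr (1 / (q / p)) = lq_norm q2 n2 (\<lambda>l. F l z) powr p"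
        using p q by (simp add: real lq_norm_ereal powr_powr)
      also have "\<dots> \<le> g z" unfolding g[symmetric]
        using le[of z] p by (intro powr_mono2) (auto simp: real lq_norm_ereal)
      finally show "(\<Sum>l<n2. (\<bar>F l z\<bar> powr p) powr (q / p)) powr (1 / (q / p)) \<le> g z" .
    qed (use LpD(2)[OF F] in auto)
    also note gR
    finally have "((\<Sum>l<n2. (LINT z|N. \<bar>F l z\<bar> powr p) powr (q / p)) powr (1 / (q / p))) powr (1 / p) \<le> R"
      by (rule root) simp
    then show "lq_norm q2 n2 (\<lambda>l. (LINT z|N. \<bar>F l z\<bar> powr p) powr (1 / p)) \<le> R"
      using p q by (simp add: real lq_norm_ereal powr_powr)
  qed (use q2 in simp)
qed

lemma tendsto_lq_norm:
  assumes q: "q > 0" and n: "1 \<le> n" and x: "\<And>i. i < n \<Longrightarrow> ((\<lambda>j. x j i) \<longlongrightarrow> y i) G"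
  shows "((\<lambda>j. lq_norm q n (x j)) \<longlongrightarrow> lq_norm q n y) G"
proof (cases q)
  case PInf
  have "((\<lambda>j. Max ((\<lambda>i. \<bar>x j i\<bar>) ` {..<Suc n})) \<longlongrightarrow> Max ((\<lambda>i. \<bar>y i\<bar>) ` {..<Suc n})) G"
    if "\<And>i. i < Suc n \<Longrightarrow> ((\<lambda>j. x j i) \<longlongrightarrow> y i) G" for n
    using that
  proof (induction n)
    case 0
    have "(\<lambda>i. \<bar>z i\<bar>) ` {..<Suc 0} = {\<bar>z 0\<bar>}" for z :: "nat \<Rightarrow> real" by auto
    then show ?case using 0 by (simp add: tendsto_rabs)
  next
    case (Suc n)
    have eq: "Max ((\<lambda>i. \<bar>z i\<bar>) ` {..<Suc (Suc n)}) = max \<bar>z (Suc n)\<bar> (Max ((\<lambda>i. \<bar>z i\<bar>) ` {..<Suc n}))"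
      for z :: "nat \<Rightarrow> real"
      by (subst lessThan_Suc, subst image_insert, subst Max_insert) auto
    show ?case unfolding eq by (intro tendsto_max tendsto_rabs Suc) auto
  qed
  from this[of "n - 1"] show ?thesis using n x by (simp add: PInf lq_norm_infinity)
next
  case (real r)
  then have "r > 0" using q by simp
  have "((\<lambda>j. \<bar>x j i\<bar> powr r) \<longlongrightarrow> \<bar>y i\<bar> powr r) G" if "i < n" for i
    using \<open>r > 0\<close> by (intro tendsto_powr'[OF tendsto_rabs[OF x[OF that]] tendsto_const]) auto
  then show ?thesis unfolding real lq_norm_ereal
    using \<open>r > 0\<close> by (intro tendsto_powr'[OF tendsto_sum tendsto_const]) (auto simp: sum_nonneg)
qed (use q in simp)

lemma lq_norm_le_limit:
  assumes G: "G \<noteq> bot" and p: "p > 0" and n: "1 \<le> n1" "1 \<le> n2" and q: "0 < q1" "ereal p \<le> q2"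
    and a: "\<And>l. l < n2 \<Longrightarrow> ((\<lambda>j. a j l) \<longlongrightarrow> A l) G" "\<And>j l. a j l \<ge> 0"
    and b: "\<And>i. i < n1 \<Longrightarrow> ((\<lambda>j. b j i) \<longlongrightarrow> B i) G" "\<And>j i. b j i \<ge> 0"
    and le: "\<forall>\<^sub>F j in G. lq_norm q2 n2 (\<lambda>l. a j l powr (1 / p)) \<le> lq_norm (ereal q1) n1 (\<lambda>i. b j i powr (1 / p))"
  shows "lq_norm q2 n2 (\<lambda>l. A l powr (1 / p)) \<le> lq_norm (ereal q1) n1 (\<lambda>i. B i powr (1 / p))"
proof (rule tendsto_le[OF G _ _ le])
  have "((\<lambda>j. b j i powr (1 / p)) \<longlongrightarrow> B i powr (1 / p)) G" if "i < n1" for i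
    using p by (intro tendsto_powr' b that) (auto simp: b)
  then show "((\<lambda>j. lq_norm (ereal q1) n1 (\<lambda>i. b j i powr (1 / p))) \<longlongrightarrow> lq_norm (ereal q1) n1 (\<lambda>i. B i powr (1 / p))) G"
    using q n by (intro tendsto_lq_norm) auto
  have "((\<lambda>j. a j l powr (1 / p)) \<longlongrightarrow> A l powr (1 / p)) G" if "l < n2" for l
    using p by (intro tendsto_powr' a that) (auto simp: a)
  moreover have "q2 > 0" using p q(2) by (metis ereal_less(2) less_le_trans)
  ultimately show "((\<lambda>j. lq_norm q2 n2 (\<lambda>l. a j l powr (1 / p))) \<longlongrightarrow> lq_norm q2 n2 (\<lambda>l. A l powr (1 / p))) G"
    using n by (intro tendsto_lq_norm) auto
qed


section \<open>Positive functionals on compactly supported functions\<close>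

lemma CcD:
  assumes "f \<in> Cc"
  shows "continuous_on UNIV f" "compact (closure {x. f x \<noteq> 0})" "\<And>S. continuous_on S f"
  using assms by (auto simp: Cc_def intro: continuous_on_subset)

lemma Cc_borel: "f \<in> Cc \<Longrightarrow> f \<in> borel_measurable borel"
  by (intro borel_measurable_continuous_onI CcD)

lemma CcI:
  fixes f :: "'a::t2_space \<Rightarrow> real"
  assumes "continuous_on UNIV f" "compact S" "\<And>x. f x \<noteq> 0 \<Longrightarrow> x \<in> S"
  shows "f \<in> Cc"
proof -
  have "closure {x. f x \<noteq> 0} \<subseteq> S"
    using assms by (intro closure_minimal compact_imp_closed) auto
  then have "compact (closure {x. f x \<noteq> 0})"
    using compact_Int_closed[OF assms(2), of "closure {x. f x \<noteq> 0}"] by (simp add: Int_absorb1)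
  then show ?thesis using assms(1) by (simp add: Cc_def)
qed

lemma Cc_combine:
  fixes f g :: "'a::t2_space \<Rightarrow> real"
  assumes "f \<in> Cc" "g \<in> Cc" "continuous_on UNIV h" "\<And>x. f x = 0 \<Longrightarrow> g x = 0 \<Longrightarrow> h x = 0"
  shows "h \<in> Cc"
proof (rule CcI)
  show "compact (closure {x. f x \<noteq> 0} \<union> closure {x. g x \<noteq> 0})"
    using assms by (intro compact_Un CcD)
  show "x \<in> closure {x. f x \<noteq> 0} \<union> closure {x. g x \<noteq> 0}" if "h x \<noteq> 0" for x
    using assms(4)[of x] that closure_subset[of "{x. f x \<noteq> 0}"] closure_subset[of "{x. g x \<noteq> 0}"]
    by auto
qed (rule assms)

lemma Cc_dominated:
  fixes f :: "'a::t2_space \<Rightarrow> real"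
  assumes "f \<in> Cc" "continuous_on UNIV h" "\<And>x. f x = 0 \<Longrightarrow> h x = 0"
  shows "h \<in> Cc"
  using Cc_combine[OF assms(1,1,2)] assms(3) by blast

lemma Cc_zero: "(\<lambda>x. 0) \<in> Cc"
  by (simp add: Cc_def)

lemma Cc_add:
  fixes f g :: "'a::t2_space \<Rightarrow> real"
  shows "f \<in> Cc \<Longrightarrow> g \<in> Cc \<Longrightarrow> (\<lambda>x. f x + g x) \<in> Cc"
  by (rule Cc_combine[of f g]) (auto simp: Cc_def intro!: continuous_intros)

lemma Cc_diff:
  fixes f g :: "'a::t2_space \<Rightarrow> real"
  shows "f \<in> Cc \<Longrightarrow> g \<in> Cc \<Longrightarrow> (\<lambda>x. f x - g x) \<in> Cc"
  by (rule Cc_combine[of f g]) (auto simp: Cc_def intro!: continuous_intros)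

lemma Cc_cmult:
  fixes f :: "'a::t2_space \<Rightarrow> real"
  shows "f \<in> Cc \<Longrightarrow> (\<lambda>x. c * f x) \<in> Cc"
  by (rule Cc_dominated[of f]) (auto simp: Cc_def intro!: continuous_intros)

lemma Cc_shrink:
  fixes f :: "'a::t2_space \<Rightarrow> real"
  shows "f \<in> Cc \<Longrightarrow> c \<ge> 0 \<Longrightarrow> (\<lambda>x. max 0 (f x - c)) \<in> Cc"
  by (rule Cc_dominated[of f]) (auto simp: Cc_def intro!: continuous_intros)

lemma Cc_pos_part:
  fixes f :: "'a::t2_space \<Rightarrow> real"
  shows "f \<in> Cc \<Longrightarrow> (\<lambda>x. max 0 (f x)) \<in> Cc"
  using Cc_shrink[of f 0] by simp

lemma Cc_bounded:
  assumes "f \<in> Cc"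
  obtains c where "c > 0" "\<And>x. \<bar>f x\<bar> \<le> c"
proof -
  have "bounded (f ` closure {x. f x \<noteq> 0})"
    using assms by (intro compact_imp_bounded compact_continuous_image CcD)
  then obtain c where c: "\<And>x. x \<in> closure {x. f x \<noteq> 0} \<Longrightarrow> \<bar>f x\<bar> \<le> c"
    by (auto simp: bounded_iff)
  show ?thesis
  proof (rule that[of "max c 1"])
    fix x show "\<bar>f x\<bar> \<le> max c 1"
      using c[of x] closure_subset[of "{x. f x \<noteq> 0}"] by (cases "f x = 0") auto
  qed simp
qed

text \<open>The complement of \<open>UNIV\<close> is empty and \<open>infdist\<close> to it vanishes, hence the case distinction.\<close>

definition cutoff :: "'a::metric_space set \<Rightarrow> nat \<Rightarrow> 'a \<Rightarrow> real" where
  "cutoff U n x = (if U = UNIV then 1 else min 1 (real n * infdist x (- U)))"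

lemma cutoff_continuous: "continuous_on S (cutoff U n)"
  unfolding cutoff_def by (cases "U = UNIV") (auto intro!: continuous_intros)

lemma cutoff_range: "0 \<le> cutoff U n x" "cutoff U n x \<le> 1"
  by (auto simp: cutoff_def infdist_nonneg)

lemma cutoff_outside: "x \<notin> U \<Longrightarrow> cutoff U n x = 0"
  by (auto simp: cutoff_def)

lemma cutoff_le_indicator: "cutoff U n x \<le> indicator U x"
  using cutoff_range[of U n x] cutoff_outside[of x U n] by (auto simp: indicator_def)

lemma cutoff_mono: "m \<le> n \<Longrightarrow> cutoff U m x \<le> cutoff U n x"
  by (simp add: cutoff_def del: min_less_iff_conj min.bounded_iff)
    (intro impI min.mono order_refl mult_right_mono infdist_nonneg of_nat_mono)

lemma cutoff_eventually:
  assumes "open U" "x \<in> U"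
  shows "\<forall>\<^sub>F n in sequentially. cutoff U n x = 1"
proof (cases "U = UNIV")
  case False
  have "infdist x (- U) > 0"
    using assms False by (intro infdist_pos_not_in_closed) auto
  then obtain n0 where n0: "real n0 * infdist x (- U) > 1"
    using reals_Archimedean3 by blast
  have "cutoff U n x = 1" if "n \<ge> n0" for n
  proof -
    have "real n0 * infdist x (- U) \<le> real n * infdist x (- U)"
      using that by (intro mult_right_mono infdist_nonneg) auto
    then show ?thesis using n0 False by (simp add: cutoff_def)
  qed
  then show ?thesis by (auto simp: eventually_sequentially)
qed (simp add: cutoff_def)

lemma cutoff_tendsto:
  assumes "open U"
  shows "(\<lambda>n. cutoff U n x) \<longlonglongrightarrow> indicator U x"
proof (cases "x \<in> U")
  case True
  then show ?thesis using cutoff_eventually[OF assms True] by (simp add: tendsto_eventually)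
qed (simp add: cutoff_outside)

text \<open>The bound \<open>B\<close> on the norm of the functional becomes the bound on the mass of the representing
  measure.  It also makes uniform approximations harmless, so that the usual support conditions can be
  replaced by pointwise bounds.\<close>

locale bounded_positive_functional =
  fixes \<Lambda> :: "('a::metric_space \<Rightarrow> real) \<Rightarrow> real" and B :: real
  assumes add: "\<And>f g. f \<in> Cc \<Longrightarrow> g \<in> Cc \<Longrightarrow> \<Lambda> (\<lambda>x. f x + g x) = \<Lambda> f + \<Lambda> g"
    and cmult: "\<And>c f. f \<in> Cc \<Longrightarrow> \<Lambda> (\<lambda>x. c * f x) = c * \<Lambda> f"
    and nonneg: "\<And>f. f \<in> Cc \<Longrightarrow> (\<And>x. 0 \<le> f x) \<Longrightarrow> 0 \<le> \<Lambda> f"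
    and bound: "\<And>f c. f \<in> Cc \<Longrightarrow> (\<And>x. \<bar>f x\<bar> \<le> c) \<Longrightarrow> \<Lambda> f \<le> B * c"
begin

lemma zero: "\<Lambda> (\<lambda>x. 0) = 0"
  using cmult[of "\<lambda>x. 0" 0] Cc_zero by simp

lemma B_nonneg: "B \<ge> 0"
  using bound[of "\<lambda>x. 0" 1] zero Cc_zero by simp

lemma diff: "f \<in> Cc \<Longrightarrow> g \<in> Cc \<Longrightarrow> \<Lambda> (\<lambda>x. f x - g x) = \<Lambda> f - \<Lambda> g"
  using add[of "\<lambda>x. f x - g x" g] by (simp add: Cc_diff)

lemma mono: "f \<in> Cc \<Longrightarrow> g \<in> Cc \<Longrightarrow> (\<And>x. f x \<le> g x) \<Longrightarrow> \<Lambda> f \<le> \<Lambda> g"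
  using nonneg[of "\<lambda>x. g x - f x"] diff[of g f] by (simp add: Cc_diff)

text \<open>The content of an open set is the supremum of the functional over the admissible functions \<open>below U\<close>;
  it extends to all sets as an outer measure for which open sets are measurable in the sense of
  Caratheodory.\<close>

definition below :: "'a set \<Rightarrow> ('a \<Rightarrow> real) set" where
  "below U = {f \<in> Cc. \<forall>x. 0 \<le> f x \<and> f x \<le> indicator U x}"

definition content :: "'a set \<Rightarrow> ennreal" where
  "content U = (SUP f\<in>below U. ennreal (\<Lambda> f))"

definition outer :: "'a set \<Rightarrow> ennreal" where
  "outer A = (INF U\<in>{U. open U \<and> A \<subseteq> U}. content U)"

lemma below_Cc: "f \<in> below U \<Longrightarrow> f \<in> Cc"
  by (simp add: below_def)

lemma belowD:
  assumes "f \<in> below U"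
  shows "0 \<le> f x" "f x \<le> indicator U x" "f x \<le> 1" "x \<notin> U \<Longrightarrow> f x = 0"
proof -
  show *: "0 \<le> f x" "f x \<le> indicator U x" using assms by (auto simp: below_def)
  have "indicator U x \<le> (1 :: real)" by (simp add: indicator_def)
  with *(2) show "f x \<le> 1" by linarith
  show "f x = 0" if "x \<notin> U" using *(1,2) that by simp
qed

lemma belowI:
  assumes "f \<in> Cc" "\<And>x. 0 \<le> f x" "\<And>x. f x \<le> 1" "\<And>x. x \<notin> U \<Longrightarrow> f x = 0"
  shows "f \<in> below U"
  using assms by (auto simp: below_def indicator_def)

lemma zero_below: "(\<lambda>x. 0) \<in> below U"
  by (auto simp: below_def Cc_zero)

lemma below_mono: "U \<subseteq> V \<Longrightarrow> below U \<subseteq> below V"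
  by (rule subsetI, rule belowI) (auto intro: below_Cc belowD)

lemma content_mono: "U \<subseteq> V \<Longrightarrow> content U \<le> content V"
  unfolding content_def by (intro SUP_subset_mono below_mono) auto

lemma content_upper: "f \<in> below U \<Longrightarrow> ennreal (\<Lambda> f) \<le> content U"
  unfolding content_def by (rule SUP_upper)

lemma content_le: "content U \<le> ennreal B"
  unfolding content_def
proof (rule SUP_least)
  fix f assume f: "f \<in> below U"
  have "\<bar>f x\<bar> \<le> 1" for x using belowD[OF f, of x] by auto
  then have "\<Lambda> f \<le> B * 1" by (rule bound[OF below_Cc[OF f]])
  then show "ennreal (\<Lambda> f) \<le> ennreal B" by (intro ennreal_leI) simp
qed

lemma content_empty: "content {} = 0"
proof -
  have "f = (\<lambda>x. 0)" if "f \<in> below {}" for f using belowD(4)[OF that] by auto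
  then have "below {} = {\<lambda>x. 0}" using zero_below by blast
  then show ?thesis by (simp add: content_def zero)
qed

text \<open>Shrinking an admissible function makes its support a closed subset of \<open>U\<close>, at a small cost.\<close>

lemma below_shrink:
  assumes f: "f \<in> below U" and e: "e > 0"
  defines "g \<equiv> \<lambda>x. max 0 (f x - e)"
  shows "g \<in> below U" "\<Lambda> f \<le> \<Lambda> g + B * e"
proof -
  show g: "g \<in> below U"
  proof (rule belowI)
    show "g x \<le> 1" for x using belowD(3)[OF f, of x] e by (auto simp: g_def)
    show "g x = 0" if "x \<notin> U" for x using belowD(4)[OF f that] e by (auto simp: g_def)
  qed (use e below_Cc[OF f] in \<open>auto simp: g_def intro!: Cc_shrink\<close>)
  have "\<Lambda> f - \<Lambda> g = \<Lambda> (\<lambda>x. f x - g x)" using diff below_Cc f g by simp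
  also have "\<dots> \<le> B * e"
  proof (rule bound)
    show "\<bar>f x - g x\<bar> \<le> e" for x using belowD(1)[OF f, of x] e by (auto simp: g_def)
  qed (use below_Cc f g in \<open>auto intro: Cc_diff\<close>)
  finally show "\<Lambda> f \<le> \<Lambda> g + B * e" by simp
qed

text \<open>A function supported in a union of open sets is, up to a uniformly small error, split into a sum
  of functions supported in the single sets; compactness of the support makes finitely many of them
  sufficient.\<close>

lemma content_UN_le:
  fixes U :: "nat \<Rightarrow> 'a set"
  assumes U: "\<And>i. open (U i)"
  shows "content (\<Union>i. U i) \<le> (\<Sum>i. content (U i))"
  unfolding content_def[of "\<Union>i. U i"]
proof (rule SUP_least, rule ennreal_le_epsilon)
  fix f and e :: real assume f: "f \<in> below (\<Union>i. U i)" and e: "e > 0"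
  note fC = below_Cc[OF f]
  define d where "d = e / (B + 1)"
  have d: "d > 0" "B * d \<le> e" using e B_nonneg by (auto simp: d_def field_simps)
  define S where "S N k x = (\<Sum>i<k. cutoff (U i) N x)" for N k x
  have Sc: "continuous_on A (S N k)" for A N k
    unfolding S_def by (intro continuous_intros cutoff_continuous)
  have S0: "S N k x \<ge> 0" for N k x unfolding S_def by (intro sum_nonneg cutoff_range)
  have minC: "(\<lambda>x. min (f x) (S N k x)) \<in> Cc" for N k
    by (rule Cc_dominated[OF fC]) (use S0 CcD(1)[OF fC] in \<open>auto intro!: continuous_intros Sc\<close>)
  \<comment> \<open>Consecutive truncations of \<open>f\<close> by the partial sums differ by a function below one of the sets.\<close>
  have split: "ennreal (\<Lambda> (\<lambda>x. min (f x) (S N k x))) \<le> (\<Sum>i<k. content (U i))" for N k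
  proof (induction k)
    case 0
    have "(\<lambda>x. min (f x) (S N 0 x)) = (\<lambda>x. 0)"
      using belowD(1)[OF f] by (auto simp: S_def fun_eq_iff min_def intro: order_antisym)
    then show ?case by (simp add: zero)
  next
    case (Suc k)
    define piece where "piece x = min (f x) (S N (Suc k) x) - min (f x) (S N k x)" for x
    have piece: "piece \<in> below (U k)"
    proof -
      have "0 \<le> piece x \<and> piece x \<le> cutoff (U k) N x" for x
        using cutoff_range(1)[of "U k" N x] by (auto simp: piece_def S_def min_def)
      moreover have "piece \<in> Cc" unfolding piece_def[abs_def] by (rule Cc_diff[OF minC minC])
      moreover have "cutoff (U k) N x \<le> indicator (U k) x" for x by (rule cutoff_le_indicator)
      ultimately show ?thesis by (auto simp: below_def simp del: indicator_simps intro: order_trans)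
    qed
    have "\<Lambda> (\<lambda>x. min (f x) (S N (Suc k) x)) = \<Lambda> (\<lambda>x. min (f x) (S N k x)) + \<Lambda> piece"
      using add[OF minC[of N k] below_Cc[OF piece]] by (simp add: piece_def)
    moreover have "\<Lambda> (\<lambda>x. min (f x) (S N k x)) \<ge> 0"
      by (rule nonneg[OF minC]) (use S0 belowD(1)[OF f] in auto)
    moreover have "\<Lambda> piece \<ge> 0" using nonneg[OF below_Cc[OF piece]] belowD(1)[OF piece] by blast
    ultimately have "ennreal (\<Lambda> (\<lambda>x. min (f x) (S N (Suc k) x)))
      = ennreal (\<Lambda> (\<lambda>x. min (f x) (S N k x))) + ennreal (\<Lambda> piece)" by simp
    also have "\<dots> \<le> (\<Sum>i<k. content (U i)) + content (U k)"
      by (intro add_mono Suc content_upper piece)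
    finally show ?case by simp
  qed
  obtain N where N: "\<And>x. f x - min (f x) (S N N x) \<le> d"
  proof -
    define G where "G N = {x. f x - min (f x) (S N N x) < d}" for N
    let ?K = "closure {x. f x \<noteq> 0}"
    have G: "open (G N)" for N unfolding G_def
      by (intro open_Collect_less continuous_intros CcD(1)[OF fC] Sc)
    have Smono: "S M M x \<le> S N N x" if "M \<le> N" for M N x
    proof -
      have "S M M x \<le> (\<Sum>i<M. cutoff (U i) N x)" unfolding S_def by (intro sum_mono cutoff_mono that)
      also have "\<dots> \<le> S N N x" unfolding S_def using that by (intro sum_mono2 cutoff_range) auto
      finally show ?thesis .
    qed
    have "\<exists>N. x \<in> G N" for x
    proof (cases "x \<in> (\<Union>i. U i)")
      case True
      then obtain i where i: "x \<in> U i" by auto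
      obtain N where N: "N > i" "cutoff (U i) N x = 1"
        using eventually_conj[OF cutoff_eventually[OF U i] eventually_gt_at_top[of i]]
        by (metis (mono_tags, lifting) eventually_sequentially le_refl)
      have "1 \<le> S N N x" unfolding S_def N(2)[symmetric]
        by (rule member_le_sum) (use N cutoff_range in auto)
      then have "min (f x) (S N N x) = f x" using belowD(3)[OF f, of x] by auto
      then have "x \<in> G N" using d by (simp add: G_def)
      then show ?thesis ..
    next
      case False
      then have "f x = 0" using belowD(4)[OF f] by simp
      then have "x \<in> G 0" using d S0[of 0 0 x] by (simp add: G_def)
      then show ?thesis ..
    qed
    then have "?K \<subseteq> (\<Union>N\<in>UNIV. G N)" by blast
    then obtain D where D: "finite D" "?K \<subseteq> (\<Union>N\<in>D. G N)"
      using compactE_image[OF CcD(2)[OF fC], of UNIV G] G by auto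
    define N where "N = (if D = {} then 0 else Max D)"
    show ?thesis
    proof (rule that)
      fix x show "f x - min (f x) (S N N x) \<le> d"
      proof (cases "f x = 0")
        case True
        then show ?thesis using d S0[of N N x] by (auto simp: min_def)
      next
        case False
        then have "x \<in> ?K" using closure_subset[of "{x. f x \<noteq> 0}"] by auto
        then obtain M where M: "M \<in> D" "x \<in> G M" using D by auto
        then have "M \<le> N" using Max_ge[OF D(1) M(1)] by (auto simp: N_def)
        then have "min (f x) (S M M x) \<le> min (f x) (S N N x)" using Smono by (intro min.mono) auto
        then show ?thesis using M(2) by (simp add: G_def)
      qed
    qed
  qed
  let ?f = "\<lambda>x. min (f x) (S N N x)"
  have "\<Lambda> f - \<Lambda> ?f = \<Lambda> (\<lambda>x. f x - ?f x)" using diff fC minC by simp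
  also have "\<dots> \<le> B * d"
  proof (rule bound)
    show "\<bar>f x - ?f x\<bar> \<le> d" for x using N[of x] by auto
  qed (use fC minC in \<open>auto intro: Cc_diff\<close>)
  finally have "\<Lambda> f \<le> \<Lambda> ?f + e" using d by simp
  then have "ennreal (\<Lambda> f) \<le> ennreal (\<Lambda> ?f + e)" by (rule ennreal_leI)
  also have "\<dots> \<le> ennreal (\<Lambda> ?f) + ennreal e"
  proof -
    have "\<Lambda> ?f \<ge> 0" by (rule nonneg[OF minC]) (use S0 belowD(1)[OF f] in auto)
    then show ?thesis using e by simp
  qed
  also have "\<dots> \<le> (\<Sum>i. content (U i)) + ennreal e"
    by (intro add_right_mono order_trans[OF split] sum_le_suminf) auto
  finally show "ennreal (\<Lambda> f) \<le> (\<Sum>i. content (U i)) + ennreal e" .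
qed

lemma outer_open: "open U \<Longrightarrow> outer U = content U"
  unfolding outer_def by (rule antisym) (auto intro!: INF_lower INF_greatest content_mono)

lemma outer_le_content: "open U \<Longrightarrow> A \<subseteq> U \<Longrightarrow> outer A \<le> content U"
  unfolding outer_def by (rule INF_lower) simp

lemma outer_mono: "A \<subseteq> A' \<Longrightarrow> outer A \<le> outer A'"
  unfolding outer_def by (rule INF_superset_mono) auto

lemma outer_le: "outer A \<le> ennreal B"
  using outer_le_content[of UNIV A] content_le[of UNIV] by (auto intro: order_trans)

lemma outer_approx:
  assumes "e > 0"
  obtains U where "open U" "A \<subseteq> U" "content U \<le> outer A + ennreal e"
proof -
  have "outer A < outer A + ennreal e"
  proof -
    have "outer A < top" using outer_le[of A] ennreal_less_top by (rule le_less_trans)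
    then show ?thesis using assms by simp
  qed
  then obtain U where "open U" "A \<subseteq> U" "content U < outer A + ennreal e"
    unfolding outer_def[of A] INF_less_iff by auto
  then show ?thesis using that by auto
qed

lemma outer_UN_le:
  fixes A :: "nat \<Rightarrow> 'a set"
  shows "outer (\<Union>i. A i) \<le> (\<Sum>i. outer (A i))"
proof (rule ennreal_le_epsilon)
  fix e :: real assume e: "e > 0"
  have "\<exists>U. open U \<and> A i \<subseteq> U \<and> content U \<le> outer (A i) + ennreal (e * (1/2) ^ Suc i)" for i
    using outer_approx[of "e * (1/2) ^ Suc i" "A i"] e by auto
  then obtain U where U: "\<And>i. open (U i)" "\<And>i. A i \<subseteq> U i"
    "\<And>i. content (U i) \<le> outer (A i) + ennreal (e * (1/2) ^ Suc i)" by metis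
  have "outer (\<Union>i. A i) \<le> content (\<Union>i. U i)"
    using U by (intro outer_le_content) auto
  also have "\<dots> \<le> (\<Sum>i. content (U i))" by (rule content_UN_le[OF U(1)])
  also have "\<dots> \<le> (\<Sum>i. outer (A i) + ennreal e * ennreal ((1/2) ^ Suc i))"
    using U(3) e by (intro suminf_le) (auto simp: ennreal_mult[symmetric])
  also have "\<dots> = (\<Sum>i. outer (A i)) + (\<Sum>i. ennreal e * ennreal ((1/2) ^ Suc i))"
    by (rule suminf_add[symmetric]) auto
  also have "\<dots> = (\<Sum>i. outer (A i)) + ennreal e"
    unfolding ennreal_suminf_cmult
    by (subst suminf_ennreal_eq[OF zero_le_power power_half_series]) auto
  finally show "outer (\<Union>i. A i) \<le> (\<Sum>i. outer (A i)) + ennreal e" .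
qed

lemma outer_empty: "outer {} = 0"
  by (simp add: outer_open content_empty)

lemma outer_Un_le: "outer (A1 \<union> A2) \<le> outer A1 + outer A2"
proof -
  define A where "A i = (if i = 0 then A1 else if i = Suc 0 then A2 else {})" for i :: nat
  have "outer (\<Union>i. A i) \<le> (\<Sum>i. outer (A i))" by (rule outer_UN_le)
  moreover have "(\<Union>i. A i) = A1 \<union> A2" 
  proof
    show "(\<Union>i. A i) \<subseteq> A1 \<union> A2" by (rule UN_least) (simp add: A_def)
    have "A 0 = A1" "A (Suc 0) = A2" by (simp_all add: A_def)
    then show "A1 \<union> A2 \<subseteq> (\<Union>i. A i)" by blast
  qed
  moreover have "(\<Sum>i. outer (A i)) = (\<Sum>i<2. outer (A i))"
    by (rule suminf_finite) (auto simp: A_def outer_empty)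
  ultimately show ?thesis by (simp add: A_def numeral_2_eq_2)
qed

text \<open>After shrinking, a function below \<open>V \<inter> U\<close> vanishes outside the closed set \<open>{x. d \<le> f x}\<close>.  The open set
  \<open>V - {x. d \<le> f x}\<close> still covers the part of \<open>A\<close> outside \<open>U\<close>, and functions below it may be added
  without leaving \<open>below V\<close>.\<close>

lemma outer_open_split:
  assumes U: "open U"
  shows "outer (U \<inter> A) + outer ((UNIV - U) \<inter> A) \<le> outer A"
  unfolding outer_def[of A]
proof (rule INF_greatest)
  fix V assume "V \<in> {V. open V \<and> A \<subseteq> V}"
  then have V: "open V" "A \<subseteq> V" by auto
  let ?R = "(UNIV - U) \<inter> A"
  have "outer (U \<inter> A) \<le> content (V \<inter> U)" using U V by (intro outer_le_content) auto
  then have "outer (U \<inter> A) + outer ?R \<le> content (V \<inter> U) + outer ?R" by (rule add_right_mono)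
  also have "\<dots> = (SUP f\<in>below (V \<inter> U). ennreal (\<Lambda> f) + outer ?R)"
    unfolding content_def using zero_below by (subst ennreal_SUP_add_left) auto
  also have "\<dots> \<le> content V"
  proof (rule SUP_least, rule ennreal_le_epsilon)
    fix f and e :: real assume f: "f \<in> below (V \<inter> U)" and e: "e > 0"
    define d where "d = e / (B + 1)"
    have d: "d > 0" "B * d \<le> e" using e B_nonneg by (auto simp: d_def field_simps)
    define g where "g x = max 0 (f x - d)" for x
    have g: "g \<in> below (V \<inter> U)" "\<Lambda> f \<le> \<Lambda> g + B * d"
      using below_shrink[OF f d(1)] by (auto simp: g_def[abs_def])
    define F where "F = {x. d \<le> f x}"
    have F: "closed F" "F \<subseteq> V \<inter> U"
    proof -
      show "closed F" unfolding F_def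
        by (intro closed_Collect_le continuous_intros CcD(1)[OF below_Cc[OF f]])
      have "x \<in> V \<inter> U" if "d \<le> f x" for x
        using belowD(4)[OF f, of x] that d by (cases "x \<in> V \<inter> U") auto
      then show "F \<subseteq> V \<inter> U" by (auto simp: F_def)
    qed
    have "outer ?R \<le> content (V - F)"
      using V F by (intro outer_le_content) auto
    then have "ennreal (\<Lambda> g) + outer ?R \<le> ennreal (\<Lambda> g) + content (V - F)" by (rule add_left_mono)
    also have "\<dots> = (SUP h\<in>below (V - F). ennreal (\<Lambda> g) + ennreal (\<Lambda> h))"
      unfolding content_def using zero_below by (subst ennreal_SUP_add_right) auto
    also have "\<dots> \<le> content V"
    proof (rule SUP_least)
      fix h assume h: "h \<in> below (V - F)"
      have "(\<lambda>x. g x + h x) \<in> below V"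
      proof -
        have "0 \<le> g x + h x \<and> g x + h x \<le> indicator V x" for x
        proof (cases "x \<in> F")
          case True
          then have "h x = 0" "x \<in> V" using belowD(4)[OF h, of x] F by auto
          then show ?thesis using belowD[OF g(1), of x] by auto
        next
          case False
          then have "g x = 0" by (auto simp: F_def g_def)
          then show ?thesis using belowD[OF h, of x] by (cases "x \<in> V") auto
        qed
        then show ?thesis using below_Cc g h by (auto simp: below_def intro!: Cc_add)
      qed
      then have "ennreal (\<Lambda> (\<lambda>x. g x + h x)) \<le> content V" by (rule content_upper)
      moreover have "\<Lambda> g \<ge> 0" "\<Lambda> h \<ge> 0"
        using nonneg[OF below_Cc] belowD(1) g(1) h by metis+
      ultimately show "ennreal (\<Lambda> g) + ennreal (\<Lambda> h) \<le> content V"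
        using add[OF below_Cc[OF g(1)] below_Cc[OF h]] by simp
    qed
    finally have *: "ennreal (\<Lambda> g) + outer ?R \<le> content V" .
    have "\<Lambda> g \<ge> 0" using nonneg[OF below_Cc[OF g(1)]] belowD(1)[OF g(1)] by blast
    then have "ennreal (\<Lambda> f) \<le> ennreal (\<Lambda> g) + ennreal e"
      using g(2) d e by (simp add: ennreal_plus[symmetric] del: ennreal_plus)
    then have "ennreal (\<Lambda> f) + outer ?R \<le> ennreal (\<Lambda> g) + ennreal e + outer ?R" by (rule add_right_mono)
    also have "\<dots> = ennreal (\<Lambda> g) + outer ?R + ennreal e" by (simp add: ac_simps)
    also have "\<dots> \<le> content V + ennreal e" using * by (rule add_right_mono)
    finally show "ennreal (\<Lambda> f) + outer ?R \<le> content V + ennreal e" .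
  qed
  finally show "outer (U \<inter> A) + outer ?R \<le> content V" .
qed

definition riesz_measure :: "'a measure" where
  "riesz_measure = measure_of UNIV (sets borel) outer"

lemma sets_riesz: "sets riesz_measure = sets borel"
  unfolding riesz_measure_def by (metis sets.sets_measure_of_eq space_borel)

lemma space_riesz: "space riesz_measure = UNIV"
  using sets_eq_imp_space_eq[OF sets_riesz] by simp

lemma emeasure_riesz_open:
  assumes "open U"
  shows "emeasure riesz_measure U = content U"
proof -
  let ?L = "lambda_system UNIV (Pow UNIV) outer"
  have oms: "outer_measure_space (Pow UNIV) outer"
    unfolding outer_measure_space_def positive_def increasing_def countably_subadditive_def
    using outer_empty outer_mono outer_UN_le by auto
  have ms: "measure_space UNIV ?L outer"
    using sigma_algebra.caratheodory_lemma[OF sigma_algebra_Pow oms] .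
  then have sa: "sigma_algebra UNIV ?L" by (simp add: measure_space_def)
  have op: "U \<in> ?L" if "open U" for U
  proof -
    have "outer (U \<inter> A) + outer ((UNIV - U) \<inter> A) = outer A" for A
    proof (rule antisym)
      have "A = (U \<inter> A) \<union> ((UNIV - U) \<inter> A)" by auto
      then show "outer A \<le> outer (U \<inter> A) + outer ((UNIV - U) \<inter> A)" using outer_Un_le by metis
    qed (rule outer_open_split[OF that])
    then show ?thesis by (simp add: lambda_system_def)
  qed
  have "sigma_sets UNIV {S :: 'a set. open S} \<subseteq> ?L"
    by (rule sigma_algebra.sigma_sets_subset[OF sa]) (use op in auto)
  then have sub: "sets borel \<subseteq> ?L" by (simp add: borel_def)
  have "measure_space UNIV (sets borel) outer"
    by (rule measure_down[OF ms _ sub]) (metis sets.sigma_algebra_axioms space_borel)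
  then show ?thesis
    unfolding riesz_measure_def measure_space_def using assms
    by (subst emeasure_measure_of_sigma) (auto simp: outer_open)
qed

lemma emeasure_riesz_UNIV: "emeasure riesz_measure UNIV \<le> ennreal B"
  by (simp add: emeasure_riesz_open content_le)

lemma finite_riesz: "finite_measure riesz_measure"
  using emeasure_riesz_UNIV by (intro finite_measureI) (auto simp: space_riesz top_unique)

lemma Cc_integrable_riesz: 
  assumes "f \<in> Cc" shows "integrable riesz_measure f"
proof -
  interpret finite_measure riesz_measure by (rule finite_riesz)
  obtain c where "\<And>x. \<bar>f x\<bar> \<le> c" using Cc_bounded[OF assms] by metis
  then show ?thesis using Cc_borel[OF assms]
    by (intro integrable_const_bound[of _ c]) (auto simp: measurable_cong_sets[OF sets_riesz refl])
qed

text \<open>Layer-cake comparison.  Cutting the range into \<open>N\<close> slices, both functionals of the \<open>i\<close>-th slice lie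
  between the measures of two consecutive superlevel sets; the differences telescope.\<close>

lemma riesz_slice:
  assumes f: "f \<in> Cc" "\<And>x. 0 \<le> f x" and N: "N > 0"
  defines "s \<equiv> \<lambda>i x. min 1 (max 0 (real N * f x - real i))"
    and "m \<equiv> \<lambda>i. measure riesz_measure {x. real i < real N * f x}"
  shows "s i \<in> Cc" "m (Suc i) \<le> \<Lambda> (s i)" "\<Lambda> (s i) \<le> m i"
    "m (Suc i) \<le> (LINT x|riesz_measure. s i x)" "(LINT x|riesz_measure. s i x) \<le> m i"
proof -
  interpret finite_measure riesz_measure by (rule finite_riesz)
  have op: "open {x. real i < real N * f x}" for i
    by (intro open_Collect_less continuous_intros CcD(1)[OF f(1)])
  have mc: "ennreal (m i) = content {x. real i < real N * f x}" for i
    unfolding m_def using emeasure_riesz_open[OF op] by (simp add: emeasure_eq_measure)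
  show s: "s i \<in> Cc"
    unfolding s_def
    by (rule Cc_dominated[OF f(1)]) (use CcD(1)[OF f(1)] in \<open>auto intro!: continuous_intros\<close>)
  have below: "s i \<in> below {x. real i < real N * f x}"
    using s by (auto simp: below_def s_def indicator_def)
  have s0: "0 \<le> \<Lambda> (s i)" using nonneg[OF s] by (auto simp: s_def)
  have "ennreal (\<Lambda> (s i)) \<le> ennreal (m i)" unfolding mc by (rule content_upper[OF below])
  then show "\<Lambda> (s i) \<le> m i" by (simp add: m_def)
  have "ennreal (m (Suc i)) \<le> ennreal (\<Lambda> (s i))"
    unfolding mc content_def
  proof (intro SUP_least ennreal_leI mono s)
    fix g x assume g: "g \<in> below {x. real (Suc i) < real N * f x}"
    show "g x \<le> s i x"
    proof (cases "real (Suc i) < real N * f x")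
      case True
      then have "s i x = 1" by (simp add: s_def)
      then show ?thesis using belowD(3)[OF g, of x] by simp
    next
      case False
      then have "g x = 0" using belowD(4)[OF g] by simp
      then show ?thesis by (simp add: s_def)
    qed
  qed (use below_Cc in blast)
  then show "m (Suc i) \<le> \<Lambda> (s i)" using s0 by simp
  have meas: "{x. real i < real N * f x} \<in> sets riesz_measure" for i
    unfolding sets_riesz using op by simp
  have "(LINT x|riesz_measure. s i x) \<le> (LINT x|riesz_measure. indicator {x. real i < real N * f x} x)"
    by (rule integral_mono[OF Cc_integrable_riesz[OF s] _ belowD(2)[OF below]])
      (use meas in \<open>auto simp: integrable_indicator_iff less_top[symmetric]\<close>)
  then show "(LINT x|riesz_measure. s i x) \<le> m i" by (simp add: m_def space_riesz)
  have "(LINT x|riesz_measure. indicator {x. real (Suc i) < real N * f x} x) \<le> (LINT x|riesz_measure. s i x)"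
  proof (rule integral_mono[OF _ Cc_integrable_riesz[OF s]])
    show "integrable riesz_measure (indicator {x. real (Suc i) < real N * f x} :: 'a \<Rightarrow> real)"
      using meas[of "Suc i"] by (simp add: integrable_indicator_iff less_top[symmetric] del: of_nat_Suc)
  qed (auto simp: s_def indicator_def)
  then show "m (Suc i) \<le> (LINT x|riesz_measure. s i x)" by (simp add: m_def space_riesz)
qed

lemma sum_slices:
  fixes t :: real
  assumes "0 \<le> t" "t \<le> N"
  shows "(\<Sum>i<N. min 1 (max 0 (t - real i))) = t"
proof -
  have "(\<Sum>i<N. min 1 (max 0 (t - real i))) = min (real N) t" if "0 \<le> t" for t :: real and N
    using that
  proof (induction N)
    case (Suc N)
    have "min (real N) t + min 1 (max 0 (t - real N)) = min (real (Suc N)) t" by simp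
    then show ?case using Suc by simp
  qed simp
  then show ?thesis using assms by simp
qed

lemma riesz_representation:
  assumes f: "f \<in> Cc"
  shows "\<Lambda> f = (LINT x|riesz_measure. f x)"
proof -
  interpret finite_measure riesz_measure by (rule finite_riesz)
  have unit: "\<Lambda> f = (LINT x|riesz_measure. f x)" if f: "f \<in> Cc" "\<And>x. 0 \<le> f x" "\<And>x. f x \<le> 1" for f
  proof -
    have est: "real N * \<bar>\<Lambda> f - (LINT x|riesz_measure. f x)\<bar> \<le> B" if N: "N > 0" for N :: nat
    proof -
      define s where "s i x = min 1 (max 0 (real N * f x - real i))" for i :: nat and x
      define m where "m i = measure riesz_measure {x. real i < real N * f x}" for i :: nat
      note sl = riesz_slice[OF f(1,2) N, folded s_def m_def]
      have "real N * f x = (\<Sum>i<N. s i x)" for x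
        unfolding s_def using f N by (subst sum_slices) (auto intro: mult_left_le)
      then have Nf: "(\<lambda>x. real N * f x) = (\<lambda>x. \<Sum>i<N. s i x)" by simp
      have Ls: "\<Lambda> (\<lambda>x. \<Sum>i<k. s i x) = (\<Sum>i<k. \<Lambda> (s i)) \<and> (\<lambda>x. \<Sum>i<k. s i x) \<in> Cc" for k
      proof (induction k)
        case (Suc k)
        then show ?case using sl(1)[of k] add[of "\<lambda>x. \<Sum>i<k. s i x" "s k"] by (auto intro!: Cc_add)
      qed (auto simp: zero Cc_zero)
      have "real N * (\<Lambda> f - (LINT x|riesz_measure. f x)) = \<Lambda> (\<lambda>x. real N * f x) - (LINT x|riesz_measure. real N * f x)"
        using cmult[OF f(1)] by (simp add: right_diff_distrib)
      also have "\<dots> = (\<Sum>i<N. \<Lambda> (s i)) - (\<Sum>i<N. LINT x|riesz_measure. s i x)"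
        unfolding Nf using Ls Cc_integrable_riesz sl(1)
        by (simp add: Bochner_Integration.integral_sum)
      also have "\<dots> = (\<Sum>i<N. \<Lambda> (s i) - (LINT x|riesz_measure. s i x))" by (simp add: sum_subtractf)
      also have "\<bar>\<dots>\<bar> \<le> (\<Sum>i<N. m i - m (Suc i))"
        using sl by (intro order_trans[OF sum_abs] sum_mono) (smt (verit))
      also have "\<dots> = m 0 - m N" by (rule sum_lessThan_telescope')
      also have "\<dots> \<le> m 0" by (simp add: m_def)
      also have "m 0 \<le> B"
      proof -
        have "m 0 \<le> measure riesz_measure UNIV" unfolding m_def
          by (intro finite_measure_mono) (auto simp: sets_riesz)
        also have "ennreal \<dots> \<le> ennreal B" using emeasure_riesz_UNIV by (simp add: emeasure_eq_measure)
        then have "measure riesz_measure UNIV \<le> B" using B_nonneg by simp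
        finally show ?thesis .
      qed
      finally show ?thesis using N by (simp add: abs_mult)
    qed
    have "\<bar>\<Lambda> f - (LINT x|riesz_measure. f x)\<bar> \<le> 0"
    proof (rule ccontr)
      assume "\<not> ?thesis"
      then obtain N where "real N * \<bar>\<Lambda> f - (LINT x|riesz_measure. f x)\<bar> > B"
        using reals_Archimedean3[of "\<bar>\<Lambda> f - (LINT x|riesz_measure. f x)\<bar>"] by auto
      moreover then have "N > 0" using B_nonneg by (cases N) auto
      ultimately show False using est[of N] by simp
    qed
    then show ?thesis by simp
  qed
  have pos: "\<Lambda> f = (LINT x|riesz_measure. f x)" if f: "f \<in> Cc" "\<And>x. 0 \<le> f x" for f
  proof -
    obtain c where c: "c > 0" "\<And>x. \<bar>f x\<bar> \<le> c" using Cc_bounded[OF f(1)] by metis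
    have "f x \<le> c" for x using c(2)[of x] by simp
    then have "\<Lambda> (\<lambda>x. 1 / c * f x) = (LINT x|riesz_measure. 1 / c * f x)"
      using f c by (intro unit Cc_cmult) (auto simp: field_simps)
    then have "1 / c * \<Lambda> f = 1 / c * (LINT x|riesz_measure. f x)"
      unfolding cmult[OF f(1)] by simp
    then show ?thesis using c(1) by simp
  qed
  define g where "g x = max 0 (f x)" for x
  define h where "h x = max 0 (- 1 * f x)" for x
  have gh: "g \<in> Cc" "h \<in> Cc" unfolding g_def h_def by (intro Cc_pos_part Cc_cmult f)+
  have f_eq: "f = (\<lambda>x. g x - h x)" by (auto simp: g_def h_def)
  have "\<Lambda> f = \<Lambda> g - \<Lambda> h" unfolding f_eq by (rule diff[OF gh])
  also have "\<dots> = (LINT x|riesz_measure. g x) - (LINT x|riesz_measure. h x)"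
    using pos[OF gh(1)] pos[OF gh(2)] by (simp add: g_def h_def)
  also have "\<dots> = (LINT x|riesz_measure. f x)"
    unfolding f_eq using gh by (simp add: Cc_integrable_riesz)
  finally show ?thesis .
qed

end


section \<open>Approximation of Borel functions and uniqueness of Radon measures\<close>

lemma locally_compact_countable_cover:
  assumes "locally_compact_space (euclidean :: 'a::{metric_space, second_countable_topology} topology)"
  obtains V :: "nat \<Rightarrow> 'a::{metric_space, second_countable_topology} set"
  where "\<And>n. open (V n)" "\<And>n. compact (closure (V n))" "(\<Union>n. V n) = UNIV"
proof -
  define \<F> where "\<F> = {U :: 'a set. open U \<and> compact (closure U)}"
  have "\<exists>U\<in>\<F>. x \<in> U" for x :: 'a
  proof -
    obtain U K where "openin euclidean U" "compactin euclidean K" and UK: "x \<in> U" "U \<subseteq> K"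
      using assms unfolding locally_compact_space_def topspace_euclidean by blast
    then have UK: "open U" "compact K" "x \<in> U" "U \<subseteq> K"
      by simp_all
    have "closure U \<subseteq> K" using UK by (intro closure_minimal compact_imp_closed) auto
    then have "compact (closure U)"
      using compact_Int_closed[OF UK(2), of "closure U"] by (simp add: Int_absorb1)
    then show ?thesis using UK by (auto simp: \<F>_def)
  qed
  then have "\<Union>\<F> = UNIV" by blast
  moreover obtain \<F>' where F': "\<F>' \<subseteq> \<F>" "countable \<F>'" "\<Union>\<F>' = \<Union>\<F>"
    using Lindelof[of \<F>] by (auto simp: \<F>_def)
  ultimately have ne: "\<F>' \<noteq> {}" and U: "\<Union>\<F>' = UNIV" by auto
  define V where "V = from_nat_into \<F>'"
  have r: "range V = \<F>'" unfolding V_def using range_from_nat_into[OF ne F'(2)] .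
  then have "V n \<in> \<F>" for n using F'(1) by auto
  then show ?thesis using that[of V] r U by (auto simp: \<F>_def)
qed

text \<open>This sequence stands in for the constant \<open>1\<close>, which has compact support only in compact spaces.\<close>

lemma Cc_exhaustion:
  assumes "locally_compact_space (euclidean :: 'a::{metric_space, second_countable_topology} topology)"
  obtains h :: "nat \<Rightarrow> 'a::{metric_space, second_countable_topology} \<Rightarrow> real"
  where "\<And>n. h n \<in> Cc" "\<And>n x. 0 \<le> h n x" "\<And>n x. h n x \<le> 1" "\<And>x. (\<lambda>n. h n x) \<longlonglongrightarrow> 1"
proof -
  obtain V :: "nat \<Rightarrow> 'a set" where V: "\<And>n. open (V n)" "\<And>n. compact (closure (V n))" "(\<Union>n. V n) = UNIV"
    using locally_compact_countable_cover[OF assms] by blast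
  define h where "h n x = min 1 (\<Sum>i<n. cutoff (V i) n x)" for n x
  show ?thesis
  proof (rule that)
    show "h n \<in> Cc" for n
    proof (rule CcI)
      show "continuous_on UNIV (h n)"
        unfolding h_def by (intro continuous_intros cutoff_continuous)
      show "compact (\<Union>i<n. closure (V i))" by (intro compact_UN V) auto
      show "x \<in> (\<Union>i<n. closure (V i))" if nz: "h n x \<noteq> 0" for x
      proof (rule ccontr)
        assume "x \<notin> (\<Union>i<n. closure (V i))"
        then have "cutoff (V i) n x = 0" if "i < n" for i
          using that closure_subset[of "V i"] by (intro cutoff_outside) auto
        then show False using nz by (simp add: h_def)
      qed
    qed
    show "0 \<le> h n x" "h n x \<le> 1" for n x
      by (auto simp: h_def sum_nonneg cutoff_range)
    show "(\<lambda>n. h n x) \<longlonglongrightarrow> 1" for x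
    proof (rule tendsto_eventually)
      obtain i where i: "x \<in> V i" using V(3) by blast
      show "\<forall>\<^sub>F n in sequentially. h n x = 1"
        using cutoff_eventually[OF V(1) i] eventually_gt_at_top[of i]
      proof eventually_elim
        case (elim n)
        have "cutoff (V i) n x \<le> (\<Sum>i<n. cutoff (V i) n x)"
          using elim by (intro member_le_sum cutoff_range) auto
        then show ?case using elim by (simp add: h_def)
      qed
    qed
  qed
qed

text \<open>Approximation in \<open>L\<^sup>1\<close> of several measures by the same function: an inequality between integrals
  against different measures is only transferred if all the integrals are approximated together.\<close>

definition L1_approximable :: "nat \<Rightarrow> (nat \<Rightarrow> 'a::topological_space measure) \<Rightarrow> ('a \<Rightarrow> real) \<Rightarrow> bool" where
  "L1_approximable n \<mu> \<phi> \<longleftrightarrow>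
     (\<forall>e>0. \<exists>\<psi>\<in>Cc. \<forall>i<n. (LINT x|\<mu> i. \<bar>\<phi> x - \<psi> x\<bar>) < e)"

lemma Cc_integrable:
  assumes "sets M = sets borel" "finite_measure M" "f \<in> Cc"
  shows "integrable M f"
proof -
  interpret finite_measure M by fact
  obtain c where "\<And>x. \<bar>f x\<bar> \<le> c" using Cc_bounded[OF assms(3)] by metis
  then show ?thesis using Cc_borel[OF assms(3)]
    by (intro integrable_const_bound[of _ c]) (auto simp: measurable_cong_sets[OF assms(1) refl])
qed

lemma L1_approximable_limit:
  assumes fin: "\<And>i. i < n \<Longrightarrow> finite_measure (\<mu> i)" "\<And>i. i < n \<Longrightarrow> sets (\<mu> i) = sets borel"
    and U: "\<And>j. L1_approximable n \<mu> (U j)" "\<And>i j. i < n \<Longrightarrow> integrable (\<mu> i) (U j)"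
    and w: "\<And>i. i < n \<Longrightarrow> integrable (\<mu> i) w" "\<And>i. i < n \<Longrightarrow> integrable (\<mu> i) \<phi>"
    and lim: "\<And>x. (\<lambda>j. U j x) \<longlonglongrightarrow> \<phi> x" and bnd: "\<And>j x. \<bar>U j x\<bar> \<le> w x"
  shows "L1_approximable n \<mu> \<phi>"
  unfolding L1_approximable_def
proof (intro allI impI)
  fix e :: real assume e: "e > 0"
  have "(\<lambda>j. LINT x|\<mu> i. \<bar>\<phi> x - U j x\<bar>) \<longlonglongrightarrow> (LINT x|\<mu> i. 0)" if i: "i < n" for i
  proof (rule integral_dominated_convergence[where w="\<lambda>x. \<bar>\<phi> x\<bar> + w x"])
    show "AE x in \<mu> i. (\<lambda>j. \<bar>\<phi> x - U j x\<bar>) \<longlonglongrightarrow> 0"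
    proof (rule AE_I2)
      fix x
      have "(\<lambda>j. \<bar>\<phi> x - U j x\<bar>) \<longlonglongrightarrow> \<bar>\<phi> x - \<phi> x\<bar>" by (intro tendsto_intros lim)
      then show "(\<lambda>j. \<bar>\<phi> x - U j x\<bar>) \<longlonglongrightarrow> 0" by simp
    qed
    show "AE x in \<mu> i. norm \<bar>\<phi> x - U j x\<bar> \<le> \<bar>\<phi> x\<bar> + w x" for j
    proof (rule AE_I2)
      fix x
      show "norm \<bar>\<phi> x - U j x\<bar> \<le> \<bar>\<phi> x\<bar> + w x"
        using abs_triangle_ineq4[of "\<phi> x" "U j x"] bnd[of j x] by simp
    qed
  qed (use i w U(2) in auto)
  then have "\<forall>\<^sub>F j in sequentially. (LINT x|\<mu> i. \<bar>\<phi> x - U j x\<bar>) < e / 2" if "i < n" for i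
    using order_tendstoD(2)[of _ "LINT x|\<mu> i. 0" sequentially "e / 2"] that e by auto
  then have "\<forall>\<^sub>F j in sequentially. \<forall>i\<in>{..<n}. (LINT x|\<mu> i. \<bar>\<phi> x - U j x\<bar>) < e / 2"
    by (intro eventually_ball_finite) auto
  then obtain j where j: "\<And>i. i < n \<Longrightarrow> (LINT x|\<mu> i. \<bar>\<phi> x - U j x\<bar>) < e / 2"
    by (auto simp: eventually_sequentially)
  obtain \<psi> where \<psi>: "\<psi> \<in> Cc" "\<And>i. i < n \<Longrightarrow> (LINT x|\<mu> i. \<bar>U j x - \<psi> x\<bar>) < e / 2"
    using U(1)[of j] e unfolding L1_approximable_def by (metis half_gt_zero_iff)
  show "\<exists>\<psi>\<in>Cc. \<forall>i<n. (LINT x|\<mu> i. \<bar>\<phi> x - \<psi> x\<bar>) < e"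
  proof (intro bexI[of _ \<psi>] allI impI \<psi>(1))
    fix i assume i: "i < n"
    note int = w(2)[OF i] U(2)[OF i, of j] Cc_integrable[OF fin(2)[OF i] fin(1)[OF i] \<psi>(1)]
    have "(LINT x|\<mu> i. \<bar>\<phi> x - \<psi> x\<bar>) \<le> (LINT x|\<mu> i. \<bar>\<phi> x - U j x\<bar> + \<bar>U j x - \<psi> x\<bar>)"
      using int by (intro integral_mono) auto
    also have "\<dots> = (LINT x|\<mu> i. \<bar>\<phi> x - U j x\<bar>) + (LINT x|\<mu> i. \<bar>U j x - \<psi> x\<bar>)"
      using int by (intro Bochner_Integration.integral_add) auto
    also have "\<dots> < e" using j[OF i] \<psi>(2)[OF i] by simp
    finally show "(LINT x|\<mu> i. \<bar>\<phi> x - \<psi> x\<bar>) < e" .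
  qed
qed

lemma L1_approximable_add:
  fixes f g :: "'a::t2_space \<Rightarrow> real"
  assumes fin: "\<And>i. i < n \<Longrightarrow> finite_measure (\<mu> i)" "\<And>i. i < n \<Longrightarrow> sets (\<mu> i) = sets borel"
    and f: "L1_approximable n \<mu> f" "\<And>i. i < n \<Longrightarrow> integrable (\<mu> i) f"
    and g: "L1_approximable n \<mu> g" "\<And>i. i < n \<Longrightarrow> integrable (\<mu> i) g"
  shows "L1_approximable n \<mu> (\<lambda>x. f x + c * g x)"
  unfolding L1_approximable_def
proof (intro allI impI)
  fix e :: real assume e: "e > 0"
  define d where "d = e / (2 * (\<bar>c\<bar> + 1))"
  have "\<bar>c\<bar> + 1 > 0" using abs_ge_zero[of c] by linarith
  then have d0: "d > 0" and d1: "(\<bar>c\<bar> + 1) * d = e / 2" using e by (simp_all add: d_def field_simps)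
  have d: "d > 0" "\<bar>c\<bar> * d < e / 2" using d0 d1 by (simp_all add: distrib_right)
  obtain \<psi> where \<psi>: "\<psi> \<in> Cc" "\<And>i. i < n \<Longrightarrow> (LINT x|\<mu> i. \<bar>f x - \<psi> x\<bar>) < e / 2"
    using f(1) e unfolding L1_approximable_def by (metis half_gt_zero_iff)
  obtain \<rho> where \<rho>: "\<rho> \<in> Cc" "\<And>i. i < n \<Longrightarrow> (LINT x|\<mu> i. \<bar>g x - \<rho> x\<bar>) < d"
    using g(1) d(1) unfolding L1_approximable_def by metis
  have "(\<lambda>x. \<psi> x + c * \<rho> x) \<in> Cc" by (rule Cc_add[OF \<psi>(1) Cc_cmult[OF \<rho>(1)]])
  then show "\<exists>\<psi>\<in>Cc. \<forall>i<n. (LINT x|\<mu> i. \<bar>f x + c * g x - \<psi> x\<bar>) < e"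
  proof (intro bexI[of _ "\<lambda>x. \<psi> x + c * \<rho> x"] allI impI)
    fix i assume i: "i < n"
    note int = f(2)[OF i] g(2)[OF i] Cc_integrable[OF fin(2)[OF i] fin(1)[OF i] \<psi>(1)]
      Cc_integrable[OF fin(2)[OF i] fin(1)[OF i] \<rho>(1)]
    have "(LINT x|\<mu> i. \<bar>f x + c * g x - (\<psi> x + c * \<rho> x)\<bar>)
      \<le> (LINT x|\<mu> i. \<bar>f x - \<psi> x\<bar> + \<bar>c\<bar> * \<bar>g x - \<rho> x\<bar>)"
    proof (rule integral_mono)
      fix x
      have "f x + c * g x - (\<psi> x + c * \<rho> x) = (f x - \<psi> x) + c * (g x - \<rho> x)"
        by (simp add: algebra_simps)
      then show "\<bar>f x + c * g x - (\<psi> x + c * \<rho> x)\<bar> \<le> \<bar>f x - \<psi> x\<bar> + \<bar>c\<bar> * \<bar>g x - \<rho> x\<bar>"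
        using abs_triangle_ineq[of "f x - \<psi> x" "c * (g x - \<rho> x)"] by (simp add: abs_mult)
    qed (use int in auto)
    also have "\<dots> = (LINT x|\<mu> i. \<bar>f x - \<psi> x\<bar>) + \<bar>c\<bar> * (LINT x|\<mu> i. \<bar>g x - \<rho> x\<bar>)"
      using int by simp
    also have "\<dots> \<le> (LINT x|\<mu> i. \<bar>f x - \<psi> x\<bar>) + \<bar>c\<bar> * d"
      using \<rho>(2)[OF i] by (intro add_left_mono mult_left_mono) auto
    also have "\<dots> < e" using \<psi>(2)[OF i] d by linarith
    finally show "(LINT x|\<mu> i. \<bar>f x + c * g x - (\<psi> x + c * \<rho> x)\<bar>) < e" .
  qed
qed

lemma L1_approximable_Cc: "f \<in> Cc \<Longrightarrow> L1_approximable n \<mu> f"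
  unfolding L1_approximable_def by (intro allI impI bexI[of _ f]) auto

context
  fixes \<mu> :: "nat \<Rightarrow> 'a::{metric_space, second_countable_topology} measure" and n :: nat
  assumes lc: "locally_compact_space (euclidean :: 'a topology)"
    and fin: "\<And>i. i < n \<Longrightarrow> finite_measure (\<mu> i)" and sets: "\<And>i. i < n \<Longrightarrow> sets (\<mu> i) = sets borel"
begin

lemma bounded_borel_integrable:
  fixes f :: "'a \<Rightarrow> real"
  assumes "f \<in> borel_measurable borel" "\<And>x. \<bar>f x\<bar> \<le> c" "i < n"
  shows "integrable (\<mu> i) f"
proof -
  interpret finite_measure "\<mu> i" using fin assms(3) .
  show ?thesis using assms sets
    by (intro integrable_const_bound[of _ c]) (auto cong: measurable_cong_sets)
qed

text \<open>Indicators of open sets are limits of cutoffs, and the approximable sets form a Dynkin system.\<close>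

lemma L1_approximable_indicator:
  assumes "A \<in> sets borel"
  shows "L1_approximable n \<mu> (indicator A)"
proof -
  have ind: "integrable (\<mu> i) (indicator A :: 'a \<Rightarrow> real)" if "i < n" "A \<in> sets borel" for i A
    using that by (intro bounded_borel_integrable[of _ 1]) (auto simp: indicator_def)
  obtain h :: "nat \<Rightarrow> 'a \<Rightarrow> real" where h: "\<And>n. h n \<in> Cc" "\<And>n x. 0 \<le> h n x" "\<And>n x. h n x \<le> 1"
    "\<And>x. (\<lambda>n. h n x) \<longlonglongrightarrow> 1"
    using Cc_exhaustion[OF lc] by blast
  have op: "L1_approximable n \<mu> (indicator U)" if U: "open U" for U
  proof (rule L1_approximable_limit[where U="\<lambda>j x. cutoff U j x * h j x" and w="\<lambda>x. 1"])
    have C: "(\<lambda>x. cutoff U j x * h j x) \<in> Cc" for j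
      by (rule Cc_dominated[OF h(1)[of j]])
        (use CcD(1)[OF h(1)[of j]] in \<open>auto intro!: continuous_intros cutoff_continuous\<close>)
    show "L1_approximable n \<mu> (\<lambda>x. cutoff U j x * h j x)" for j
      by (rule L1_approximable_Cc[OF C])
    show "integrable (\<mu> i) (\<lambda>x. cutoff U j x * h j x)" if "i < n" for i j
      using that by (intro Cc_integrable sets fin C)
    show "(\<lambda>j. cutoff U j x * h j x) \<longlonglongrightarrow> indicator U x" for x
      using tendsto_mult[OF cutoff_tendsto[OF U, of x] h(4)[of x]] by simp
    show "\<bar>cutoff U j x * h j x\<bar> \<le> 1" for j x
      using h(2,3)[of j x] cutoff_range[of U j x] by (simp add: abs_mult mult_le_one)
    show "integrable (\<mu> i) (\<lambda>x. 1 :: real)" if "i < n" for i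
      using that by (intro bounded_borel_integrable[of _ 1]) auto
    show "integrable (\<mu> i) (indicator U :: 'a \<Rightarrow> real)" if "i < n" for i
      using that U by (intro ind) auto
  qed (use fin sets in auto)
  have "A \<in> sigma_sets UNIV {S. open S}" using assms by (simp add: borel_def)
  then show ?thesis
  proof (induction rule: sigma_sets_induct_disjoint[of "{S. open S}" UNIV, rotated 2,
      consumes 1, case_names basic empty compl union Int_stable Pow])
    case (basic A)
    then show ?case using op by simp
  next
    case empty
    show ?case by (rule op) simp
  next
    case (compl A)
    have A: "A \<in> sets borel" using compl(1) by (simp add: borel_def)
    have "L1_approximable n \<mu> (\<lambda>x. indicator UNIV x + (- 1) * indicator A x)"
      using A compl by (intro L1_approximable_add[OF fin sets op] ind) auto
    moreover have "(\<lambda>x. indicator UNIV x + (- 1) * indicator A x) = (indicator (UNIV - A) :: 'a \<Rightarrow> real)"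
      by (auto simp: indicator_def)
    ultimately show ?case by simp
  next
    case (union A)
    have A: "A i \<in> sets borel" for i using union(2) by (auto simp: borel_def)
    have "L1_approximable n \<mu> (indicator (\<Union>i<j. A i))" for j
    proof (induction j)
      case 0
      have "L1_approximable n \<mu> (indicator {})" by (rule op) simp
      then show ?case by (simp only: lessThan_0 UN_empty)
    next
      case (Suc j)
      have "L1_approximable n \<mu> (\<lambda>x. indicator (\<Union>i<j. A i) x + 1 * indicator (A j) x)"
        using A union(3) Suc by (intro L1_approximable_add ind fin sets) auto
      moreover have "(\<lambda>x. indicator (\<Union>i<j. A i) x + 1 * indicator (A j) x)
        = (indicator (\<Union>i<Suc j. A i) :: 'a \<Rightarrow> real)"
      proof -
        have "A i \<inter> A j = {}" if "i < j" for i
          using disjoint_family_onD[OF union(1), of i j] that by simp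
        then have "(\<Union>i<j. A i) \<inter> A j = {}" by auto
        moreover have "(\<Union>i<Suc j. A i) = (\<Union>i<j. A i) \<union> A j" by (simp add: lessThan_Suc Un_commute)
        moreover have "(\<lambda>x. indicator S x + 1 * indicator T x) = (indicator (S \<union> T) :: 'a \<Rightarrow> real)"
          if "S \<inter> T = {}" for S T using that by (auto simp: indicator_def fun_eq_iff)
        ultimately show ?thesis by simp
      qed
      ultimately show ?case by simp
    qed
    then show ?case
    proof (rule L1_approximable_limit[where w="\<lambda>x. 1", rotated 2])
      show "(\<lambda>j. indicator (\<Union>i<j. A i) x) \<longlonglongrightarrow> (indicator (\<Union>i. A i) x :: real)" for x
        by (rule LIMSEQ_indicator_UN)
      show "integrable (\<mu> i) (indicator (\<Union>i<j. A i) :: 'a \<Rightarrow> real)" if "i < n" for i j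
        using A that by (intro ind) auto
      show "integrable (\<mu> i) (indicator (\<Union>i. A i) :: 'a \<Rightarrow> real)" if "i < n" for i
        using A that by (intro ind) auto
      show "integrable (\<mu> i) (\<lambda>x. 1 :: real)" if "i < n" for i
        using that by (intro bounded_borel_integrable[of _ 1]) auto
    qed (use fin sets in \<open>auto simp: indicator_def\<close>)
  qed (auto simp: Int_stable_def)
qed

lemma L1_approximable_borel:
  assumes "\<phi> \<in> borel_measurable borel" "\<And>x. 0 \<le> \<phi> x" "\<And>x. \<phi> x \<le> c"
  shows "L1_approximable n \<mu> \<phi>"
proof -
  have "(\<forall>x. \<phi> x \<le> c) \<longrightarrow> L1_approximable n \<mu> \<phi>" for c
    using assms(1,2)
  proof (induction arbitrary: c rule: borel_measurable_induct_real)
    case (set A)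
    then show ?case using L1_approximable_indicator by simp
  next
    case (mult u a)
    show ?case
    proof (intro impI)
      assume le: "\<forall>x. a * u x \<le> c"
      have zero: "L1_approximable n \<mu> (\<lambda>x. 0)" by (rule L1_approximable_Cc[OF Cc_zero])
      show "L1_approximable n \<mu> (\<lambda>x. a * u x)"
      proof (cases "a = 0")
        case False
        then have ub: "u x \<le> c / a" for x using le mult(1) by (simp add: field_simps)
        then have "L1_approximable n \<mu> u" using mult(4) by blast
        then have "L1_approximable n \<mu> (\<lambda>x. 0 + a * u x)"
          using ub mult(2,3) zero
          by (intro L1_approximable_add fin sets bounded_borel_integrable[of u "c / a"]) auto
        then show ?thesis by simp
      qed (use zero in simp)
    qed
  next
    case (add u v)
    show ?case
    proof (intro impI)
      assume le: "\<forall>x. v x + u x \<le> c"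
      have ub: "u x \<le> c" "v x \<le> c" for x
        using le[rule_format, of x] add.hyps(2)[of x] add.hyps(4)[of x] by auto
      have "L1_approximable n \<mu> u" "L1_approximable n \<mu> v" using ub add.IH by blast+
      then have "L1_approximable n \<mu> (\<lambda>x. v x + 1 * u x)"
        using ub add.hyps by (intro L1_approximable_add fin sets bounded_borel_integrable[of u c]
          bounded_borel_integrable[of v c]) auto
      then show "L1_approximable n \<mu> (\<lambda>x. v x + u x)" by simp
    qed
  next
    case (seq U)
    show ?case
    proof (intro impI)
      assume le: "\<forall>x. \<phi> x \<le> c"
      have Ule: "U j x \<le> c" for j x
      proof -
        have "U j x \<le> \<phi> x"
          using seq.hyps(3,4) by (intro incseq_le) (auto simp: incseq_def le_fun_def)
        then show ?thesis using le by (meson order_trans)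
      qed
      show "L1_approximable n \<mu> \<phi>"
      proof (rule L1_approximable_limit[where U=U and w="\<lambda>x. c"])
        show "L1_approximable n \<mu> (U j)" for j using seq.IH Ule by blast
        show "integrable (\<mu> i) (U j)" if "i < n" for i j
          using that seq(1,2) Ule by (intro bounded_borel_integrable[of _ c]) auto
        show "integrable (\<mu> i) \<phi>" if "i < n" for i
          using that assms(1,2) le by (intro bounded_borel_integrable[of _ c]) auto
        show "integrable (\<mu> i) (\<lambda>x. c)" if "i < n" for i
          using that by (intro bounded_borel_integrable[of _ "\<bar>c\<bar>"]) auto
      qed (use fin sets seq Ule in auto)
    qed
  qed
  then show ?thesis using assms(3) by blast
qed

text \<open>One sequence serves all the measures at once, which is what transfers inequalities between the
  integrals of a test function against several measures.\<close>

lemma Cc_approximating_sequence: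
  assumes "bounded_nonneg_borel \<phi>"
  obtains \<psi> :: "nat \<Rightarrow> 'a \<Rightarrow> real" where "\<And>j. \<psi> j \<in> Cc" "\<And>j x. 0 \<le> \<psi> j x"
    "\<And>i. i < n \<Longrightarrow> (\<lambda>j. LINT x|\<mu> i. \<psi> j x) \<longlonglongrightarrow> (LINT x|\<mu> i. \<phi> x)"
proof -
  obtain c where c: "\<And>x. \<bar>\<phi> x\<bar> \<le> c"
    using assms by (force simp: bounded_nonneg_borel_def bounded_iff)
  have \<phi>: "\<phi> \<in> borel_measurable borel" "\<And>x. 0 \<le> \<phi> x" "\<And>x. \<phi> x \<le> c"
    using assms c by (auto simp: bounded_nonneg_borel_def intro: order_trans[OF abs_ge_self])
  have "\<exists>\<psi>\<in>Cc. \<forall>i<n. (LINT x|\<mu> i. \<bar>\<phi> x - \<psi> x\<bar>) < inverse (real (Suc j))" for j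
    using L1_approximable_borel[OF \<phi>] unfolding L1_approximable_def by auto
  then obtain \<rho> where \<rho>: "\<And>j. \<rho> j \<in> Cc"
    "\<And>i j. i < n \<Longrightarrow> (LINT x|\<mu> i. \<bar>\<phi> x - \<rho> j x\<bar>) < inverse (real (Suc j))" by metis
  define \<psi> where "\<psi> j x = max 0 (\<rho> j x)" for j x
  have \<psi>: "\<psi> j \<in> Cc" for j unfolding \<psi>_def by (rule Cc_pos_part[OF \<rho>(1)])
  show ?thesis
  proof (rule that[OF \<psi>])
    fix i assume i: "i < n"
    note int = Cc_integrable[OF sets[OF i] fin[OF i]] bounded_borel_integrable[OF \<phi>(1) c i]
    show "(\<lambda>j. LINT x|\<mu> i. \<psi> j x) \<longlonglongrightarrow> (LINT x|\<mu> i. \<phi> x)"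
    proof (rule LIM_zero_cancel, rule Lim_null_comparison[OF always_eventually LIMSEQ_inverse_real_of_nat])
      show "\<forall>j. norm ((LINT x|\<mu> i. \<psi> j x) - (LINT x|\<mu> i. \<phi> x)) \<le> inverse (real (Suc j))"
      proof
        fix j
        have "(LINT x|\<mu> i. \<psi> j x) - (LINT x|\<mu> i. \<phi> x) = (LINT x|\<mu> i. \<psi> j x - \<phi> x)"
          using int \<psi> by simp
        also have "norm \<dots> \<le> (LINT x|\<mu> i. \<bar>\<psi> j x - \<phi> x\<bar>)"
          using integral_abs_bound by simp
        also have "\<dots> \<le> (LINT x|\<mu> i. \<bar>\<phi> x - \<rho> j x\<bar>)"
        proof (rule integral_mono)
          show "\<bar>\<psi> j x - \<phi> x\<bar> \<le> \<bar>\<phi> x - \<rho> j x\<bar>" for x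
            using \<phi>(2)[of x] by (auto simp: \<psi>_def)
        qed (use int \<psi> \<rho>(1) in auto)
        also have "\<dots> \<le> inverse (real (Suc j))" using \<rho>(2)[OF i, of j] by simp
        finally show "norm ((LINT x|\<mu> i. \<psi> j x) - (LINT x|\<mu> i. \<phi> x)) \<le> inverse (real (Suc j))" .
      qed
    qed
  qed (simp add: \<psi>_def)
qed

end

lemma radon_Cc_integrable:
  assumes "radon_measure M" "f \<in> Cc"
  shows "integrable M f"
proof -
  let ?K = "closure {x. f x \<noteq> 0}"
  have s: "sets M = sets borel" using assms(1) by (simp add: radon_measure_def)
  obtain c where c: "c > 0" "\<And>x. \<bar>f x\<bar> \<le> c" using Cc_bounded[OF assms(2)] by metis
  have "emeasure M ?K < \<infinity>" using assms CcD(2) by (auto simp: radon_measure_def)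
  then have int: "integrable M (\<lambda>x. c * indicator ?K x)"
    using s by (intro integrable_mult_right) (simp add: integrable_indicator_iff)
  show ?thesis
  proof (rule Bochner_Integration.integrable_bound[OF int])
    show "f \<in> borel_measurable M"
      using Cc_borel[OF assms(2)] by (simp add: measurable_cong_sets[OF s refl])
    show "AE x in M. norm (f x) \<le> norm (c * indicator ?K x)"
      using c closure_subset[of "{x. f x \<noteq> 0}"] by (intro AE_I2) (auto simp: indicator_def)
  qed
qed

text \<open>The open sets with compact closure generate the Borel sets and have finite measure, and their
  indicators are limits of compactly supported cutoffs dominated by them.\<close>

lemma radon_measure_eqI:
  fixes M N :: "'a::{metric_space, second_countable_topology} measure"
  assumes lc: "locally_compact_space (euclidean :: 'a topology)"
    and M: "radon_measure M" and N: "radon_measure N"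
    and eq: "\<And>f. f \<in> Cc \<Longrightarrow> (LINT x|M. f x) = (LINT x|N. f x)"
  shows "M = N"
proof -
  define E where "E = {U :: 'a set. open U \<and> compact (closure U)}"
  obtain V :: "nat \<Rightarrow> 'a set" where V: "\<And>n. open (V n)" "\<And>n. compact (closure (V n))" "(\<Union>n. V n) = UNIV"
    using locally_compact_countable_cover[OF lc] by blast
  have sub: "open U \<Longrightarrow> open W \<Longrightarrow> compact (closure U) \<Longrightarrow> U \<inter> W \<in> E" for U W
    using compact_Int_closed[of "closure U" "closure (U \<inter> W)"] closure_mono[of "U \<inter> W" U]
    by (auto simp: E_def Int_absorb1)
  have fin: "emeasure K U < \<infinity>" if "U \<in> E" "radon_measure K" for U and K :: "'a measure"
  proof -
    have "emeasure K U \<le> emeasure K (closure U)"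
      using that closure_subset by (intro emeasure_mono) (auto simp: radon_measure_def)
    also have "\<dots> < \<infinity>" using that by (auto simp: radon_measure_def E_def)
    finally show ?thesis .
  qed
  have lim: "(\<lambda>n. LINT x|K. cutoff U n x) \<longlonglongrightarrow> measure K U" if U: "U \<in> E" and K: "radon_measure K"
    for U and K :: "'a measure"
  proof -
    have s: "sets K = sets borel" using K by (simp add: radon_measure_def)
    have m: "U \<in> sets K" using U s by (auto simp: E_def)
    have "(\<lambda>n. LINT x|K. cutoff U n x) \<longlonglongrightarrow> (LINT x|K. indicator U x)"
    proof (rule integral_dominated_convergence[where w="indicator U"])
      show "integrable K (indicator U :: 'a \<Rightarrow> real)" using fin[OF U K] m by (simp add: integrable_indicator_iff)
      show "cutoff U n \<in> borel_measurable K" for n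
        unfolding measurable_cong_sets[OF s refl]
        by (intro borel_measurable_continuous_onI cutoff_continuous)
      show "AE x in K. (\<lambda>n. cutoff U n x) \<longlonglongrightarrow> indicator U x"
        using U by (intro AE_I2 cutoff_tendsto) (simp add: E_def)
      show "AE x in K. norm (cutoff U n x) \<le> indicator U x" for n
        using cutoff_range(1)[of U n] cutoff_le_indicator[of U n] by (intro AE_I2) simp
    qed (use m in simp)
    then show ?thesis using m by simp
  qed
  show ?thesis
  proof (rule measure_eqI_generator_eq[where E=E and \<Omega>=UNIV and A=V])
    show "Int_stable E" using sub by (auto simp: Int_stable_def E_def)
    fix U assume U: "U \<in> E"
    have "cutoff U n \<in> Cc" for n
      using U cutoff_outside closure_subset[of U]
      by (intro CcI[of _ "closure U"] cutoff_continuous) (auto simp: E_def)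
    then have "measure M U = measure N U"
      using LIMSEQ_unique[OF lim[OF U M]] lim[OF U N] eq by simp
    then show "emeasure M U = emeasure N U"
      using fin[OF U M] fin[OF U N] by (simp add: emeasure_eq_ennreal_measure less_top)
  next
    have "sigma_sets UNIV {S :: 'a set. open S} = sigma_sets UNIV E"
    proof (rule sigma_sets_eqI)
      fix U :: "'a set" assume "U \<in> {S. open S}"
      then have "V n \<inter> U \<in> E" for n using V sub by auto
      then have "(\<Union>n. V n \<inter> U) \<in> sigma_sets UNIV E" by (intro sigma_sets.Union sigma_sets.Basic)
      moreover have "(\<Union>n. V n \<inter> U) = U" using V(3) by blast
      ultimately show "U \<in> sigma_sets UNIV E" by simp
    qed (auto simp: E_def)
    then show "sets M = sigma_sets UNIV E" "sets N = sigma_sets UNIV E"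
      using M N by (auto simp: radon_measure_def borel_def)
    show "range V \<subseteq> E" using V by (auto simp: E_def)
    show "emeasure M (V i) \<noteq> \<infinity>" for i using fin[OF _ M, of "V i"] V by (auto simp: E_def)
  qed (use V in auto)
qed


section \<open>Energies as integrals over the product space\<close>

text \<open>The increment as a function on the product space: energies are its \<open>L\<^sup>p\<close>-norms with respect to the
  measures \<open>N r\<close> below.\<close>

definition incr :: "('a \<Rightarrow> real) \<Rightarrow> 'a \<times> 'a \<Rightarrow> real" where
  "incr f z = f (fst z) - f (snd z)"

lemma Cc_uniformly_continuous:
  fixes f :: "'a::metric_space \<Rightarrow> real"
  assumes f: "f \<in> Cc" and e: "e > 0"
  obtains d where "d > 0" "\<And>x y. dist x y < d \<Longrightarrow> \<bar>f x - f y\<bar> < e"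
proof -
  let ?K = "closure {x. f x \<noteq> 0}"
  define G where "G a = {z. \<bar>f z - a\<bar> < e / 2}" for a
  have op: "open (G a)" for a unfolding G_def
    by (intro open_Collect_less continuous_intros CcD(1)[OF f])
  have cov: "?K \<subseteq> \<Union>(range G)"
  proof
    fix x
    have "x \<in> G (f x)" using e by (simp add: G_def)
    then show "x \<in> \<Union>(range G)" by blast
  qed
  obtain d where d: "d > 0" "\<And>x. x \<in> ?K \<Longrightarrow> \<exists>A\<in>range G. ball x d \<subseteq> A"
    using Heine_Borel_lemma[OF CcD(2)[OF f] cov] op by auto
  have near: "\<bar>f x - f y\<bar> < e" if xy: "dist x y < d" "f x \<noteq> 0" for x y
  proof -
    have "x \<in> ?K" using closure_subset[of "{x. f x \<noteq> 0}"] xy by auto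
    then obtain a where a: "ball x d \<subseteq> G a" using d(2) by blast
    have "x \<in> G a" "y \<in> G a" using a xy d(1) by (auto simp: subset_iff)
    then have "\<bar>f x - a\<bar> < e / 2" "\<bar>f y - a\<bar> < e / 2" by (simp_all add: G_def)
    then show ?thesis by linarith
  qed
  show ?thesis
  proof (rule that[OF d(1)])
    fix x y :: 'a assume xy: "dist x y < d"
    show "\<bar>f x - f y\<bar> < e"
      using near[OF xy] near[of y x] xy e by (cases "f x = 0"; cases "f y = 0") (auto simp: dist_commute abs_minus_commute)
  qed
qed

locale energy_setting =
  fixes p :: real
    and m :: "'a::{metric_space, second_countable_topology} measure"
    and k :: "real \<Rightarrow> 'a \<Rightarrow> 'a \<Rightarrow> ennreal"
    and rs :: "nat \<Rightarrow> real"
  assumes p: "1 < p"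
    and locally_compact: "locally_compact_space (euclidean :: 'a topology)"
    and sets_m: "sets m = sets borel"
    and sigma_finite: "sigma_finite_measure m"
    and kernel_measurable: "\<And>r. r > 0 \<Longrightarrow> (\<lambda>(x, y). k r x y) \<in> borel_measurable borel"
    and weak_mono: "weak_monotonicity p m k"
    and asymp_local: "asymptotically_local m k"
    and regular: "regular_Bspace p m k"
    and admissible: "admissible_scales p m k rs"
begin

abbreviation B :: "('a \<Rightarrow> real) set" where "B \<equiv> Bspace p m k"

abbreviation E :: "('a \<Rightarrow> real) \<Rightarrow> real" where "E \<equiv> energy p m k rs"

text \<open>The measure \<open>k r x y m(dy) m(dx)\<close>.\<close>

definition N :: "real \<Rightarrow> ('a \<times> 'a) measure" where
  "N r = density (m \<Otimes>\<^sub>M m) (\<lambda>(x, y). k r x y)"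

definition en :: "real \<Rightarrow> ('a \<Rightarrow> real) \<Rightarrow> real" where
  "en r f = (LINT z|N r. \<bar>incr f z\<bar> powr p)"

text \<open>The energy at scale \<open>rs n\<close> localized by \<open>\<phi>\<close>.\<close>

definition J :: "('a \<Rightarrow> real) \<Rightarrow> nat \<Rightarrow> ('a \<Rightarrow> real) \<Rightarrow> real" where
  "J \<phi> n f = (LINT z|N (rs n). \<bar>incr f z\<bar> powr p * \<phi> (fst z))"

lemma p_pos: "p > 0" using p by simp

lemma rs_pos: "rs n > 0"
  using admissible by (simp add: admissible_scales_def)

lemma measurable_m: "measurable m M = measurable borel M"
  by (rule measurable_cong_sets[OF sets_m refl])

lemma space_m: "space m = UNIV"
  using sets_eq_imp_space_eq[OF sets_m] by simp

lemma sets_mm: "sets (m \<Otimes>\<^sub>M m) = sets (borel :: ('a \<times> 'a) measure)"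
proof -
  have "sets (m \<Otimes>\<^sub>M m) = sets (borel \<Otimes>\<^sub>M borel :: ('a \<times> 'a) measure)"
    by (rule sets_pair_measure_cong[OF sets_m sets_m])
  then show ?thesis by (simp only: borel_prod)
qed

lemma sets_N: "sets (N r) = sets (borel :: ('a \<times> 'a) measure)"
  by (simp add: N_def sets_mm)

lemma measurable_N: "measurable (N r) M = measurable borel M"
  by (rule measurable_cong_sets[OF sets_N refl])

lemma incr_borel:
  assumes "f \<in> borel_measurable m"
  shows "incr f \<in> borel_measurable borel"
proof -
  have [measurable]: "f \<in> borel_measurable borel" using assms by (simp add: measurable_m)
  have "(\<lambda>z. f (fst z) - f (snd z)) \<in> borel_measurable (borel \<Otimes>\<^sub>M borel)" by measurable
  then show ?thesis by (simp add: borel_prod incr_def[abs_def])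
qed

lemma fst_borel:
  fixes f :: "'a \<Rightarrow> real"
  assumes "f \<in> borel_measurable m"
  shows "(\<lambda>z. f (fst z)) \<in> borel_measurable (borel :: ('a \<times> 'a) measure)"
proof -
  have [measurable]: "f \<in> borel_measurable borel" using assms by (simp add: measurable_m)
  have "(\<lambda>z. f (fst z)) \<in> borel_measurable (borel \<Otimes>\<^sub>M (borel :: 'a measure))" by measurable
  then show ?thesis by (simp add: borel_prod)
qed

lemma Cc_measurable: "f \<in> Cc \<Longrightarrow> f \<in> borel_measurable m"
  using Cc_borel by (simp add: measurable_m)

lemma nn_integral_N:
  assumes "r > 0" and g: "g \<in> borel_measurable borel"
  shows "(\<integral>\<^sup>+z. g z \<partial>N r) = (\<integral>\<^sup>+x. (\<integral>\<^sup>+y. g (x, y) * k r x y \<partial>m) \<partial>m)"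
proof -
  interpret sigma_finite_measure m by (rule sigma_finite)
  have k: "(\<lambda>(x, y). k r x y) \<in> borel_measurable (m \<Otimes>\<^sub>M m)"
    using kernel_measurable[OF assms(1)] by (simp add: measurable_cong_sets[OF sets_mm refl])
  have g': "g \<in> borel_measurable (m \<Otimes>\<^sub>M m)"
    using g by (simp add: measurable_cong_sets[OF sets_mm refl])
  have "(\<integral>\<^sup>+z. g z \<partial>N r) = (\<integral>\<^sup>+z. (case z of (x, y) \<Rightarrow> k r x y) * g z \<partial>(m \<Otimes>\<^sub>M m))"
    unfolding N_def by (rule nn_integral_density[OF k g'])
  also have "\<dots> = (\<integral>\<^sup>+x. (\<integral>\<^sup>+y. k r x y * g (x, y) \<partial>m) \<partial>m)"
    using k g' by (subst nn_integral_fst[symmetric]) auto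
  finally show ?thesis by (simp add: mult.commute)
qed

lemma kernel_energy_eq:
  assumes "r > 0" "f \<in> borel_measurable m"
  shows "kernel_energy p m k r f = (\<integral>\<^sup>+z. ennreal (\<bar>incr f z\<bar> powr p) \<partial>N r)"
proof -
  have [measurable]: "incr f \<in> borel_measurable borel" by (rule incr_borel[OF assms(2)])
  have "(\<lambda>z. ennreal (\<bar>incr f z\<bar> powr p)) \<in> borel_measurable borel" by measurable
  from nn_integral_N[OF assms(1) this] show ?thesis by (simp add: kernel_energy_def incr_def)
qed

lemma Bspace_iff:
  "f \<in> B \<longleftrightarrow> f \<in> Lp p m \<and> (\<exists>M. \<forall>r>0. kernel_energy p m k r f \<le> ennreal M)"
proof -
  have "sup_energy p m k f < \<infinity> \<longleftrightarrow> (\<exists>M. \<forall>r>0. kernel_energy p m k r f \<le> ennreal M)"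
  proof
    assume "sup_energy p m k f < \<infinity>"
    then obtain M where M: "sup_energy p m k f = ennreal M" by (cases "sup_energy p m k f") auto
    have "kernel_energy p m k r f \<le> ennreal M" if "r > 0" for r
      unfolding M[symmetric] sup_energy_def using that by (intro SUP_upper) auto
    then show "\<exists>M. \<forall>r>0. kernel_energy p m k r f \<le> ennreal M" by blast
  next
    assume "\<exists>M. \<forall>r>0. kernel_energy p m k r f \<le> ennreal M"
    then obtain M where "\<And>r. r > 0 \<Longrightarrow> kernel_energy p m k r f \<le> ennreal M" by blast
    then have "sup_energy p m k f \<le> ennreal M" unfolding sup_energy_def by (intro SUP_least) auto
    then show "sup_energy p m k f < \<infinity>" by (simp add: le_less_trans)
  qed
  then show ?thesis by (simp add: Bspace_def)
qed

lemma B_measurable: "f \<in> B \<Longrightarrow> f \<in> borel_measurable m"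
  by (simp add: Bspace_def Lp_def)

lemma B_incr_Lp:
  assumes "f \<in> B" "r > 0"
  shows "incr f \<in> Lp p (N r)" and "kernel_energy p m k r f = ennreal (en r f)"
proof -
  note ke = kernel_energy_eq[OF assms(2) B_measurable[OF assms(1)]]
  have i: "incr f \<in> borel_measurable (N r)"
    using incr_borel[OF B_measurable[OF assms(1)]] by (simp add: measurable_N)
  obtain M where "kernel_energy p m k r f \<le> ennreal M" using assms Bspace_iff by blast
  then have "kernel_energy p m k r f < \<infinity>" by (simp add: le_less_trans)
  then show L: "incr f \<in> Lp p (N r)" using i by (simp add: Lp_def ke)
  show "kernel_energy p m k r f = ennreal (en r f)"
    unfolding ke en_def by (rule nn_integral_eq_integral[OF LpD(2)[OF L]]) simp
qed

lemma en_nonneg: "en r f \<ge> 0"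
  by (simp add: en_def)

lemma en_bounded:
  assumes "f \<in> B"
  obtains M where "M \<ge> 0" "\<And>r. r > 0 \<Longrightarrow> en r f \<le> M"
proof -
  obtain M where M: "\<And>r. r > 0 \<Longrightarrow> kernel_energy p m k r f \<le> ennreal M"
    using assms Bspace_iff by blast
  show ?thesis
  proof (rule that[of "max 0 M"])
    fix r :: real assume r: "r > 0"
    have "ennreal (en r f) \<le> ennreal (max 0 M)"
      using M[OF r] B_incr_Lp(2)[OF assms r] by (simp add: ennreal_leI order_trans[OF _ ennreal_leI[of M "max 0 M"]])
    then show "en r f \<le> max 0 M" by (simp add: ennreal_le_iff del: max_less_iff_conj)
  qed simp
qed

lemma energy_tendsto:
  assumes "f \<in> B"
  shows "(\<lambda>n. en (rs n) f) \<longlonglongrightarrow> E f" and "E f \<ge> 0"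
proof -
  obtain c where c: "c \<ge> 0" "(\<lambda>n. kernel_energy p m k (rs n) f) \<longlonglongrightarrow> ennreal c"
    using admissible assms by (auto simp: admissible_scales_def)
  have "lim (\<lambda>n. kernel_energy p m k (rs n) f) = ennreal c" using c(2) by (rule limI)
  then have E: "E f = c" using c(1) by (simp add: energy_def)
  have "(\<lambda>n. ennreal (en (rs n) f)) \<longlonglongrightarrow> ennreal c"
    using c(2) B_incr_Lp(2)[OF assms rs_pos] by simp
  then show "(\<lambda>n. en (rs n) f) \<longlonglongrightarrow> E f" unfolding E
    using c(1) en_nonneg by (intro tendsto_ennrealD) auto
  show "E f \<ge> 0" using E c(1) by simp
qed

lemma filterlim_rs: "filterlim rs (at_right 0) sequentially"
  using admissible rs_pos
  by (auto simp: admissible_scales_def filterlim_at less_imp_neq[symmetric] intro!: always_eventually)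

text \<open>Weak monotonicity makes \<open>E\<close>, a limit along one sequence, control the energies at all scales.\<close>

lemma weak_monotonicity_energy:
  obtains C where "C \<ge> 1" "\<And>f r. f \<in> B \<Longrightarrow> r > 0 \<Longrightarrow> en r f \<le> C * E f"
proof -
  obtain C where C: "C \<ge> 1" "\<And>f. f \<in> B \<Longrightarrow>
      sup_energy p m k f \<le> ennreal C * Liminf (at_right 0) (\<lambda>r. kernel_energy p m k r f)"
    using weak_mono by (auto simp: weak_monotonicity_def)
  show ?thesis
  proof (rule that[OF C(1)])
    fix f r assume f: "f \<in> B" and r: "(r::real) > 0"
    have "Liminf (at_right 0) (\<lambda>r. kernel_energy p m k r f) \<le> liminf (\<lambda>n. kernel_energy p m k (rs n) f)"
      unfolding le_Liminf_iff
    proof (intro allI impI)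
      fix y assume "y < Liminf (at_right 0) (\<lambda>r. kernel_energy p m k r f)"
      then have "\<forall>\<^sub>F r in at_right 0. y < kernel_energy p m k r f" by (rule less_LiminfD)
      then show "\<forall>\<^sub>F n in sequentially. y < kernel_energy p m k (rs n) f"
        using filterlim_rs by (rule eventually_compose_filterlim)
    qed
    also have "\<dots> = ennreal (E f)"
    proof (rule lim_imp_Liminf)
      show "(\<lambda>n. kernel_energy p m k (rs n) f) \<longlonglongrightarrow> ennreal (E f)"
        unfolding B_incr_Lp(2)[OF f rs_pos] by (intro tendsto_ennrealI energy_tendsto f)
    qed simp
    finally have "ennreal C * Liminf (at_right 0) (\<lambda>r. kernel_energy p m k r f) \<le> ennreal C * ennreal (E f)"
      by (rule mult_left_mono) simp
    then have "sup_energy p m k f \<le> ennreal C * ennreal (E f)"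
      using C(2)[OF f] by (rule order_trans[rotated])
    moreover have "ennreal (en r f) \<le> sup_energy p m k f"
      unfolding B_incr_Lp(2)[OF f r, symmetric] sup_energy_def using r by (intro SUP_upper) auto
    ultimately have "ennreal (en r f) \<le> ennreal C * ennreal (E f)" by (rule order_trans[rotated])
    then have "ennreal (en r f) \<le> ennreal (C * E f)"
      using C(1) energy_tendsto(2)[OF f] by (simp add: ennreal_mult)
    moreover have "0 \<le> C * E f" using C(1) energy_tendsto(2)[OF f] by simp
    ultimately show "en r f \<le> C * E f" by (simp only: ennreal_le_iff)
  qed
qed

text \<open>Membership in the space, with estimates, for any function whose values and increments are dominated
  by those of members; sums, products, truncations and Lipschitz images are instances.\<close>

lemma B_dominated:
  fixes g :: "nat \<Rightarrow> 'a \<Rightarrow> real"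
  assumes f: "f \<in> borel_measurable m" and g: "\<And>i. i < n \<Longrightarrow> g i \<in> B" and C: "C \<ge> 0"
    and le: "\<And>x. \<bar>f x\<bar> \<le> C * (\<Sum>i<n. \<bar>g i x\<bar>)"
    and inc: "\<And>x y. \<bar>f x - f y\<bar> \<le> C * (\<Sum>i<n. \<bar>g i x - g i y\<bar>)"
  shows "f \<in> B" and "\<And>r. r > 0 \<Longrightarrow> en r f \<le> (C * n) powr p * (\<Sum>i<n. en r (g i))"
    and "E f \<le> (C * n) powr p * (\<Sum>i<n. E (g i))"
proof -
  have i: "incr f \<in> borel_measurable (N r)" for r using incr_borel[OF f] by (simp add: measurable_N)
  have gL: "g i \<in> Lp p m" if "i < n" for i using g[OF that] by (simp add: Bspace_def)
  have inc': "\<bar>incr f z\<bar> \<le> C * (\<Sum>i<n. \<bar>incr (g i) z\<bar>)" for z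
    using inc[of "fst z" "snd z"] by (simp add: incr_def)
  have fL: "f \<in> Lp p m" by (rule Lp_dominated(1)[OF p_pos f gL C le])
  have L: "incr f \<in> Lp p (N r)" and le_en: "en r f \<le> (C * n) powr p * (\<Sum>i<n. en r (g i))" if r: "r > 0" for r
    using Lp_dominated[OF p_pos i B_incr_Lp(1)[OF g r] C inc'] unfolding en_def by auto
  have "\<exists>M. \<forall>r>0. en r (g i) \<le> M" if "i < n" for i using en_bounded[OF g[OF that]] by blast
  then obtain M where M: "\<And>i r. i < n \<Longrightarrow> r > 0 \<Longrightarrow> en r (g i) \<le> M i" by metis
  have "kernel_energy p m k r f \<le> ennreal ((C * n) powr p * (\<Sum>i<n. M i))" if r: "r > 0" for r
  proof -
    have "kernel_energy p m k r f = ennreal (en r f)"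
      unfolding kernel_energy_eq[OF r f] en_def by (rule nn_integral_eq_integral[OF LpD(2)[OF L[OF r]]]) simp
    also have "\<dots> \<le> ennreal ((C * n) powr p * (\<Sum>i<n. M i))"
      using M r by (intro ennreal_leI order_trans[OF le_en[OF r]] mult_left_mono sum_mono) auto
    finally show ?thesis .
  qed
  then show fB: "f \<in> B" using fL Bspace_iff by blast
  show "\<And>r. r > 0 \<Longrightarrow> en r f \<le> (C * n) powr p * (\<Sum>i<n. en r (g i))" by (rule le_en)
  show "E f \<le> (C * n) powr p * (\<Sum>i<n. E (g i))"
  proof (rule LIMSEQ_le[OF energy_tendsto(1)[OF fB]])
    show "(\<lambda>j. (C * n) powr p * (\<Sum>i<n. en (rs j) (g i))) \<longlonglongrightarrow> (C * n) powr p * (\<Sum>i<n. E (g i))"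
      using g by (intro tendsto_intros energy_tendsto) auto
  qed (use le_en[OF rs_pos] in blast)
qed

lemma B_dominated1:
  assumes f: "f \<in> borel_measurable m" and g: "g \<in> B" and C: "C \<ge> 0"
    and le: "\<And>x. \<bar>f x\<bar> \<le> C * \<bar>g x\<bar>" and inc: "\<And>x y. \<bar>f x - f y\<bar> \<le> C * \<bar>g x - g y\<bar>"
  shows "f \<in> B"
  by (rule B_dominated(1)[where g="\<lambda>_. g" and n=1, OF f _ C]) (use g le inc in simp_all)

lemma B_combination:
  assumes f: "f \<in> B" and g: "g \<in> B"
  shows "(\<lambda>x. f x + t * g x) \<in> B" and "E (\<lambda>x. f x + t * g x) \<le> (2 * (1 + \<bar>t\<bar>)) powr p * (E f + E g)"
proof -
  have le: "\<bar>a + t * b\<bar> \<le> (1 + \<bar>t\<bar>) * (\<bar>a\<bar> + \<bar>b\<bar>)" for a b :: real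
  proof -
    have "\<bar>a + t * b\<bar> \<le> 1 * \<bar>a\<bar> + \<bar>t\<bar> * \<bar>b\<bar>"
      using abs_triangle_ineq[of a "t * b"] by (simp add: abs_mult)
    also have "\<dots> \<le> (1 + \<bar>t\<bar>) * \<bar>a\<bar> + (1 + \<bar>t\<bar>) * \<bar>b\<bar>" by (intro add_mono mult_right_mono) auto
    finally show ?thesis by (simp add: distrib_left)
  qed
  let ?g = "\<lambda>i::nat. if i = 0 then f else g"
  have m: "(\<lambda>x. f x + t * g x) \<in> borel_measurable m"
    using B_measurable[OF f] B_measurable[OF g] by measurable
  have s: "(\<Sum>i<2. h (?g i)) = h f + h g" for h :: "('a \<Rightarrow> real) \<Rightarrow> real"
    by (simp add: numeral_2_eq_2)
  have 1: "\<bar>f x + t * g x\<bar> \<le> (1 + \<bar>t\<bar>) * (\<Sum>i<2. \<bar>?g i x\<bar>)" for x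
    unfolding s[of "\<lambda>h. \<bar>h x\<bar>"] by (rule le)
  have 2: "\<bar>(f x + t * g x) - (f y + t * g y)\<bar> \<le> (1 + \<bar>t\<bar>) * (\<Sum>i<2. \<bar>?g i x - ?g i y\<bar>)" for x y
    unfolding s[of "\<lambda>h. \<bar>h x - h y\<bar>"] using le[of "f x - f y" "g x - g y"] by (simp add: algebra_simps)
  note * = B_dominated[where g="?g" and n=2 and C="1 + \<bar>t\<bar>", OF m _ _ 1 2]
  show "(\<lambda>x. f x + t * g x) \<in> B" using f g by (intro *(1)) auto
  have "E (\<lambda>x. f x + t * g x) \<le> ((1 + \<bar>t\<bar>) * real 2) powr p * (\<Sum>i<2. E (?g i))"
    using f g by (intro *(3)) auto
  then show "E (\<lambda>x. f x + t * g x) \<le> (2 * (1 + \<bar>t\<bar>)) powr p * (E f + E g)"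
    unfolding s by (simp add: mult.commute)
qed

lemma B_diff: "f \<in> B \<Longrightarrow> g \<in> B \<Longrightarrow> (\<lambda>x. f x - g x) \<in> B"
  using B_combination(1)[of f g "-1"] by simp

lemma B_cmult: "f \<in> B \<Longrightarrow> (\<lambda>x. c * f x) \<in> B"
  by (rule B_dominated1[of _ f "\<bar>c\<bar>"])
    (auto simp: abs_mult right_diff_distrib[symmetric] intro: borel_measurable_times B_measurable)

lemma B_shrink: "f \<in> B \<Longrightarrow> c \<ge> 0 \<Longrightarrow> (\<lambda>x. max 0 (f x - c)) \<in> B"
proof (rule B_dominated1[of _ f 1])
  assume "f \<in> B"
  then have [measurable]: "f \<in> borel_measurable m" by (rule B_measurable)
  show "(\<lambda>x. max 0 (f x - c)) \<in> borel_measurable m" by measurable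
qed auto

lemma B_mult:
  assumes f: "f \<in> B" "\<And>x. \<bar>f x\<bar> \<le> c" and g: "g \<in> B" "\<And>x. \<bar>g x\<bar> \<le> c"
  shows "(\<lambda>x. f x * g x) \<in> B"
proof (rule B_dominated(1)[where g="\<lambda>i. if i = 0 then f else g" and n=2 and C=c])
  show c: "c \<ge> 0" using f(2)[of undefined] by linarith
  show "\<bar>f x * g x\<bar> \<le> c * (\<Sum>i<(2::nat). \<bar>(if i = 0 then f else g) x\<bar>)" for x
  proof -
    have "\<bar>f x * g x\<bar> \<le> c * \<bar>g x\<bar>" unfolding abs_mult using f(2) by (rule mult_right_mono) simp
    also have "\<dots> \<le> c * (\<bar>f x\<bar> + \<bar>g x\<bar>)" using c by (intro mult_left_mono) auto
    finally show ?thesis by (simp add: numeral_2_eq_2)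
  qed
  show "\<bar>f x * g x - f y * g y\<bar> \<le> c * (\<Sum>i<(2::nat). \<bar>(if i = 0 then f else g) x - (if i = 0 then f else g) y\<bar>)" for x y
  proof -
    have "f x * g x - f y * g y = g x * (f x - f y) + f y * (g x - g y)" by (simp add: algebra_simps)
    also have "\<bar>\<dots>\<bar> \<le> \<bar>g x\<bar> * \<bar>f x - f y\<bar> + \<bar>f y\<bar> * \<bar>g x - g y\<bar>"
      using abs_triangle_ineq by (simp add: abs_mult[symmetric])
    also have "\<dots> \<le> c * \<bar>f x - f y\<bar> + c * \<bar>g x - g y\<bar>"
      using f(2) g(2) by (intro add_mono mult_right_mono) auto
    finally show ?thesis by (simp add: numeral_2_eq_2 distrib_left)
  qed
  show "(\<lambda>x. f x * g x) \<in> borel_measurable m"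
    using B_measurable[OF f(1)] B_measurable[OF g(1)] by measurable
qed (use f g in auto)

lemma B_abs_powr:
  assumes f: "f \<in> B" "\<And>x. \<bar>f x\<bar> \<le> c" and q: "q > 1"
  shows "(\<lambda>x. \<bar>f x\<bar> powr q) \<in> B"
proof (rule B_dominated1[OF _ f(1), where C="q * c powr (q - 1)"])
  have lip: "\<bar>\<bar>a\<bar> powr q - \<bar>b\<bar> powr q\<bar> \<le> q * c powr (q - 1) * \<bar>a - b\<bar>" if "\<bar>a\<bar> \<le> c" "\<bar>b\<bar> \<le> c" for a b :: real
  proof -
    obtain \<xi> where \<xi>: "min b a \<le> \<xi>" "\<xi> \<le> max b a"
      "\<bar>a\<bar> powr q - \<bar>b\<bar> powr q = q * spow (q - 1) \<xi> * (a - b)"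
      using mean_value_unordered[OF abs_powr_has_derivative[OF q], of b a] by blast
    have "\<bar>\<xi>\<bar> \<le> c" using \<xi>(1,2) that by linarith
    then have "\<bar>spow (q - 1) \<xi>\<bar> \<le> c powr (q - 1)" unfolding abs_spow using q by (intro powr_mono2) auto
    then show ?thesis unfolding \<xi>(3) abs_mult using q by (intro mult_right_mono mult_mono) auto
  qed
  show "\<bar>\<bar>f x\<bar> powr q - \<bar>f y\<bar> powr q\<bar> \<le> q * c powr (q - 1) * \<bar>f x - f y\<bar>" for x y
    by (rule lip) (rule f)+
  have c: "c \<ge> 0" using f(2)[of undefined] by linarith
  show "\<bar>\<bar>f x\<bar> powr q\<bar> \<le> q * c powr (q - 1) * \<bar>f x\<bar>" for x
    using lip[of "f x" 0] f(2)[of x] c by simp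
  show "(\<lambda>x. \<bar>f x\<bar> powr q) \<in> borel_measurable m"
    using B_measurable[OF f(1)] by measurable
qed (use q in simp)

text \<open>Increments are linear in the function and the energies are bounded uniformly in the scale, so
  \<open>derivative_of_power_integral_limit\<close> applies along \<open>rs\<close>.\<close>

lemma energy2_tendsto:
  assumes f: "f \<in> B" and g: "g \<in> B"
  shows "(\<lambda>n. LINT z|N (rs n). spow (p - 1) (incr f z) * incr g z) \<longlonglongrightarrow> energy2 p m k rs f g"
proof -
  obtain M1 where M1: "\<And>r. r > 0 \<Longrightarrow> en r f \<le> M1" using en_bounded[OF f] by blast
  obtain M2 where M2: "\<And>r. r > 0 \<Longrightarrow> en r g \<le> M2" using en_bounded[OF g] by blast
  obtain D where D: "(\<lambda>n. LINT z|N (rs n). spow (p - 1) (incr f z) * incr g z) \<longlonglongrightarrow> D"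
    "((\<lambda>t. E (\<lambda>x. f x + t * g x)) has_real_derivative p * D) (at 0)"
  proof (rule derivative_of_power_integral_limit[OF p, where F="\<lambda>n. incr f" and H="\<lambda>n. incr g" and N="\<lambda>n. N (rs n)"
        and M="max M1 M2" and h="\<lambda>t. E (\<lambda>x. f x + t * g x)"])
    show "(LINT z|N (rs n). \<bar>incr f z\<bar> powr p) \<le> max M1 M2" for n
      using M1[OF rs_pos[of n]] by (simp add: en_def)
    show "(LINT z|N (rs n). \<bar>incr g z\<bar> powr p) \<le> max M1 M2" for n
      using M2[OF rs_pos[of n]] by (simp add: en_def)
    show "(\<lambda>n. LINT z|N (rs n). \<bar>incr f z + t * incr g z\<bar> powr p) \<longlonglongrightarrow> E (\<lambda>x. f x + t * g x)" for t
    proof -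
      have "incr f z + t * incr g z = incr (\<lambda>x. f x + t * g x) z" for z
        by (simp add: incr_def algebra_simps)
      then show ?thesis using energy_tendsto(1)[OF B_combination(1)[OF f g, of t]] by (simp add: en_def)
    qed
  qed (use B_incr_Lp(1) f g rs_pos in auto)
  then have "energy2 p m k rs f g = D" using p by (simp add: energy2_def DERIV_imp_deriv)
  then show ?thesis using D(1) by simp
qed

lemma far_measure_tendsto:
  obtains \<delta> :: "real \<Rightarrow> real" where "(\<lambda>n. \<delta> (rs n)) \<longlonglongrightarrow> 0"
    "(\<lambda>n. emeasure (N (rs n)) {z. \<delta> (rs n) \<le> dist (fst z) (snd z)}) \<longlonglongrightarrow> 0"
proof -
  obtain \<delta> :: "real \<Rightarrow> real" where \<delta>: "(\<delta> \<longlongrightarrow> 0) (at_right 0)"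
    "((\<lambda>r. \<integral>\<^sup>+x. (\<integral>\<^sup>+y\<in>UNIV - ball x (\<delta> r). k r x y \<partial>m) \<partial>m) \<longlongrightarrow> 0) (at_right 0)"
    using asymp_local by (auto simp: asymptotically_local_def)
  have eq: "emeasure (N r) {z. \<delta> r \<le> dist (fst z) (snd z)} = (\<integral>\<^sup>+x. (\<integral>\<^sup>+y\<in>UNIV - ball x (\<delta> r). k r x y \<partial>m) \<partial>m)"
    if r: "r > 0" for r
  proof -
    let ?F = "{z :: 'a \<times> 'a. \<delta> r \<le> dist (fst z) (snd z)}"
    have F: "?F \<in> sets borel"
      by (intro borel_closed closed_Collect_le continuous_intros)
    have "emeasure (N r) ?F = (\<integral>\<^sup>+z. indicator ?F z \<partial>N r)" using F by (simp add: sets_N)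
    also have "\<dots> = (\<integral>\<^sup>+x. (\<integral>\<^sup>+y. indicator ?F (x, y) * k r x y \<partial>m) \<partial>m)"
      using F by (intro nn_integral_N r) auto
    also have "\<dots> = (\<integral>\<^sup>+x. (\<integral>\<^sup>+y\<in>UNIV - ball x (\<delta> r). k r x y \<partial>m) \<partial>m)"
      by (intro nn_integral_cong) (auto simp: indicator_def not_less)
    finally show ?thesis .
  qed
  show ?thesis
  proof (rule that)
    show "(\<lambda>n. \<delta> (rs n)) \<longlonglongrightarrow> 0" by (rule filterlim_compose[OF \<delta>(1) filterlim_rs])
    show "(\<lambda>n. emeasure (N (rs n)) {z. \<delta> (rs n) \<le> dist (fst z) (snd z)}) \<longlonglongrightarrow> 0"
      unfolding eq[OF rs_pos] by (rule filterlim_compose[OF \<delta>(2) filterlim_rs])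
  qed
qed

lemma weighted_integrable:
  assumes f: "f \<in> B" and g: "g \<in> borel_measurable borel" "\<And>z. \<bar>g z\<bar> \<le> c" and r: "r > 0"
  shows "integrable (N r) (\<lambda>z. \<bar>incr f z\<bar> powr p * g z)"
proof (rule Bochner_Integration.integrable_bound)
  show "integrable (N r) (\<lambda>z. c * \<bar>incr f z\<bar> powr p)"
    using LpD(2)[OF B_incr_Lp(1)[OF f r]] by simp
  show "(\<lambda>z. \<bar>incr f z\<bar> powr p * g z) \<in> borel_measurable (N r)"
    using g(1) incr_borel[OF B_measurable[OF f]] unfolding measurable_N by measurable
  have "\<bar>g z\<bar> \<le> \<bar>c\<bar>" for z using g(2)[of z] by linarith
  then show "AE z in N r. norm (\<bar>incr f z\<bar> powr p * g z) \<le> norm (c * \<bar>incr f z\<bar> powr p)"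
    by (intro AE_I2) (simp add: abs_mult mult.commute[of _ "\<bar>g _\<bar>"] mult_right_mono)
qed

text \<open>Near the diagonal the increments of \<open>\<phi>\<close> are uniformly small, and away from it the kernels have
  vanishing mass.\<close>

lemma local_energy_vanishes:
  assumes u: "u \<in> B" "\<And>x. \<bar>u x\<bar> \<le> c" and \<phi>: "\<phi> \<in> Cc"
  shows "(\<lambda>n. LINT z|N (rs n). \<bar>incr u z\<bar> powr p * \<bar>incr \<phi> z\<bar>) \<longlonglongrightarrow> 0"
proof (rule LIMSEQ_I)
  fix e :: real assume e: "e > 0"
  obtain M where M: "M \<ge> 0" "\<And>r. r > 0 \<Longrightarrow> en r u \<le> M" using en_bounded[OF u(1)] by blast
  obtain b where b: "b > 0" "\<And>x. \<bar>\<phi> x\<bar> \<le> b" using Cc_bounded[OF \<phi>] by blast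
  have c: "c \<ge> 0" using u(2)[of undefined] by linarith
  define s where "s = e / (2 * (M + 1))"
  have s: "s > 0" "s * M < e / 2" using e M(1) by (auto simp: s_def field_simps)
  define K where "K = (2 * c) powr p * (2 * b)"
  have K: "K \<ge> 0" using b c by (simp add: K_def)
  define t where "t = e / (2 * (K + 1))"
  have t: "t > 0" "K * t < e / 2" using e K by (auto simp: t_def field_simps)
  obtain d where d: "d > 0" "\<And>x y. dist x y < d \<Longrightarrow> \<bar>\<phi> x - \<phi> y\<bar> < s"
    using Cc_uniformly_continuous[OF \<phi> s(1)] by blast
  obtain \<delta> :: "real \<Rightarrow> real" where \<delta>: "(\<lambda>n. \<delta> (rs n)) \<longlonglongrightarrow> 0"
    "(\<lambda>n. emeasure (N (rs n)) {z. \<delta> (rs n) \<le> dist (fst z) (snd z)}) \<longlonglongrightarrow> 0"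
    by (rule far_measure_tendsto)
  have "\<forall>\<^sub>F n in sequentially. \<delta> (rs n) < d" using order_tendstoD(2)[OF \<delta>(1) d(1)] .
  moreover have "\<forall>\<^sub>F n in sequentially. emeasure (N (rs n)) {z. \<delta> (rs n) \<le> dist (fst z) (snd z)} < ennreal t"
    using order_tendstoD(2)[OF \<delta>(2), of "ennreal t"] t by simp
  ultimately have "\<forall>\<^sub>F n in sequentially. norm ((LINT z|N (rs n). \<bar>incr u z\<bar> powr p * \<bar>incr \<phi> z\<bar>) - 0) < e"
  proof eventually_elim
    case (elim n)
    let ?F = "{z :: 'a \<times> 'a. \<delta> (rs n) \<le> dist (fst z) (snd z)}"
    have F: "?F \<in> sets (N (rs n))" unfolding sets_N
      by (intro borel_closed closed_Collect_le continuous_intros)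
    have fin: "emeasure (N (rs n)) ?F < \<infinity>" using elim(2) by (rule less_trans) simp
    have mF: "measure (N (rs n)) ?F \<le> t"
    proof -
      have "ennreal (measure (N (rs n)) ?F) \<le> ennreal t"
        using elim(2) fin by (simp add: emeasure_eq_ennreal_measure less_top)
      then show ?thesis using t(1) by (simp only: ennreal_le_iff less_imp_le)
    qed
    have pt: "\<bar>incr u z\<bar> powr p * \<bar>incr \<phi> z\<bar> \<le> s * \<bar>incr u z\<bar> powr p + K * indicator ?F z" for z
    proof (cases "z \<in> ?F")
      case True
      have "\<bar>incr u z\<bar> \<le> 2 * c" using u(2)[of "fst z"] u(2)[of "snd z"] by (simp add: incr_def)
      moreover have "\<bar>incr \<phi> z\<bar> \<le> 2 * b" using b(2)[of "fst z"] b(2)[of "snd z"] by (simp add: incr_def)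
      ultimately have "\<bar>incr u z\<bar> powr p * \<bar>incr \<phi> z\<bar> \<le> K"
        unfolding K_def using p by (intro mult_mono powr_mono2) auto
      moreover have "0 \<le> s * \<bar>incr u z\<bar> powr p" using s by simp
      ultimately show ?thesis using True by simp
    next
      case False
      then have "\<bar>incr \<phi> z\<bar> \<le> s" using d(2)[of "fst z" "snd z"] elim(1) by (simp add: incr_def)
      then have "\<bar>incr u z\<bar> powr p * \<bar>incr \<phi> z\<bar> \<le> \<bar>incr u z\<bar> powr p * s" by (intro mult_left_mono) auto
      then show ?thesis using False by (simp add: mult.commute)
    qed
    have iF: "integrable (N (rs n)) (indicator ?F :: _ \<Rightarrow> real)" using F fin by (simp add: integrable_indicator_iff)
    note iu = LpD(2)[OF B_incr_Lp(1)[OF u(1) rs_pos[of n]]]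
    have "(LINT z|N (rs n). \<bar>incr u z\<bar> powr p * \<bar>incr \<phi> z\<bar>)
      \<le> (LINT z|N (rs n). s * \<bar>incr u z\<bar> powr p + K * indicator ?F z)"
    proof (rule integral_mono[OF _ _ pt])
      show "integrable (N (rs n)) (\<lambda>z. \<bar>incr u z\<bar> powr p * \<bar>incr \<phi> z\<bar>)"
      proof (rule weighted_integrable[OF u(1) _ _ rs_pos])
        show "(\<lambda>z. \<bar>incr \<phi> z\<bar>) \<in> borel_measurable borel"
          using incr_borel[OF Cc_measurable[OF \<phi>]] by measurable
        show "\<bar>\<bar>incr \<phi> z\<bar>\<bar> \<le> 2 * b" for z using b(2)[of "fst z"] b(2)[of "snd z"] by (simp add: incr_def)
      qed
    qed (intro Bochner_Integration.integrable_add integrable_mult_right iu iF)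
    also have "\<dots> = s * en (rs n) u + K * measure (N (rs n)) ?F"
      using iu iF F sets.sets_into_space[OF F] by (simp add: en_def Int_absorb2)
    also have "\<dots> \<le> s * M + K * t"
      using M(2)[OF rs_pos] mF s K by (intro add_mono mult_left_mono) auto
    also have "\<dots> < e" using s t by linarith
    finally show ?case by simp
  qed
  then show "\<exists>no. \<forall>n\<ge>no. norm ((LINT z|N (rs n). \<bar>incr u z\<bar> powr p * \<bar>incr \<phi> z\<bar>) - 0) < e"
    by (simp add: eventually_sequentially)
qed

lemma Cb_bounded:
  assumes "u \<in> Cb"
  obtains c where "c > 0" "\<And>x. \<bar>u x\<bar> \<le> c"
  using assms unfolding Cb_def by (auto simp: bounded_pos)

lemma CbI:
  assumes "continuous_on UNIV f" "\<And>x. \<bar>f x\<bar> \<le> c"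
  shows "f \<in> Cb"
  using assms by (auto simp: Cb_def bounded_iff)

text \<open>The functional defining the energy measure is the vague limit of the localized energies: by
  \<open>conjugate_power_cancellation\<close> the two differ by at most the quantity in \<open>local_energy_vanishes\<close>.\<close>

lemma localized_energy_tendsto:
  assumes u: "u \<in> B \<inter> Cb" and \<phi>: "\<phi> \<in> B \<inter> Cc"
  shows "(\<lambda>n. J \<phi> n u) \<longlonglongrightarrow> energy2 p m k rs u (\<lambda>x. u x * \<phi> x)
    - ((p - 1) / p) powr (p - 1) * energy2 p m k rs (\<lambda>x. \<bar>u x\<bar> powr (p / (p - 1))) \<phi>"
proof -
  define v where "v x = \<bar>u x\<bar> powr (p / (p - 1))" for x
  define cp where "cp = ((p - 1) / p) powr (p - 1)"
  obtain a where a: "a > 0" "\<And>x. \<bar>u x\<bar> \<le> a" using Cb_bounded u by blast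
  obtain b where b: "b > 0" "\<And>x. \<bar>\<phi> x\<bar> \<le> b" using Cc_bounded \<phi> by blast
  have q: "p / (p - 1) > 1" using p by simp
  have uB: "u \<in> B" and \<phi>B: "\<phi> \<in> B" and \<phi>C: "\<phi> \<in> Cc" using u \<phi> by auto
  have vB: "v \<in> B" unfolding v_def by (rule B_abs_powr[OF uB a(2) q])
  have u\<phi>: "(\<lambda>x. u x * \<phi> x) \<in> B"
    by (rule B_mult[OF uB _ \<phi>B, of "max a b"]) (use a(2) b(2) in \<open>auto intro: max.coboundedI1 max.coboundedI2\<close>)
  define A1 where "A1 n = (LINT z|N (rs n). spow (p - 1) (incr u z) * incr (\<lambda>x. u x * \<phi> x) z)" for n
  define A2 where "A2 n = (LINT z|N (rs n). spow (p - 1) (incr v z) * incr \<phi> z)" for n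
  have lim: "(\<lambda>n. A1 n - cp * A2 n) \<longlonglongrightarrow> energy2 p m k rs u (\<lambda>x. u x * \<phi> x) - cp * energy2 p m k rs v \<phi>"
    unfolding A1_def A2_def by (intro tendsto_intros energy2_tendsto uB u\<phi> vB \<phi>B)
  have est: "\<bar>J \<phi> n u - (A1 n - cp * A2 n)\<bar> \<le> (LINT z|N (rs n). \<bar>incr u z\<bar> powr p * \<bar>incr \<phi> z\<bar>)" for n
  proof -
    note L = B_incr_Lp(1)[OF _ rs_pos[of n]]
    have i1: "integrable (N (rs n)) (\<lambda>z. \<bar>incr u z\<bar> powr p * \<phi> (fst z))"
      using b(2) by (intro weighted_integrable[OF uB _ _ rs_pos] fst_borel Cc_measurable \<phi>C)
    have i2: "integrable (N (rs n)) (\<lambda>z. spow (p - 1) (incr u z) * incr (\<lambda>x. u x * \<phi> x) z)"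
      by (rule integrable_spow_mult[OF p L[OF uB] L[OF u\<phi>]])
    have i3: "integrable (N (rs n)) (\<lambda>z. spow (p - 1) (incr v z) * incr \<phi> z)"
      by (rule integrable_spow_mult[OF p L[OF vB] L[OF \<phi>B]])
    have i4: "integrable (N (rs n)) (\<lambda>z. \<bar>incr u z\<bar> powr p * \<bar>incr \<phi> z\<bar>)"
    proof (rule weighted_integrable[OF uB _ _ rs_pos])
      show "(\<lambda>z. \<bar>incr \<phi> z\<bar>) \<in> borel_measurable borel"
        using incr_borel[OF Cc_measurable[OF \<phi>C]] by measurable
      show "\<bar>\<bar>incr \<phi> z\<bar>\<bar> \<le> 2 * b" for z using b(2)[of "fst z"] b(2)[of "snd z"] by (simp add: incr_def)
    qed
    define w where "w z = \<bar>incr u z\<bar> powr p * \<phi> (fst z)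
      - (spow (p - 1) (incr u z) * incr (\<lambda>x. u x * \<phi> x) z - cp * (spow (p - 1) (incr v z) * incr \<phi> z))" for z
    have iw: "integrable (N (rs n)) w" unfolding w_def
      by (intro Bochner_Integration.integrable_diff integrable_mult_right i1 i2 i3)
    have w_eq: "w z = - ((u (snd z) * spow (p - 1) (incr u z) - cp * spow (p - 1) (incr v z)) * incr \<phi> z)" for z
    proof -
      have e1: "incr (\<lambda>x. u x * \<phi> x) z = incr u z * \<phi> (fst z) + u (snd z) * incr \<phi> z"
        by (simp add: incr_def algebra_simps)
      show ?thesis unfolding w_def e1 spow_mult_self[symmetric] by (simp add: algebra_simps)
    qed
    have w_le: "\<bar>w z\<bar> \<le> \<bar>incr u z\<bar> powr p * \<bar>incr \<phi> z\<bar>" for z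
    proof -
      have "\<bar>u (snd z) * spow (p - 1) (incr u z) - cp * spow (p - 1) (incr v z)\<bar> \<le> \<bar>incr u z\<bar> powr p"
        using conjugate_power_cancellation[OF p, of "u (snd z)" "u (fst z)"]
        by (simp add: incr_def v_def cp_def)
      then show ?thesis unfolding w_eq abs_minus abs_mult by (intro mult_right_mono) auto
    qed
    have "J \<phi> n u - (A1 n - cp * A2 n) = (LINT z|N (rs n). w z)"
      unfolding w_def J_def A1_def A2_def using i1 i2 i3 by simp
    also have "\<bar>\<dots>\<bar> \<le> (LINT z|N (rs n). \<bar>w z\<bar>)" by (rule integral_abs_bound)
    also have "\<dots> \<le> (LINT z|N (rs n). \<bar>incr u z\<bar> powr p * \<bar>incr \<phi> z\<bar>)"
      by (rule integral_mono[OF integrable_abs[OF iw] i4 w_le])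
    finally show ?thesis .
  qed
  have "(\<lambda>n. J \<phi> n u - (A1 n - cp * A2 n)) \<longlonglongrightarrow> 0"
    by (rule Lim_null_comparison[OF _ local_energy_vanishes[OF uB a(2) \<phi>C]]) (use est in simp)
  from tendsto_add[OF this lim] show ?thesis by (simp add: v_def[abs_def] cp_def)
qed

end


section \<open>The space of limits of bounded continuous functions\<close>

lemma convergent_of_uniform_approximation:
  fixes f :: "nat \<Rightarrow> real"
  assumes "\<And>e. e > 0 \<Longrightarrow> \<exists>g. convergent g \<and> (\<forall>n. \<bar>f n - g n\<bar> \<le> e)"
  shows "convergent f"
proof -
  have "Cauchy f"
  proof (rule metric_CauchyI)
    fix e :: real assume e: "e > 0"
    obtain g where g: "convergent g" "\<And>n. \<bar>f n - g n\<bar> \<le> e / 4"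
      using assms[of "e / 4"] e by auto
    then have "Cauchy g" by (simp add: Cauchy_convergent_iff)
    then obtain M where M: "\<And>i j. i \<ge> M \<Longrightarrow> j \<ge> M \<Longrightarrow> dist (g i) (g j) < e / 4"
      using metric_CauchyD[of g "e / 4"] e by auto
    show "\<exists>M. \<forall>i\<ge>M. \<forall>j\<ge>M. dist (f i) (f j) < e"
    proof (intro exI[of _ M] allI impI)
      fix i j assume "i \<ge> M" "j \<ge> M"
      from M[OF this] show "dist (f i) (f j) < e"
        using g(2)[of i] g(2)[of j] e unfolding dist_real_def by linarith
    qed
  qed
  then show ?thesis by (simp add: Cauchy_convergent_iff)
qed

context energy_setting
begin

lemma AE_N:
  assumes "AE x in m. P x" and r: "r > 0"
  shows "AE z in N r. P (fst z) \<and> P (snd z)"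
proof -
  interpret sigma_finite_measure m by (rule sigma_finite)
  obtain A where A: "A \<in> null_sets m" "{x \<in> space m. \<not> P x} \<subseteq> A"
    using assms(1) by (auto simp: eventually_ae_filter)
  have Am: "A \<in> sets m" using A(1) by auto
  have U: "UNIV \<in> sets m" by (simp add: sets_m)
  have "A \<times> UNIV \<union> UNIV \<times> A \<in> null_sets (m \<Otimes>\<^sub>M m)"
    using A(1) U by (intro null_sets.Un times_in_null_sets1 times_in_null_sets2)
  then have "AE z in m \<Otimes>\<^sub>M m. z \<notin> A \<times> UNIV \<union> UNIV \<times> A" by (rule AE_not_in)
  then have ae: "AE z in m \<Otimes>\<^sub>M m. P (fst z) \<and> P (snd z)"
    by eventually_elim (use A(2) space_m in \<open>auto simp: mem_Times_iff\<close>)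
  have "(\<lambda>(x, y). k r x y) \<in> borel_measurable (m \<Otimes>\<^sub>M m)"
    using kernel_measurable[OF r] by (simp add: measurable_cong_sets[OF sets_mm refl])
  from AE_density[OF this] show ?thesis unfolding N_def using ae by auto
qed

lemma weighted_difference_bound:
  assumes u: "u \<in> B" and \<phi>: "\<phi> \<in> borel_measurable m" "\<And>x. \<bar>\<phi> x\<bar> \<le> c"
    and \<psi>: "\<psi> \<in> borel_measurable m" "\<And>x. \<bar>\<psi> x\<bar> \<le> c" and d: "\<And>x. \<bar>\<phi> x - \<psi> x\<bar> \<le> d"
  shows "\<bar>J \<phi> n u - J \<psi> n u\<bar> \<le> d * en (rs n) u"
proof -
  note i = weighted_integrable[OF u fst_borel[OF \<phi>(1)] \<phi>(2) rs_pos[of n]]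
    weighted_integrable[OF u fst_borel[OF \<psi>(1)] \<psi>(2) rs_pos[of n]]
  have "J \<phi> n u - J \<psi> n u = (LINT z|N (rs n). \<bar>incr u z\<bar> powr p * \<phi> (fst z) - \<bar>incr u z\<bar> powr p * \<psi> (fst z))"
    unfolding J_def using i by simp
  also have "\<bar>\<dots>\<bar> \<le> (LINT z|N (rs n). \<bar>\<bar>incr u z\<bar> powr p * \<phi> (fst z) - \<bar>incr u z\<bar> powr p * \<psi> (fst z)\<bar>)"
    by (rule integral_abs_bound)
  also have "\<dots> \<le> (LINT z|N (rs n). d * \<bar>incr u z\<bar> powr p)"
  proof (rule integral_mono)
    fix z
    have "\<bar>\<bar>incr u z\<bar> powr p * \<phi> (fst z) - \<bar>incr u z\<bar> powr p * \<psi> (fst z)\<bar>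
      = \<bar>\<phi> (fst z) - \<psi> (fst z)\<bar> * \<bar>incr u z\<bar> powr p"
      by (simp add: right_diff_distrib[symmetric] abs_mult)
    also have "\<dots> \<le> d * \<bar>incr u z\<bar> powr p" by (rule mult_right_mono[OF d]) simp
    finally show "\<bar>\<bar>incr u z\<bar> powr p * \<phi> (fst z) - \<bar>incr u z\<bar> powr p * \<psi> (fst z)\<bar> \<le> d * \<bar>incr u z\<bar> powr p" .
  next
    show "integrable (N (rs n)) (\<lambda>z. d * \<bar>incr u z\<bar> powr p)"
      by (rule integrable_mult_right[OF LpD(2)[OF B_incr_Lp(1)[OF u rs_pos]]])
  qed (intro integrable_abs Bochner_Integration.integrable_diff i)
  also have "\<dots> = d * en (rs n) u" by (simp add: en_def)
  finally show ?thesis .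
qed

text \<open>The localized energy is continuous in \<open>u\<close> uniformly in the scale, with an error that is itself a
  localized energy and therefore survives passing to the measures.\<close>

lemma energy_difference_bound:
  assumes C: "\<And>a b :: real. abs (\<bar>a\<bar> powr p - \<bar>b\<bar> powr p) \<le> \<eta> * \<bar>b\<bar> powr p + C * \<bar>a - b\<bar> powr p"
    and u: "u \<in> B" and v: "v \<in> B" and \<phi>: "\<phi> \<in> borel_measurable m" "\<And>x. \<bar>\<phi> x\<bar> \<le> c"
  shows "\<bar>J \<phi> n u - J \<phi> n v\<bar> \<le> \<eta> * J (\<lambda>x. \<bar>\<phi> x\<bar>) n v + C * J (\<lambda>x. \<bar>\<phi> x\<bar>) n (\<lambda>x. u x - v x)"
proof -
  note i = weighted_integrable[OF _ fst_borel[OF \<phi>(1)] \<phi>(2) rs_pos[of n]]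
  have m': "(\<lambda>x. \<bar>\<phi> x\<bar>) \<in> borel_measurable m" using \<phi>(1) by measurable
  have b': "\<bar>\<bar>\<phi> x\<bar>\<bar> \<le> c" for x using \<phi>(2)[of x] by simp
  note i' = weighted_integrable[OF _ fst_borel[OF m'] b' rs_pos[of n]]
  note uv = B_diff[OF u v]
  let ?d = "\<lambda>z. \<bar>incr u z\<bar> powr p * \<phi> (fst z) - \<bar>incr v z\<bar> powr p * \<phi> (fst z)"
  let ?b = "\<lambda>z. \<eta> * (\<bar>incr v z\<bar> powr p * \<bar>\<phi> (fst z)\<bar>) + C * (\<bar>incr (\<lambda>x. u x - v x) z\<bar> powr p * \<bar>\<phi> (fst z)\<bar>)"
  have id: "integrable (N (rs n)) ?d" by (intro Bochner_Integration.integrable_diff i u v)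
  have ib: "integrable (N (rs n)) ?b" by (intro Bochner_Integration.integrable_add integrable_mult_right i' v uv)
  have "J \<phi> n u - J \<phi> n v = (LINT z|N (rs n). ?d z)"
    unfolding J_def using i[OF u] i[OF v] by simp
  also have "\<bar>\<dots>\<bar> \<le> (LINT z|N (rs n). \<bar>?d z\<bar>)" by (rule integral_abs_bound)
  also have "\<dots> \<le> (LINT z|N (rs n). ?b z)"
  proof (rule integral_mono[OF integrable_abs[OF id] ib])
    fix z
    have e: "incr u z - incr v z = incr (\<lambda>x. u x - v x) z" by (simp add: incr_def)
    have "\<bar>?d z\<bar> = abs (\<bar>incr u z\<bar> powr p - \<bar>incr v z\<bar> powr p) * \<bar>\<phi> (fst z)\<bar>"
      by (simp add: left_diff_distrib[symmetric] abs_mult)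
    also have "\<dots> \<le> (\<eta> * \<bar>incr v z\<bar> powr p + C * \<bar>incr u z - incr v z\<bar> powr p) * \<bar>\<phi> (fst z)\<bar>"
      by (rule mult_right_mono[OF C]) simp
    also have "\<dots> = ?b z" unfolding e by (simp add: distrib_right)
    finally show "\<bar>?d z\<bar> \<le> ?b z" .
  qed
  also have "\<dots> = \<eta> * J (\<lambda>x. \<bar>\<phi> x\<bar>) n v + C * J (\<lambda>x. \<bar>\<phi> x\<bar>) n (\<lambda>x. u x - v x)"
    unfolding J_def using i'[OF v] i'[OF uv] by simp
  finally show ?thesis .
qed

lemma J_bound:
  assumes u: "u \<in> B" and \<phi>: "\<phi> \<in> borel_measurable m" "\<And>x. \<bar>\<phi> x\<bar> \<le> c"
  shows "\<bar>J \<phi> n u\<bar> \<le> c * en (rs n) u"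
proof -
  have "c \<ge> 0" using \<phi>(2)[of undefined] by linarith
  then show ?thesis
    using weighted_difference_bound[OF u \<phi>, of "\<lambda>x. 0" c n] \<phi> by (simp add: J_def)
qed

text \<open>Convergence for \<open>\<phi> \<in> B \<inter> Cc\<close> extends to \<open>Cc\<close> since the error is the uniform distance of the test
  functions times a bounded energy.\<close>

lemma J_convergent_Cb:
  assumes u: "u \<in> B \<inter> Cb" and \<phi>: "\<phi> \<in> Cc"
  shows "convergent (\<lambda>n. J \<phi> n u)"
proof (rule convergent_of_uniform_approximation)
  fix e :: real assume e: "e > 0"
  have uB: "u \<in> B" using u by simp
  obtain M where M: "M \<ge> 0" "\<And>r. r > 0 \<Longrightarrow> en r u \<le> M" using en_bounded[OF uB] by blast
  define d where "d = e / (M + 1)"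
  have d: "d > 0" "d * M \<le> e" using e M(1) by (auto simp: d_def field_simps)
  obtain g where g: "g \<in> B \<inter> Cc" "\<And>x. \<bar>\<phi> x - g x\<bar> < d"
    using regular \<phi> d(1) unfolding regular_Bspace_def by blast
  obtain a where a: "a > 0" "\<And>x. \<bar>\<phi> x\<bar> \<le> a" using Cc_bounded[OF \<phi>] by blast
  obtain b where b: "b > 0" "\<And>x. \<bar>g x\<bar> \<le> b" using Cc_bounded g by blast
  have "\<bar>J \<phi> n u - J g n u\<bar> \<le> d * en (rs n) u" for n
    by (rule weighted_difference_bound[OF uB, of _ "max a b"])
      (use a b g \<phi> in \<open>auto intro: Cc_measurable max.coboundedI1 max.coboundedI2 less_imp_le\<close>)
  also have "d * en (rs n) u \<le> e" for n
    using M(2)[OF rs_pos] d by (meson mult_left_mono order_trans less_imp_le)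
  finally have "\<forall>n. \<bar>J \<phi> n u - J g n u\<bar> \<le> e" by blast
  moreover have "convergent (\<lambda>n. J g n u)"
    using localized_energy_tendsto[OF u g(1)] by (auto simp: convergent_def)
  ultimately show "\<exists>g. convergent g \<and> (\<forall>n. \<bar>J \<phi> n u - g n\<bar> \<le> e)" by blast
qed

text \<open>The next two lemmas replace the norm of the space by the \<open>p\<close>-th powers of its two parts.\<close>

lemma Db_approx:
  assumes u: "u \<in> Db p m k" and e: "e > 0"
  obtains v where "v \<in> B \<inter> Cb" "(\<lambda>x. u x - v x) \<in> B" "(LINT x|m. \<bar>u x - v x\<bar> powr p) \<le> e"
    "\<And>r. r > 0 \<Longrightarrow> en r (\<lambda>x. u x - v x) \<le> e"
proof -
  obtain v where v: "v \<in> B \<inter> Cb" "Bnorm p m k (\<lambda>x. u x - v x) < e powr (1 / p)"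
    using u e unfolding Db_def by (auto dest!: spec[of _ "e powr (1 / p)"])
  define w where "w x = u x - v x" for x
  have wB: "w \<in> B" unfolding w_def using u v by (intro B_diff) (auto simp: Db_def)
  let ?L = "LINT x|m. \<bar>w x\<bar> powr p" and ?S = "enn2real (sup_energy p m k w)"
  have n0: "?L powr (1 / p) \<ge> 0" "?S powr (1 / p) \<ge> 0" by auto
  have "?L powr (1 / p) + ?S powr (1 / p) < e powr (1 / p)"
    using v(2) by (simp add: Bnorm_def Lp_norm_def w_def[abs_def])
  then have lt: "?L powr (1 / p) \<le> e powr (1 / p)" "?S powr (1 / p) \<le> e powr (1 / p)" using n0 by linarith+
  have root: "a \<le> e" if "a powr (1 / p) \<le> e powr (1 / p)" "a \<ge> 0" for a
  proof -
    have "(a powr (1 / p)) powr p \<le> (e powr (1 / p)) powr p"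
      using p by (intro powr_mono2[OF _ _ that(1)]) auto
    moreover have "(a powr (1 / p)) powr p = a" "(e powr (1 / p)) powr p = e"
      using that(2) p e by (simp_all add: powr_powr)
    ultimately show ?thesis by (simp only:)
  qed
  have L: "?L \<le> e" by (rule root[OF lt(1)]) simp
  have S: "?S \<le> e" by (rule root[OF lt(2)]) simp
  have "en r w \<le> e" if r: "r > 0" for r
  proof -
    have fin: "sup_energy p m k w < \<infinity>" using wB by (simp add: Bspace_def)
    have "ennreal (en r w) \<le> sup_energy p m k w"
      unfolding B_incr_Lp(2)[OF wB r, symmetric] sup_energy_def using r by (intro SUP_upper) auto
    also have "\<dots> = ennreal ?S" using fin by simp
    finally have "en r w \<le> ?S" by (simp add: ennreal_le_iff)
    then show ?thesis using S by linarith
  qed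
  then show ?thesis using that[of v] v(1) wB L unfolding w_def by blast
qed

lemma DbI:
  assumes w: "w \<in> B" and ap: "\<And>e. e > 0 \<Longrightarrow> \<exists>v\<in>B \<inter> Cb. (LINT x|m. \<bar>w x - v x\<bar> powr p) \<le> e \<and>
    (\<forall>r>0. en r (\<lambda>x. w x - v x) \<le> e)"
  shows "w \<in> Db p m k"
  unfolding Db_def
proof (intro CollectI conjI allI impI w)
  fix \<epsilon> :: real assume \<epsilon>: "\<epsilon> > 0"
  define e where "e = (\<epsilon> / 3) powr p"
  have e: "e > 0" "e powr (1 / p) = \<epsilon> / 3" using \<epsilon> p by (auto simp: e_def powr_powr)
  obtain v where v: "v \<in> B \<inter> Cb" "(LINT x|m. \<bar>w x - v x\<bar> powr p) \<le> e"
    "\<And>r. r > 0 \<Longrightarrow> en r (\<lambda>x. w x - v x) \<le> e"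
    using ap[OF e(1)] by blast
  have wv: "(\<lambda>x. w x - v x) \<in> B" using w v(1) by (intro B_diff) auto
  have "sup_energy p m k (\<lambda>x. w x - v x) \<le> ennreal e"
    unfolding sup_energy_def using v(3) B_incr_Lp(2)[OF wv] by (intro SUP_least) (auto intro: ennreal_leI)
  then have "enn2real (sup_energy p m k (\<lambda>x. w x - v x)) \<le> enn2real (ennreal e)"
    by (rule enn2real_mono) simp
  then have S: "enn2real (sup_energy p m k (\<lambda>x. w x - v x)) \<le> e" using e by simp
  have "Bnorm p m k (\<lambda>x. w x - v x) \<le> e powr (1 / p) + e powr (1 / p)"
    unfolding Bnorm_def Lp_norm_def using v(2) S p by (intro add_mono powr_mono2) auto
  also have "\<dots> < \<epsilon>" using e \<epsilon> by simp
  finally show "\<exists>v\<in>B \<inter> Cb. Bnorm p m k (\<lambda>x. w x - v x) < \<epsilon>" using v(1) by blast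
qed

lemma Cb_Db: "B \<inter> Cb \<subseteq> Db p m k"
proof
  fix u assume u: "u \<in> B \<inter> Cb"
  show "u \<in> Db p m k"
  proof (rule DbI)
    fix e :: real assume "e > 0"
    then show "\<exists>v\<in>B \<inter> Cb. (LINT x|m. \<bar>u x - v x\<bar> powr p) \<le> e \<and> (\<forall>r>0. en r (\<lambda>x. u x - v x) \<le> e)"
      using u by (intro bexI[of _ u]) (auto simp: en_def incr_def)
  qed (use u in simp)
qed

lemma Db_B: "u \<in> Db p m k \<Longrightarrow> u \<in> B"
  by (simp add: Db_def)

text \<open>Passing to the closure already at the level of localized energies makes the later measure available
  for all of \<open>Db\<close> at once.\<close>

lemma J_convergent:
  assumes u: "u \<in> Db p m k" and \<phi>: "\<phi> \<in> Cc"
  shows "convergent (\<lambda>n. J \<phi> n u)"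
proof (rule convergent_of_uniform_approximation)
  fix e :: real assume e: "e > 0"
  note uB = Db_B[OF u]
  obtain M where M: "M \<ge> 0" "\<And>r. r > 0 \<Longrightarrow> en r u \<le> M" using en_bounded[OF uB] by blast
  obtain c where c: "c > 0" "\<And>x. \<bar>\<phi> x\<bar> \<le> c" using Cc_bounded[OF \<phi>] by blast
  have half: "e / (2 * X) * X = e / 2" if "X > 0" for X :: real using that by simp
  define \<eta> where "\<eta> = e / (2 * (c * M + 1))"
  have cM: "c * M + 1 > 0" using c(1) M(1) by (intro add_nonneg_pos) auto
  have \<eta>: "\<eta> > 0" using e cM by (simp add: \<eta>_def)
  have \<eta>2: "\<eta> * (c * M) \<le> e / 2"
  proof -
    have "\<eta> * (c * M) \<le> \<eta> * (c * M + 1)" using \<eta> by (intro mult_left_mono) auto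
    also have "\<dots> = e / 2" unfolding \<eta>_def by (rule half[OF cM])
    finally show ?thesis .
  qed
  obtain C where C: "C \<ge> 0" "\<And>a b :: real. abs (\<bar>a\<bar> powr p - \<bar>b\<bar> powr p) \<le> \<eta> * \<bar>b\<bar> powr p + C * \<bar>a - b\<bar> powr p"
    using powr_increment_bound[OF p_pos \<eta>] by blast
  define d where "d = e / (2 * (C * c + 1))"
  have Cc: "C * c + 1 > 0" using c(1) C(1) by (intro add_nonneg_pos) auto
  have d: "d > 0" using e Cc by (simp add: d_def)
  have d2: "C * (c * d) \<le> e / 2"
  proof -
    have "C * (c * d) \<le> (C * c + 1) * d" using d by (simp add: distrib_right)
    also have "\<dots> = e / 2" unfolding d_def using half[OF Cc] by (simp only: mult.commute)
    finally show ?thesis .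
  qed
  obtain v where v: "v \<in> B \<inter> Cb" "\<And>r. r > 0 \<Longrightarrow> en r (\<lambda>x. u x - v x) \<le> d"
    using Db_approx[OF u d] by blast
  have sym: "en r (\<lambda>x. v x - u x) = en r (\<lambda>x. u x - v x)" for r
  proof -
    have "\<bar>incr (\<lambda>x. v x - u x) z\<bar> = \<bar>incr (\<lambda>x. u x - v x) z\<bar>" for z unfolding incr_def by linarith
    then show ?thesis by (simp add: en_def)
  qed
  have vu: "(\<lambda>x. v x - u x) \<in> B" using v uB by (intro B_diff) auto
  have am: "(\<lambda>x. \<bar>\<phi> x\<bar>) \<in> borel_measurable m" using Cc_measurable[OF \<phi>] by measurable
  have "\<bar>J \<phi> n u - J \<phi> n v\<bar> \<le> e" for n
  proof -
    have "\<bar>J \<phi> n u - J \<phi> n v\<bar> = \<bar>J \<phi> n v - J \<phi> n u\<bar>" by (rule abs_minus_commute)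
    also have "\<dots> \<le> \<eta> * J (\<lambda>x. \<bar>\<phi> x\<bar>) n u + C * J (\<lambda>x. \<bar>\<phi> x\<bar>) n (\<lambda>x. v x - u x)"
      using v uB by (intro energy_difference_bound[OF C(2) _ _ Cc_measurable[OF \<phi>] c(2)]) auto
    also have "\<dots> \<le> \<eta> * (c * M) + C * (c * d)"
    proof (intro add_mono mult_left_mono)
      show "J (\<lambda>x. \<bar>\<phi> x\<bar>) n u \<le> c * M"
        using J_bound[OF uB am, of c n] c M(2)[OF rs_pos[of n]]
        by (auto intro: order_trans[OF abs_ge_self] order_trans[OF _ mult_left_mono])
      show "J (\<lambda>x. \<bar>\<phi> x\<bar>) n (\<lambda>x. v x - u x) \<le> c * d"
        using J_bound[OF vu am, of c n] c v(2)[OF rs_pos[of n]]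
        by (auto simp: sym intro: order_trans[OF abs_ge_self] order_trans[OF _ mult_left_mono])
    qed (use \<eta> C in auto)
    also have "\<dots> \<le> e" using \<eta>2 d2 by linarith
    finally show ?thesis .
  qed
  then show "\<exists>g. convergent g \<and> (\<forall>n. \<bar>J \<phi> n u - g n\<bar> \<le> e)"
    using J_convergent_Cb[OF v(1) \<phi>] by blast
qed

section \<open>Stability under Lipschitz maps\<close>

text \<open>Uniform convexity of \<open>E\<close>, inherited from the powers by integration and by taking the limit.\<close>

lemma energy_midpoint:
  assumes C: "C \<ge> 0" "\<And>a b :: real. \<bar>a - b\<bar> powr p \<le> \<eta> * (\<bar>a\<bar> powr p + \<bar>b\<bar> powr p)
      + C * ((\<bar>a\<bar> powr p + \<bar>b\<bar> powr p) / 2 - \<bar>(a + b) / 2\<bar> powr p)"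
    and f: "f \<in> B" and g: "g \<in> B"
  shows "(\<lambda>x. (f x + g x) / 2) \<in> B"
    and "E (\<lambda>x. f x - g x) \<le> \<eta> * (E f + E g) + C * ((E f + E g) / 2 - E (\<lambda>x. (f x + g x) / 2))"
proof -
  have "(\<lambda>x. 1 / 2 * (f x + 1 * g x)) \<in> B" by (intro B_cmult B_combination f g)
  then show h: "(\<lambda>x. (f x + g x) / 2) \<in> B" by simp
  note d = B_diff[OF f g]
  show "E (\<lambda>x. f x - g x) \<le> \<eta> * (E f + E g) + C * ((E f + E g) / 2 - E (\<lambda>x. (f x + g x) / 2))"
  proof (rule LIMSEQ_le[OF energy_tendsto(1)[OF d]])
    show "(\<lambda>n. \<eta> * (en (rs n) f + en (rs n) g) + C * ((en (rs n) f + en (rs n) g) / 2 - en (rs n) (\<lambda>x. (f x + g x) / 2)))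
      \<longlonglongrightarrow> \<eta> * (E f + E g) + C * ((E f + E g) / 2 - E (\<lambda>x. (f x + g x) / 2))"
      by (intro tendsto_intros energy_tendsto f g h) simp
    have "en (rs n) (\<lambda>x. f x - g x)
      \<le> \<eta> * (en (rs n) f + en (rs n) g) + C * ((en (rs n) f + en (rs n) g) / 2 - en (rs n) (\<lambda>x. (f x + g x) / 2))" for n
    proof -
      note i = LpD(2)[OF B_incr_Lp(1)[OF _ rs_pos[of n]]]
      let ?R = "\<lambda>z. \<eta> * (\<bar>incr f z\<bar> powr p + \<bar>incr g z\<bar> powr p)
        + C * ((\<bar>incr f z\<bar> powr p + \<bar>incr g z\<bar> powr p) / 2 - \<bar>incr (\<lambda>x. (f x + g x) / 2) z\<bar> powr p)"
      have "en (rs n) (\<lambda>x. f x - g x) \<le> (LINT z|N (rs n). ?R z)"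
        unfolding en_def
      proof (rule integral_mono[OF i[OF d]])
        show "integrable (N (rs n)) ?R" using i[OF f] i[OF g] i[OF h] by simp
        show "\<bar>incr (\<lambda>x. f x - g x) z\<bar> powr p \<le> ?R z" for z
        proof -
          have "incr (\<lambda>x. f x - g x) z = incr f z - incr g z"
            "incr (\<lambda>x. (f x + g x) / 2) z = (incr f z + incr g z) / 2"
            by (simp_all add: incr_def field_simps)
          then show ?thesis using C(2)[of "incr f z" "incr g z"] by (simp only:)
        qed
      qed
      also have "\<dots> = \<eta> * (en (rs n) f + en (rs n) g) + C * ((en (rs n) f + en (rs n) g) / 2 - en (rs n) (\<lambda>x. (f x + g x) / 2))"
        unfolding en_def using i[OF f] i[OF g] i[OF h] by simp
      finally show ?thesis .
    qed
    then show "\<exists>N. \<forall>n\<ge>N. en (rs n) (\<lambda>x. f x - g x)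
      \<le> \<eta> * (en (rs n) f + en (rs n) g) + C * ((en (rs n) f + en (rs n) g) / 2 - en (rs n) (\<lambda>x. (f x + g x) / 2))"
      by blast
  qed
qed

text \<open>A subsequence of \<open>g\<close> converges almost everywhere, hence so do its increments for the measure \<open>N r\<close>,
  and Fatou's lemma applies.\<close>

lemma energy_lower_semicontinuous:
  fixes g :: "nat \<Rightarrow> 'a \<Rightarrow> real"
  assumes g: "\<And>j. g j \<in> B" and w: "w \<in> borel_measurable m"
    and int: "\<And>j. integrable m (\<lambda>x. \<bar>g j x - w x\<bar> powr p)"
    and lim: "(\<lambda>j. LINT x|m. \<bar>g j x - w x\<bar> powr p) \<longlonglongrightarrow> 0"
    and f: "f \<in> B" and bnd: "\<And>j. j \<ge> j0 \<Longrightarrow> en r (\<lambda>x. f x - g j x) \<le> c" and r: "r > 0"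
  shows "kernel_energy p m k r (\<lambda>x. f x - w x) \<le> ennreal c"
proof -
  obtain s where s: "strict_mono s" "AE x in m. (\<lambda>n. \<bar>g (s n) x - w x\<bar> powr p) \<longlonglongrightarrow> 0"
    using tendsto_L1_AE_subseq[of m "\<lambda>j x. \<bar>g j x - w x\<bar> powr p"] int lim by auto
  have conv: "(\<lambda>n. a n) \<longlonglongrightarrow> b" if "(\<lambda>n. \<bar>a n - b\<bar> powr p) \<longlonglongrightarrow> 0" for a and b :: real
  proof -
    have "(\<lambda>n. (\<bar>a n - b\<bar> powr p) powr (1 / p)) \<longlonglongrightarrow> 0 powr (1 / p)"
      using that p by (intro tendsto_powr') auto
    then have "(\<lambda>n. \<bar>a n - b\<bar>) \<longlonglongrightarrow> 0" using p by (simp add: powr_powr)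
    then show ?thesis using tendsto_rabs_zero_iff LIM_zero_iff by blast
  qed
  have "AE z in N r. (\<lambda>n. g (s n) (fst z)) \<longlonglongrightarrow> w (fst z) \<and> (\<lambda>n. g (s n) (snd z)) \<longlonglongrightarrow> w (snd z)"
    using AE_N[OF s(2) r] by eventually_elim (auto intro: conv)
  then have ae: "AE z in N r. (\<lambda>n. ennreal (\<bar>incr (\<lambda>x. f x - g (s n) x) z\<bar> powr p))
      \<longlonglongrightarrow> ennreal (\<bar>incr (\<lambda>x. f x - w x) z\<bar> powr p)"
  proof eventually_elim
    case (elim z)
    show ?case unfolding incr_def
      by (intro tendsto_ennrealI tendsto_powr' tendsto_rabs tendsto_diff tendsto_const) (use elim p in auto)
  qed
  have fw: "(\<lambda>x. f x - w x) \<in> borel_measurable m" using B_measurable[OF f] w by measurable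
  have fg: "(\<lambda>x. f x - g j x) \<in> B" for j by (intro B_diff f g)
  have "kernel_energy p m k r (\<lambda>x. f x - w x) = (\<integral>\<^sup>+z. ennreal (\<bar>incr (\<lambda>x. f x - w x) z\<bar> powr p) \<partial>N r)"
    by (rule kernel_energy_eq[OF r fw])
  also have "\<dots> = (\<integral>\<^sup>+z. liminf (\<lambda>n. ennreal (\<bar>incr (\<lambda>x. f x - g (s n) x) z\<bar> powr p)) \<partial>N r)"
    by (rule nn_integral_cong_AE, use ae in eventually_elim) (rule lim_imp_Liminf[symmetric], simp)
  also have "\<dots> \<le> liminf (\<lambda>n. \<integral>\<^sup>+z. ennreal (\<bar>incr (\<lambda>x. f x - g (s n) x) z\<bar> powr p) \<partial>N r)"
  proof (rule nn_integral_liminf)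
    fix n
    show "(\<lambda>z. ennreal (\<bar>incr (\<lambda>x. f x - g (s n) x) z\<bar> powr p)) \<in> borel_measurable (N r)"
      using LpD(1)[OF B_incr_Lp(1)[OF fg r]] by measurable
  qed
  also have "\<dots> = liminf (\<lambda>n. ennreal (en r (\<lambda>x. f x - g (s n) x)))"
    using kernel_energy_eq[OF r B_measurable[OF fg]] B_incr_Lp(2)[OF fg r] by simp
  also have "\<dots> \<le> ennreal c"
  proof (rule order_trans[OF Liminf_le_Limsup], simp, rule Limsup_bounded)
    show "\<forall>\<^sub>F n in sequentially. ennreal (en r (\<lambda>x. f x - g (s n) x)) \<le> ennreal c"
      using eventually_ge_at_top[of j0]
    proof eventually_elim
      case (elim n)
      then have "s n \<ge> j0" using seq_suble[OF s(1), of n] by linarith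
      then show ?case by (intro ennreal_leI bnd)
    qed
  qed
  finally show ?thesis .
qed

text \<open>A substitute for weak compactness.  Minimizing the energy over the functions in \<open>B \<inter> Cb\<close> that are
  close to \<open>w\<close> in \<open>L\<^sup>p\<close> gives a sequence that is Cauchy in energy by uniform convexity, since the
  constraint sets are stable under midpoints; its limit can only be \<open>w\<close>.\<close>

lemma Db_of_bounded_energy:
  fixes ws :: "nat \<Rightarrow> 'a \<Rightarrow> real"
  assumes w: "w \<in> borel_measurable m" and ws: "\<And>j. ws j \<in> B \<inter> Cb"
    and int: "\<And>j. integrable m (\<lambda>x. \<bar>ws j x - w x\<bar> powr p)"
    and lim: "(\<lambda>j. LINT x|m. \<bar>ws j x - w x\<bar> powr p) \<longlonglongrightarrow> 0"
    and M: "\<And>j. E (ws j) \<le> M"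
  shows "w \<in> Db p m k"
proof -
  \<comment> \<open>The sets \<open>A (t i)\<close> decrease, so the minimal energies \<open>a i\<close> increase; they are bounded by \<open>M\<close>.\<close>
  define A where "A \<epsilon> = {g \<in> B \<inter> Cb. integrable m (\<lambda>x. \<bar>g x - w x\<bar> powr p) \<and> (LINT x|m. \<bar>g x - w x\<bar> powr p) \<le> \<epsilon>}" for \<epsilon>
  define t where "t i = inverse (real (Suc i))" for i
  have t: "t i > 0" "t \<longlonglongrightarrow> 0" "i \<le> j \<Longrightarrow> t j \<le> t i" for i j
    unfolding t_def using LIMSEQ_inverse_real_of_nat by (auto simp: field_simps)
  define a where "a i = Inf (E ` A (t i))" for i
  have E0: "E g \<ge> 0" if "g \<in> A \<epsilon>" for g \<epsilon> using that energy_tendsto(2) by (auto simp: A_def)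
  have bdd: "bdd_below (E ` A \<epsilon>)" for \<epsilon> using E0 by (auto simp: bdd_below_def)
  have a_le: "a i \<le> E g" if "g \<in> A (t i)" for g i unfolding a_def using that bdd by (intro cInf_lower) auto
  have mem: "\<exists>j. ws j \<in> A (t i)" for i
  proof -
    have "\<forall>\<^sub>F j in sequentially. (LINT x|m. \<bar>ws j x - w x\<bar> powr p) < t i"
      using order_tendstoD(2)[OF lim t(1)] .
    then obtain j where "(LINT x|m. \<bar>ws j x - w x\<bar> powr p) < t i" by (auto simp: eventually_sequentially)
    then show ?thesis using ws int by (auto simp: A_def intro!: exI[of _ j])
  qed
  have aM: "a i \<le> M" for i using mem[of i] a_le M by (meson order_trans)
  have mid: "(\<lambda>x. (f x + g x) / 2) \<in> A \<epsilon>" if f: "f \<in> A \<epsilon>" and g: "g \<in> A \<epsilon>" for f g \<epsilon>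
  proof -
    have "(\<lambda>x. 1 / 2 * (f x + 1 * g x)) \<in> B" using f g by (intro B_cmult B_combination) (auto simp: A_def)
    then have hB: "(\<lambda>x. (f x + g x) / 2) \<in> B" by simp
    have hC: "(\<lambda>x. (f x + g x) / 2) \<in> Cb"
    proof -
      obtain c where c: "\<And>x. \<bar>f x\<bar> \<le> c" using Cb_bounded[of f] f by (auto simp: A_def)
      obtain d where d: "\<And>x. \<bar>g x\<bar> \<le> d" using Cb_bounded[of g] g by (auto simp: A_def)
      have "continuous_on UNIV f" "continuous_on UNIV g" using f g by (auto simp: A_def Cb_def)
      then have "continuous_on UNIV (\<lambda>x. (f x + g x) / 2)" by (intro continuous_intros) auto
      moreover have "\<bar>(f x + g x) / 2\<bar> \<le> c + d" for x using c[of x] d[of x] by (auto simp: abs_le_iff)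
      ultimately show ?thesis by (rule CbI)
    qed
    have fi: "integrable m (\<lambda>x. \<bar>f x - w x\<bar> powr p)" and fe: "(LINT x|m. \<bar>f x - w x\<bar> powr p) \<le> \<epsilon>"
      and gi: "integrable m (\<lambda>x. \<bar>g x - w x\<bar> powr p)" and ge: "(LINT x|m. \<bar>g x - w x\<bar> powr p) \<le> \<epsilon>"
      using f g by (auto simp: A_def)
    have pt: "\<bar>(f x + g x) / 2 - w x\<bar> powr p \<le> (\<bar>f x - w x\<bar> powr p + \<bar>g x - w x\<bar> powr p) / 2" for x
    proof -
      have "(f x + g x) / 2 - w x = ((f x - w x) + (g x - w x)) / 2" by (simp add: field_simps)
      then show ?thesis using powr_midpoint_le[OF p, of "f x - w x" "g x - w x"] by (simp only:)
    qed
    have hi: "integrable m (\<lambda>x. \<bar>(f x + g x) / 2 - w x\<bar> powr p)"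
    proof (rule Bochner_Integration.integrable_bound)
      show "integrable m (\<lambda>x. (\<bar>f x - w x\<bar> powr p + \<bar>g x - w x\<bar> powr p) / 2)" using fi gi by simp
      show "(\<lambda>x. \<bar>(f x + g x) / 2 - w x\<bar> powr p) \<in> borel_measurable m"
        using B_measurable[OF hB] w by measurable
      show "AE x in m. norm (\<bar>(f x + g x) / 2 - w x\<bar> powr p) \<le> norm ((\<bar>f x - w x\<bar> powr p + \<bar>g x - w x\<bar> powr p) / 2)"
        using pt by (intro AE_I2) simp
    qed
    have "(LINT x|m. \<bar>(f x + g x) / 2 - w x\<bar> powr p) \<le> (LINT x|m. (\<bar>f x - w x\<bar> powr p + \<bar>g x - w x\<bar> powr p) / 2)"
      using fi gi by (intro integral_mono hi pt) auto
    also have "\<dots> = ((LINT x|m. \<bar>f x - w x\<bar> powr p) + (LINT x|m. \<bar>g x - w x\<bar> powr p)) / 2"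
      using fi gi by simp
    also have "\<dots> \<le> \<epsilon>" using fe ge by simp
    finally show ?thesis using hB hC hi by (simp add: A_def)
  qed
  have sub: "A (t j) \<subseteq> A (t i)" if "i \<le> j" for i j using t(3)[OF that] by (auto simp: A_def)
  have inc: "a i \<le> a j" if "i \<le> j" for i j
    unfolding a_def using sub[OF that] mem[of j] bdd by (intro cInf_superset_mono image_mono) auto
  have "\<exists>g. g \<in> A (t i) \<and> E g < a i + t i" for i
  proof -
    have "Inf (E ` A (t i)) < a i + t i" using t(1)[of i] by (simp add: a_def)
    then obtain y where "y \<in> E ` A (t i)" "y < a i + t i"
      using mem[of i] by (metis cInf_lessD empty_is_image ex_in_conv)
    then show ?thesis by auto
  qed
  then obtain g where g: "\<And>i. g i \<in> A (t i)" "\<And>i. E (g i) < a i + t i" by metis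
  have gB: "g i \<in> B" and gC: "g i \<in> Cb" and gi: "integrable m (\<lambda>x. \<bar>g i x - w x\<bar> powr p)"
    and gt: "(LINT x|m. \<bar>g i x - w x\<bar> powr p) \<le> t i" for i
    using g(1)[of i] by (auto simp: A_def)
  obtain L where L: "a \<longlonglongrightarrow> L" "\<And>i. a i \<le> L"
    using incseq_convergent[of a M] inc aM by (auto simp: incseq_def)
  have M1: "E (g i) \<le> \<bar>M\<bar> + 1" for i
    using g(2)[of i] aM[of i] t(3)[of 0 i] by (simp add: t_def)
  have lin: "(x + y) / 2 - z \<le> (l - b) + s" if "b \<le> z" "x \<le> l + s" "y \<le> l + s" for x y z l b s :: real
  proof -
    have "x + y \<le> 2 * (l + s)" using add_mono[OF that(2,3)] by (simp only: mult_2)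
    then have "(x + y) / 2 \<le> l + s" by simp
    then show ?thesis using that(1) by linarith
  qed
  have cauchy: "\<exists>I. \<forall>i\<ge>I. \<forall>j\<ge>i. E (\<lambda>x. g i x - g j x) \<le> e" if e: "e > 0" for e
  proof -
    define \<eta> where "\<eta> = e / (4 * (\<bar>M\<bar> + 1))"
    have \<eta>: "\<eta> > 0" "\<eta> * (2 * (\<bar>M\<bar> + 1)) = e / 2"
      using e by (simp_all add: \<eta>_def field_simps add_nonneg_pos)
    obtain C where C: "C \<ge> 0" "\<And>a b :: real. \<bar>a - b\<bar> powr p \<le> \<eta> * (\<bar>a\<bar> powr p + \<bar>b\<bar> powr p)
      + C * ((\<bar>a\<bar> powr p + \<bar>b\<bar> powr p) / 2 - \<bar>(a + b) / 2\<bar> powr p)"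
      using powr_uniformly_convex[OF p \<eta>(1)] by blast
    have "(\<lambda>i. C * ((L - a i) + t i)) \<longlonglongrightarrow> C * ((L - L) + 0)" by (intro tendsto_intros L t)
    then have "\<forall>\<^sub>F i in sequentially. C * ((L - a i) + t i) < e / 2" using e by (intro order_tendstoD(2)) auto
    then obtain I where I: "\<And>i. i \<ge> I \<Longrightarrow> C * ((L - a i) + t i) < e / 2" by (auto simp: eventually_sequentially)
    have "E (\<lambda>x. g i x - g j x) \<le> e" if i: "i \<ge> I" and j: "j \<ge> i" for i j
    proof -
      let ?h = "\<lambda>x. (g i x + g j x) / 2"
      \<comment> \<open>The midpoint competes in the earlier set, hence its energy cannot be much smaller.\<close>
      have "?h \<in> A (t i)" using g(1) sub[OF j] by (intro mid) auto
      then have h: "a i \<le> E ?h" by (rule a_le)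
      have gj: "E (g j) \<le> L + t i" using g(2)[of j] L(2)[of j] t(3)[OF j] by linarith
      have gi': "E (g i) \<le> L + t i" using g(2)[of i] L(2)[of i] by linarith
      have "E (\<lambda>x. g i x - g j x) \<le> \<eta> * (E (g i) + E (g j)) + C * ((E (g i) + E (g j)) / 2 - E ?h)"
        by (rule energy_midpoint(2)[OF C gB gB])
      also have "\<dots> \<le> \<eta> * (2 * (\<bar>M\<bar> + 1)) + C * ((L - a i) + t i)"
      proof (intro add_mono mult_left_mono)
        show "E (g i) + E (g j) \<le> 2 * (\<bar>M\<bar> + 1)" using add_mono[OF M1[of i] M1[of j]] by (simp only: mult_2)
        show "(E (g i) + E (g j)) / 2 - E ?h \<le> (L - a i) + t i" by (rule lin[OF h gi' gj])
      qed (use \<eta> C in auto)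
      also have "\<dots> \<le> e" using \<eta>(2) I[OF i] by linarith
      finally show ?thesis .
    qed
    then show ?thesis by blast
  qed
  obtain Cw where Cw: "Cw \<ge> 1" "\<And>f r. f \<in> B \<Longrightarrow> r > 0 \<Longrightarrow> en r f \<le> Cw * E f"
    using weak_monotonicity_energy by blast
  have glim: "(\<lambda>j. LINT x|m. \<bar>g j x - w x\<bar> powr p) \<longlonglongrightarrow> 0"
    by (rule tendsto_sandwich[OF _ _ tendsto_const t(2)]) (use gt in auto)
  have wg: "integrable m (\<lambda>x. \<bar>w x - g i x\<bar> powr p)" "(LINT x|m. \<bar>w x - g i x\<bar> powr p) \<le> t i" for i
    using gi[of i] gt[of i] by (simp_all add: abs_minus_commute[of "w _"])
  have key: "\<exists>I. \<forall>i\<ge>I. (\<forall>r>0. kernel_energy p m k r (\<lambda>x. w x - g i x) \<le> ennreal e)" if e: "e > 0" for e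
  proof -
    obtain I where I: "\<And>i j. i \<ge> I \<Longrightarrow> j \<ge> i \<Longrightarrow> E (\<lambda>x. g i x - g j x) \<le> e / Cw"
      using cauchy[of "e / Cw"] e Cw(1) by auto
    have "kernel_energy p m k r (\<lambda>x. w x - g i x) \<le> ennreal e" if i: "i \<ge> I" and r: "r > 0" for i r
    proof -
      have "en r (\<lambda>x. g i x - g j x) \<le> e" if "j \<ge> i" for j
      proof -
        have "en r (\<lambda>x. g i x - g j x) \<le> Cw * E (\<lambda>x. g i x - g j x)" by (intro Cw B_diff gB r)
        also have "\<dots> \<le> Cw * (e / Cw)" using I[OF i that] Cw(1) by (intro mult_left_mono) auto
        finally show ?thesis using Cw(1) by simp
      qed
      then have "kernel_energy p m k r (\<lambda>x. g i x - w x) \<le> ennreal e"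
        by (rule energy_lower_semicontinuous[OF gB w gi glim gB _ r])
      moreover have "kernel_energy p m k r (\<lambda>x. g i x - w x) = kernel_energy p m k r (\<lambda>x. w x - g i x)"
      proof -
        have "\<bar>(g i x - w x) - (g i y - w y)\<bar> = \<bar>(w x - g i x) - (w y - g i y)\<bar>" for x y by linarith
        then show ?thesis by (simp add: kernel_energy_def)
      qed
      ultimately show ?thesis by simp
    qed
    then show ?thesis by blast
  qed
  have wgB: "(\<lambda>x. w x - g i x) \<in> B" if "\<forall>r>0. kernel_energy p m k r (\<lambda>x. w x - g i x) \<le> ennreal e" for i e
  proof -
    have "(\<lambda>x. w x - g i x) \<in> borel_measurable m" using w B_measurable[OF gB] by measurable
    then show ?thesis using wg(1) that unfolding Bspace_iff Lp_iff_integrable by blast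
  qed
  have wB: "w \<in> B"
  proof -
    obtain I where "\<forall>r>0. kernel_energy p m k r (\<lambda>x. w x - g I x) \<le> ennreal 1" using key[of 1] by auto
    from B_combination(1)[OF wgB[OF this] gB[of I], of 1] show ?thesis by simp
  qed
  show ?thesis
  proof (rule DbI[OF wB])
    fix e :: real assume e: "e > 0"
    obtain I where I: "\<And>i. i \<ge> I \<Longrightarrow> \<forall>r>0. kernel_energy p m k r (\<lambda>x. w x - g i x) \<le> ennreal e"
      using key[OF e] by blast
    have "\<forall>\<^sub>F i in sequentially. t i < e" using order_tendstoD(2)[OF t(2) e] .
    then obtain I' where I': "\<And>i. i \<ge> I' \<Longrightarrow> t i < e" by (auto simp: eventually_sequentially)
    define i where "i = max I I'"
    have k: "\<forall>r>0. kernel_energy p m k r (\<lambda>x. w x - g i x) \<le> ennreal e" by (rule I) (simp add: i_def)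
    have "en r (\<lambda>x. w x - g i x) \<le> e" if "r > 0" for r
      using k that e B_incr_Lp(2)[OF wgB[OF k] that] by (auto simp: ennreal_le_iff)
    moreover have "(LINT x|m. \<bar>w x - g i x\<bar> powr p) \<le> e" using wg(2)[of i] I'[of i] by (simp add: i_def)
    ultimately show "\<exists>v\<in>B \<inter> Cb. (LINT x|m. \<bar>w x - v x\<bar> powr p) \<le> e \<and> (\<forall>r>0. en r (\<lambda>x. w x - v x) \<le> e)"
      using gB gC by (intro bexI[of _ "g i"]) auto
  qed
qed

end


text \<open>Maps on \<open>\<real>\<^sup>n\<close> are maps on sequences that depend on finitely many coordinates.\<close>

lemma lipschitz_composition_continuous:
  fixes T :: "(nat \<Rightarrow> real) \<Rightarrow> real" and v :: "nat \<Rightarrow> 'b::topological_space \<Rightarrow> real"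
  assumes T: "\<And>x y. \<bar>T x - T y\<bar> \<le> L * (\<Sum>i<n. \<bar>x i - y i\<bar>)"
    and v: "\<And>i. i < n \<Longrightarrow> continuous_on UNIV (v i)"
  shows "continuous_on UNIV (\<lambda>x. T (\<lambda>i. v i x))"
  unfolding continuous_on_def
proof
  fix x
  have "((\<lambda>y. v i y) \<longlongrightarrow> v i x) (at x within UNIV)" if "i < n" for i
    using v[OF that] by (simp add: continuous_on_def)
  then have "((\<lambda>y. L * (\<Sum>i<n. \<bar>v i y - v i x\<bar>)) \<longlongrightarrow> L * (\<Sum>i<n. \<bar>v i x - v i x\<bar>)) (at x within UNIV)"
    by (intro tendsto_intros) auto
  then have "((\<lambda>y. L * (\<Sum>i<n. \<bar>v i y - v i x\<bar>)) \<longlongrightarrow> 0) (at x within UNIV)" by simp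
  then have "((\<lambda>y. T (\<lambda>i. v i y) - T (\<lambda>i. v i x)) \<longlongrightarrow> 0) (at x within UNIV)"
    by (rule Lim_null_comparison[OF always_eventually, rotated]) (use T in simp)
  then show "((\<lambda>y. T (\<lambda>i. v i y)) \<longlongrightarrow> T (\<lambda>i. v i x)) (at x within UNIV)" by (rule LIM_zero_cancel)
qed

lemma lipschitz_composition_measurable:
  fixes T :: "(nat \<Rightarrow> real) \<Rightarrow> real" and u :: "nat \<Rightarrow> 'b \<Rightarrow> real"
  assumes T: "\<And>x y. \<bar>T x - T y\<bar> \<le> L * (\<Sum>i<n. \<bar>x i - y i\<bar>)"
    and u: "\<And>i. i < n \<Longrightarrow> u i \<in> borel_measurable M"
  shows "(\<lambda>x. T (\<lambda>i. u i x)) \<in> borel_measurable M"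
proof -
  have eq: "T (\<lambda>i. u i x) = T (\<lambda>i. if i < n then u i x else 0)" for x
  proof -
    have "(\<Sum>i<n. \<bar>u i x - (if i < n then u i x else 0)\<bar>) = 0" by (intro sum.neutral) auto
    then have "\<bar>T (\<lambda>i. u i x) - T (\<lambda>i. if i < n then u i x else 0)\<bar> \<le> L * 0"
      using T[of "\<lambda>i. u i x" "\<lambda>i. if i < n then u i x else 0"] by simp
    then show ?thesis by simp
  qed
  have "continuous_on UNIV (\<lambda>x. T (\<lambda>i. x i))"
    by (rule lipschitz_composition_continuous[OF T]) (rule continuous_on_product_coordinates)
  then have "T \<in> borel_measurable borel" by (intro borel_measurable_continuous_onI) simp
  moreover have "(\<lambda>x i. if i < n then u i x else 0) \<in> borel_measurable M"
  proof (rule measurable_coordinatewise_then_product)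
    show "(\<lambda>x. if i < n then u i x else 0) \<in> borel_measurable M" for i
      using u by (cases "i < n") auto
  qed
  ultimately have "(\<lambda>x. T (\<lambda>i. if i < n then u i x else 0)) \<in> borel_measurable M"
    by (rule measurable_compose[rotated])
  then show ?thesis by (simp only: eq)
qed

lemma lq_norm_le_sum:
  assumes "q > 0"
  shows "lq_norm (ereal q) n x \<le> real n powr (1 / q) * (\<Sum>i<n. \<bar>x i\<bar>)"
proof -
  define S where "S = (\<Sum>i<n. \<bar>x i\<bar>)"
  have S: "S \<ge> 0" by (simp add: S_def sum_nonneg)
  have "(\<Sum>i<n. \<bar>x i\<bar> powr q) \<le> (\<Sum>i<n. S powr q)"
  proof (rule sum_mono)
    fix i assume "i \<in> {..<n}"
    then have "\<bar>x i\<bar> \<le> S" unfolding S_def by (intro member_le_sum) auto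
    then show "\<bar>x i\<bar> powr q \<le> S powr q" using assms by (intro powr_mono2) auto
  qed
  then have "(\<Sum>i<n. \<bar>x i\<bar> powr q) powr (1 / q) \<le> (real n * S powr q) powr (1 / q)"
    using assms by (intro powr_mono2) (auto simp: sum_nonneg)
  also have "\<dots> = real n powr (1 / q) * S"
    using assms S by (simp add: powr_mult powr_powr)
  finally show ?thesis by (simp add: lq_norm_ereal S_def)
qed

lemma component_le_lq_norm:
  assumes "q > 0" "l < n"
  shows "\<bar>x l\<bar> \<le> lq_norm q n x"
proof (cases q)
  case PInf
  then show ?thesis using assms by (auto simp: lq_norm_infinity intro!: Max_ge)
next
  case (real r)
  then have r: "r > 0" using assms by simp
  have "\<bar>x l\<bar> = (\<bar>x l\<bar> powr r) powr (1 / r)" using r by (simp add: powr_powr)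
  also have "\<dots> \<le> (\<Sum>i<n. \<bar>x i\<bar> powr r) powr (1 / r)"
    using r assms(2) by (intro powr_mono2 member_le_sum[of l]) auto
  finally show ?thesis by (simp add: real lq_norm_ereal)
qed (use assms in simp)

lemma lq_norm_cong:
  assumes "\<And>i. i < n \<Longrightarrow> x i = y i"
  shows "lq_norm q n x = lq_norm q n y"
proof -
  have "(\<lambda>i. \<bar>x i\<bar>) ` {..<n} = (\<lambda>i. \<bar>y i\<bar>) ` {..<n}" using assms by (intro image_cong) auto
  moreover have "(\<Sum>i<n. \<bar>x i\<bar> powr r) = (\<Sum>i<n. \<bar>y i\<bar> powr r)" for r using assms by simp
  ultimately show ?thesis by (simp add: lq_norm_def)
qed

context energy_setting
begin

text \<open>The images of approximants of the \<open>u i\<close> converge in \<open>L\<^sup>p\<close> and are bounded in energy; convergence in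
  energy may fail, which is why \<open>Db_of_bounded_energy\<close> is needed.\<close>

lemma Db_lipschitz:
  fixes T :: "(nat \<Rightarrow> real) \<Rightarrow> real" and u :: "nat \<Rightarrow> 'a \<Rightarrow> real"
  assumes L: "L \<ge> 0" and T: "\<And>x y. \<bar>T x - T y\<bar> \<le> L * (\<Sum>i<n. \<bar>x i - y i\<bar>)" and T0: "T (\<lambda>i. 0) = 0"
    and u: "\<And>i. i < n \<Longrightarrow> u i \<in> Db p m k"
  shows "(\<lambda>x. T (\<lambda>i. u i x)) \<in> Db p m k"
proof -
  define good where "good i j v \<longleftrightarrow> v \<in> B \<inter> Cb \<and> (\<lambda>x. u i x - v x) \<in> B \<and>
      (LINT x|m. \<bar>u i x - v x\<bar> powr p) \<le> inverse (real (Suc j)) \<and>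
      (\<forall>r>0. en r (\<lambda>x. u i x - v x) \<le> inverse (real (Suc j)))" for i j v
  have "\<exists>v. i < n \<longrightarrow> good i j v" for i j
  proof (cases "i < n")
    case True
    obtain v where "v \<in> B \<inter> Cb" "(\<lambda>x. u i x - v x) \<in> B"
      "(LINT x|m. \<bar>u i x - v x\<bar> powr p) \<le> inverse (real (Suc j))"
      "\<And>r. r > 0 \<Longrightarrow> en r (\<lambda>x. u i x - v x) \<le> inverse (real (Suc j))"
      using Db_approx[OF u[OF True], where e="inverse (real (Suc j))"] by auto
    then have "good i j v" by (simp add: good_def)
    then show ?thesis by blast
  qed simp
  then obtain v where good: "\<And>i j. i < n \<Longrightarrow> good i j (v i j)" by metis
  have v: "\<And>i j. i < n \<Longrightarrow> v i j \<in> B \<inter> Cb"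
    "\<And>i j. i < n \<Longrightarrow> (\<lambda>x. u i x - v i j x) \<in> B"
    "\<And>i j. i < n \<Longrightarrow> (LINT x|m. \<bar>u i x - v i j x\<bar> powr p) \<le> inverse (real (Suc j))"
    "\<And>i j r. i < n \<Longrightarrow> r > 0 \<Longrightarrow> en r (\<lambda>x. u i x - v i j x) \<le> inverse (real (Suc j))"
    using good unfolding good_def by blast+
  define w where "w x = T (\<lambda>i. u i x)" for x
  define ws where "ws j x = T (\<lambda>i. v i j x)" for j x
  have T1: "\<bar>T x\<bar> \<le> L * (\<Sum>i<n. \<bar>x i\<bar>)" for x using T[of x "\<lambda>i. 0"] T0 by simp
  have wm: "w \<in> borel_measurable m" unfolding w_def[abs_def]
    by (rule lipschitz_composition_measurable[OF T]) (use u Db_B B_measurable in blast)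
  have wsm: "ws j \<in> borel_measurable m" for j unfolding ws_def[abs_def]
    by (rule lipschitz_composition_measurable[OF T]) (use v(1) B_measurable in blast)
  have wsB: "ws j \<in> B" and wsE: "E (ws j) \<le> (L * n) powr p * (\<Sum>i<n. E (v i j))" for j
  proof -
    note * = B_dominated[where f="ws j" and n=n and g="\<lambda>i. v i j" and C=L, OF wsm _ L]
    show "ws j \<in> B" "E (ws j) \<le> (L * n) powr p * (\<Sum>i<n. E (v i j))"
      by (intro *; use v(1) T1 T in \<open>auto simp: ws_def\<close>)+
  qed
  have wsC: "ws j \<in> Cb" for j
  proof -
    have "\<exists>c. \<forall>x. \<bar>v i j x\<bar> \<le> c" if "i < n" for i
      using Cb_bounded[of "v i j"] v(1)[OF that] by blast
    then obtain c where c: "\<And>i x. i < n \<Longrightarrow> \<bar>v i j x\<bar> \<le> c i" by metis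
    show ?thesis
    proof (rule CbI)
      show "continuous_on UNIV (ws j)" unfolding ws_def[abs_def]
        by (rule lipschitz_composition_continuous[OF T]) (use v(1) in \<open>auto simp: Cb_def\<close>)
      show "\<bar>ws j x\<bar> \<le> L * (\<Sum>i<n. c i)" for x unfolding ws_def
        using c by (intro order_trans[OF T1] mult_left_mono sum_mono L) auto
    qed
  qed
  have diffL: "(\<lambda>x. ws j x - w x) \<in> Lp p m"
    and diffI: "(LINT x|m. \<bar>ws j x - w x\<bar> powr p) \<le> (L * n) powr p * (\<Sum>i<n. LINT x|m. \<bar>u i x - v i j x\<bar> powr p)" for j
  proof -
    have m: "(\<lambda>x. ws j x - w x) \<in> borel_measurable m" using wm wsm by measurable
    have le: "\<bar>ws j x - w x\<bar> \<le> L * (\<Sum>i<n. \<bar>u i x - v i j x\<bar>)" for x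
      using T[of "\<lambda>i. v i j x" "\<lambda>i. u i x"] by (simp add: ws_def w_def abs_minus_commute)
    have g: "(\<lambda>x. u i x - v i j x) \<in> Lp p m" if "i < n" for i using v(2)[OF that] by (simp add: Bspace_def)
    show "(\<lambda>x. ws j x - w x) \<in> Lp p m" by (rule Lp_dominated(1)[OF p_pos m g L le])
    show "(LINT x|m. \<bar>ws j x - w x\<bar> powr p) \<le> (L * n) powr p * (\<Sum>i<n. LINT x|m. \<bar>u i x - v i j x\<bar> powr p)"
      by (rule Lp_dominated(2)[OF p_pos m g L le])
  qed
  have lim: "(\<lambda>j. LINT x|m. \<bar>ws j x - w x\<bar> powr p) \<longlonglongrightarrow> 0"
  proof (rule tendsto_sandwich[OF _ _ tendsto_const])
    have "(\<lambda>j. (L * n) powr p * (\<Sum>i<n. inverse (real (Suc j)))) \<longlonglongrightarrow> (L * n) powr p * (\<Sum>i<n. 0)"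
      by (intro tendsto_intros LIMSEQ_inverse_real_of_nat)
    then show "(\<lambda>j. (L * n) powr p * (\<Sum>i<n. inverse (real (Suc j)))) \<longlonglongrightarrow> 0" by simp
    have "(LINT x|m. \<bar>ws j x - w x\<bar> powr p) \<le> (L * n) powr p * (\<Sum>i<n. inverse (real (Suc j)))" for j
      using v(3) by (intro order_trans[OF diffI] mult_left_mono sum_mono) auto
    then show "\<forall>\<^sub>F j in sequentially. (LINT x|m. \<bar>ws j x - w x\<bar> powr p) \<le> (L * n) powr p * (\<Sum>i<n. inverse (real (Suc j)))"
      by simp
  qed simp
  have vE: "E (v i j) \<le> 4 powr p * (E (u i) + 1)" if i: "i < n" for i j
  proof -
    have "E (\<lambda>x. u i x - v i j x) \<le> inverse (real (Suc j))"
      by (rule LIMSEQ_le_const2[OF energy_tendsto(1)[OF v(2)[OF i]]]) (use v(4)[OF i rs_pos] in blast)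
    also have "\<dots> \<le> 1" by (simp add: field_simps)
    finally have 1: "E (\<lambda>x. u i x - v i j x) \<le> 1" .
    \<comment> \<open>The energy of \<open>v i j = u i - (u i - v i j)\<close> is bounded independently of \<open>j\<close>.\<close>
    have "E (\<lambda>x. u i x + (-1) * (u i x - v i j x)) \<le> (2 * (1 + \<bar>-1\<bar>)) powr p * (E (u i) + E (\<lambda>x. u i x - v i j x))"
      by (rule B_combination(2)[OF Db_B[OF u[OF i]] v(2)[OF i]])
    also have "\<dots> \<le> 4 powr p * (E (u i) + 1)" using 1 by simp
    finally show ?thesis by simp
  qed
  have M: "E (ws j) \<le> (L * n) powr p * (\<Sum>i<n. 4 powr p * (E (u i) + 1))" for j
    using vE by (intro order_trans[OF wsE] mult_left_mono sum_mono) auto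
  have "w \<in> Db p m k"
    by (rule Db_of_bounded_energy[where ws=ws, OF wm _ LpD(2)[OF diffL] lim M]) (use wsB wsC in blast)
  then show ?thesis by (simp add: w_def[abs_def])
qed

lemma Db_add:
  assumes "u \<in> Db p m k" "v \<in> Db p m k"
  shows "(\<lambda>x. u x + t * v x) \<in> Db p m k"
proof -
  have "(\<lambda>x. (\<lambda>z :: nat \<Rightarrow> real. z 0 + t * z 1) (\<lambda>i. (if i = 0 then u else v) x)) \<in> Db p m k"
  proof (rule Db_lipschitz[where n=2 and L="1 + \<bar>t\<bar>" and T="\<lambda>z. z 0 + t * z 1"
        and u="\<lambda>i. if i = 0 then u else v"])
    fix x y :: "nat \<Rightarrow> real"
    have "(x 0 + t * x 1) - (y 0 + t * y 1) = (x 0 - y 0) + t * (x 1 - y 1)" by (simp add: algebra_simps)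
    also have "\<bar>\<dots>\<bar> \<le> 1 * \<bar>x 0 - y 0\<bar> + \<bar>t\<bar> * \<bar>x 1 - y 1\<bar>"
      using abs_triangle_ineq[of "x 0 - y 0" "t * (x 1 - y 1)"] by (simp add: abs_mult)
    also have "\<dots> \<le> (1 + \<bar>t\<bar>) * \<bar>x 0 - y 0\<bar> + (1 + \<bar>t\<bar>) * \<bar>x 1 - y 1\<bar>"
      by (intro add_mono mult_right_mono) auto
    also have "\<dots> = (1 + \<bar>t\<bar>) * (\<Sum>i<(2::nat). \<bar>x i - y i\<bar>)" by (simp add: numeral_2_eq_2 distrib_left)
    finally show "\<bar>x 0 + t * x 1 - (y 0 + t * y 1)\<bar> \<le> (1 + \<bar>t\<bar>) * (\<Sum>i<2. \<bar>x i - y i\<bar>)" .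
  qed (use assms in auto)
  then show ?thesis by simp
qed

lemma Db_diff: "u \<in> Db p m k \<Longrightarrow> v \<in> Db p m k \<Longrightarrow> (\<lambda>x. u x - v x) \<in> Db p m k"
  using Db_add[of u v "-1"] by simp

lemma Db_zero: "(\<lambda>x. 0) \<in> Db p m k"
  using Db_lipschitz[of 0 "\<lambda>_. 0" 0] by simp

lemma Db_cmult: "u \<in> Db p m k \<Longrightarrow> (\<lambda>x. a * u x) \<in> Db p m k"
  using Db_add[OF Db_zero, of u a] by simp

lemma incr_cong_AE:
  assumes "AE x in m. u x = v x" "r > 0"
  shows "AE z in N r. incr u z = incr v z"
  using AE_N[OF assms] by eventually_elim (simp add: incr_def)

lemma Db_cong_AE:
  assumes u: "u \<in> Db p m k" and v: "v \<in> borel_measurable m" and ae: "AE x in m. u x = v x"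
  shows "v \<in> Db p m k"
proof (rule DbI)
  note um = B_measurable[OF Db_B[OF u]]
  have "kernel_energy p m k r v = kernel_energy p m k r u" if r: "r > 0" for r
    unfolding kernel_energy_eq[OF r v] kernel_energy_eq[OF r um]
    by (rule nn_integral_cong_AE, use incr_cong_AE[OF ae r] in eventually_elim) simp
  moreover have "(\<integral>\<^sup>+x. ennreal (\<bar>v x\<bar> powr p) \<partial>m) = (\<integral>\<^sup>+x. ennreal (\<bar>u x\<bar> powr p) \<partial>m)"
    by (rule nn_integral_cong_AE, use ae in eventually_elim) simp
  ultimately show "v \<in> B" using Db_B[OF u] v by (simp add: Bspace_iff Lp_def)
  fix e :: real assume e: "e > 0"
  obtain g where g: "g \<in> B \<inter> Cb" "(LINT x|m. \<bar>u x - g x\<bar> powr p) \<le> e" "\<And>r. r > 0 \<Longrightarrow> en r (\<lambda>x. u x - g x) \<le> e"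
    using Db_approx[OF u e] by blast
  have gm: "g \<in> borel_measurable m" using g(1) B_measurable by blast
  have "(LINT x|m. \<bar>v x - g x\<bar> powr p) = (LINT x|m. \<bar>u x - g x\<bar> powr p)"
  proof (rule integral_cong_AE)
    show "AE x in m. \<bar>v x - g x\<bar> powr p = \<bar>u x - g x\<bar> powr p" using ae by eventually_elim simp
  qed (use um v gm in measurable)
  moreover have "en r (\<lambda>x. v x - g x) = en r (\<lambda>x. u x - g x)" if r: "r > 0" for r
    unfolding en_def
  proof (rule integral_cong_AE)
    have "AE x in m. v x - g x = u x - g x" using ae by eventually_elim simp
    then show "AE z in N r. \<bar>incr (\<lambda>x. v x - g x) z\<bar> powr p = \<bar>incr (\<lambda>x. u x - g x) z\<bar> powr p"
      by (rule eventually_mono[OF incr_cong_AE[OF _ r]]) simp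
    have m: "incr (\<lambda>x. h x - g x) \<in> borel_measurable (N r)" if "h \<in> borel_measurable m" for h
    proof -
      have "(\<lambda>x. h x - g x) \<in> borel_measurable m" using that gm by measurable
      then show ?thesis using incr_borel by (simp add: measurable_N)
    qed
    show "(\<lambda>z. \<bar>incr (\<lambda>x. v x - g x) z\<bar> powr p) \<in> borel_measurable (N r)" using m[OF v] by measurable
    show "(\<lambda>z. \<bar>incr (\<lambda>x. u x - g x) z\<bar> powr p) \<in> borel_measurable (N r)" using m[OF um] by measurable
  qed
  ultimately show "\<exists>g\<in>B \<inter> Cb. (LINT x|m. \<bar>v x - g x\<bar> powr p) \<le> e \<and> (\<forall>r>0. en r (\<lambda>x. v x - g x) \<le> e)"
    using g by (intro bexI[of _ g]) auto
qed

section \<open>The energy measures\<close>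

text \<open>The measure \<open>gamma u\<close> represents the limit of the localized energies.\<close>

definition energy_functional :: "('a \<Rightarrow> real) \<Rightarrow> ('a \<Rightarrow> real) \<Rightarrow> real" where
  "energy_functional u \<phi> = lim (\<lambda>n. J \<phi> n u)"

definition gamma :: "('a \<Rightarrow> real) \<Rightarrow> 'a measure" where
  "gamma u = bounded_positive_functional.riesz_measure (energy_functional u)"

lemma energy_functional_tendsto:
  "u \<in> Db p m k \<Longrightarrow> \<phi> \<in> Cc \<Longrightarrow> (\<lambda>n. J \<phi> n u) \<longlonglongrightarrow> energy_functional u \<phi>"
  using J_convergent by (simp add: energy_functional_def convergent_LIMSEQ_iff)

lemma J_integrable:
  assumes "u \<in> B" "\<phi> \<in> Cc"
  shows "integrable (N (rs n)) (\<lambda>z. \<bar>incr u z\<bar> powr p * \<phi> (fst z))"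
proof -
  obtain c where "\<And>x. \<bar>\<phi> x\<bar> \<le> c" using Cc_bounded[OF assms(2)] by blast
  then show ?thesis by (intro weighted_integrable assms fst_borel Cc_measurable rs_pos)
qed

lemma energy_functional_positive:
  assumes u: "u \<in> Db p m k"
  shows "bounded_positive_functional (energy_functional u) (E u)"
proof
  note uB = Db_B[OF u]
  show "energy_functional u (\<lambda>x. f x + g x) = energy_functional u f + energy_functional u g"
    if f: "f \<in> Cc" and g: "g \<in> Cc" for f g
  proof (rule LIMSEQ_unique[OF energy_functional_tendsto[OF u Cc_add[OF f g]]])
    have "J (\<lambda>x. f x + g x) n u = J f n u + J g n u" for n
      unfolding J_def using J_integrable[OF uB f] J_integrable[OF uB g] by (simp add: distrib_left)
    then show "(\<lambda>n. J (\<lambda>x. f x + g x) n u) \<longlonglongrightarrow> energy_functional u f + energy_functional u g"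
      by (simp add: tendsto_add energy_functional_tendsto u f g)
  qed
  show "energy_functional u (\<lambda>x. c * f x) = c * energy_functional u f" if f: "f \<in> Cc" for c f
  proof (rule LIMSEQ_unique[OF energy_functional_tendsto[OF u Cc_cmult[OF f]]])
    have "J (\<lambda>x. c * f x) n u = c * J f n u" for n
      unfolding J_def by (simp add: mult.left_commute)
    then show "(\<lambda>n. J (\<lambda>x. c * f x) n u) \<longlonglongrightarrow> c * energy_functional u f"
      by (simp add: tendsto_mult_left energy_functional_tendsto u f)
  qed
  show "0 \<le> energy_functional u f" if f: "f \<in> Cc" "\<And>x. 0 \<le> f x" for f
    by (rule LIMSEQ_le_const[OF energy_functional_tendsto[OF u f(1)]]) (use f(2) in \<open>auto simp: J_def\<close>)
  show "energy_functional u f \<le> E u * c" if f: "f \<in> Cc" "\<And>x. \<bar>f x\<bar> \<le> c" for f c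
  proof (rule LIMSEQ_le[OF energy_functional_tendsto[OF u f(1)]])
    show "(\<lambda>n. en (rs n) u * c) \<longlonglongrightarrow> E u * c" by (intro tendsto_intros energy_tendsto uB)
    show "\<exists>N. \<forall>n\<ge>N. J f n u \<le> en (rs n) u * c"
      using J_bound[OF uB Cc_measurable[OF f(1)] f(2)]
      by (auto simp: mult.commute intro: order_trans[OF abs_ge_self])
  qed
qed

lemma gamma_sets: "u \<in> Db p m k \<Longrightarrow> sets (gamma u) = sets borel"
  unfolding gamma_def by (rule bounded_positive_functional.sets_riesz[OF energy_functional_positive])

lemma gamma_finite: "u \<in> Db p m k \<Longrightarrow> finite_measure (gamma u)"
  unfolding gamma_def by (rule bounded_positive_functional.finite_riesz[OF energy_functional_positive])

lemma gamma_mass: "u \<in> Db p m k \<Longrightarrow> emeasure (gamma u) UNIV \<le> ennreal (E u)"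
  unfolding gamma_def by (rule bounded_positive_functional.emeasure_riesz_UNIV[OF energy_functional_positive])

lemma gamma_tendsto:
  assumes "u \<in> Db p m k" "\<phi> \<in> Cc"
  shows "(\<lambda>n. J \<phi> n u) \<longlonglongrightarrow> (LINT x|gamma u. \<phi> x)"
  using energy_functional_tendsto[OF assms]
    bounded_positive_functional.riesz_representation[OF energy_functional_positive[OF assms(1)] assms(2)]
  by (simp add: gamma_def)

lemma gamma_radon:
  assumes "u \<in> Db p m k"
  shows "radon_measure (gamma u)"
proof -
  interpret finite_measure "gamma u" by (rule gamma_finite[OF assms])
  show ?thesis using gamma_sets[OF assms] emeasure_finite
    by (simp add: radon_measure_def less_top[symmetric])
qed

lemma gamma_cong_AE:
  assumes u: "u \<in> Db p m k" and v: "v \<in> Db p m k" and ae: "AE x in m. u x = v x"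
  shows "gamma u = gamma v"
proof (rule radon_measure_eqI[OF locally_compact gamma_radon[OF u] gamma_radon[OF v]])
  fix f :: "'a \<Rightarrow> real" assume f: "f \<in> Cc"
  have "J f n u = J f n v" for n
    unfolding J_def
  proof (rule integral_cong_AE)
    show "AE z in N (rs n). \<bar>incr u z\<bar> powr p * f (fst z) = \<bar>incr v z\<bar> powr p * f (fst z)"
      using incr_cong_AE[OF ae rs_pos] by eventually_elim simp
  qed (use J_integrable Db_B u v f in blast)+
  then show "(LINT x|gamma u. f x) = (LINT x|gamma v. f x)"
    using gamma_tendsto[OF u f] gamma_tendsto[OF v f] LIMSEQ_unique by simp
qed

text \<open>Uniform approximation from \<open>B \<inter> Cc\<close> does not control supports, and a Radon measure need not be
  finite.  Truncating the approximant near zero puts its support inside that of the target.\<close>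

lemma radon_measure_eqI_B:
  assumes M: "radon_measure \<mu>" and N: "radon_measure \<nu>"
    and eq: "\<And>g. g \<in> B \<inter> Cc \<Longrightarrow> (LINT x|\<mu>. g x) = (LINT x|\<nu>. g x)"
  shows "\<mu> = \<nu>"
proof (rule radon_measure_eqI[OF locally_compact M N])
  fix f :: "'a \<Rightarrow> real" assume f: "f \<in> Cc"
  let ?K = "closure {x. f x \<noteq> 0}"
  define c where "c = measure \<mu> ?K + measure \<nu> ?K"
  have c: "c \<ge> 0" by (simp add: c_def)
  have est: "\<bar>(LINT x|\<rho>. f x) - (LINT x|\<rho>. g x)\<bar> \<le> d * measure \<rho> ?K"
    if \<rho>: "radon_measure \<rho>" and g: "g \<in> Cc" and le: "\<And>x. \<bar>f x - g x\<bar> \<le> d" and z: "\<And>x. f x = 0 \<Longrightarrow> g x = 0"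
    for \<rho> :: "'a measure" and g d
  proof -
    have K: "?K \<in> sets \<rho>" "emeasure \<rho> ?K < \<infinity>"
      using \<rho> CcD(2)[OF f] by (auto simp: radon_measure_def)
    note i = radon_Cc_integrable[OF \<rho> f] radon_Cc_integrable[OF \<rho> g]
    have "(LINT x|\<rho>. f x) - (LINT x|\<rho>. g x) = (LINT x|\<rho>. f x - g x)" using i by simp
    also have "\<bar>\<dots>\<bar> \<le> (LINT x|\<rho>. \<bar>f x - g x\<bar>)" by (rule integral_abs_bound)
    also have "\<dots> \<le> (LINT x|\<rho>. d * indicator ?K x)"
    proof (rule integral_mono)
      show "integrable \<rho> (\<lambda>x. d * indicator ?K x)"
        using K by (intro integrable_mult_right) (simp add: integrable_indicator_iff)
      show "\<bar>f x - g x\<bar> \<le> d * indicator ?K x" for x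
      proof (cases "f x = 0")
        case True
        then show ?thesis using z le[of x] by simp
      next
        case False
        then have "x \<in> ?K" using closure_subset[of "{x. f x \<noteq> 0}"] by auto
        then show ?thesis using le by simp
      qed
    qed (use i in simp)
    also have "\<dots> = d * measure \<rho> ?K" using K sets.sets_into_space[OF K(1)] by (simp add: Int_absorb2)
    finally show ?thesis .
  qed
  have small: "\<bar>(LINT x|\<mu>. f x) - (LINT x|\<nu>. f x)\<bar> \<le> 2 * e * c" if e: "e > 0" for e
  proof -
    obtain h where h: "h \<in> B \<inter> Cc" "\<And>x. \<bar>f x - h x\<bar> < e"
      using regular f e unfolding regular_Bspace_def by blast
    define g where "g x = max 0 (h x - e) - max 0 (- 1 * h x - e)" for x
    have "g \<in> B" unfolding g_def[abs_def] using h e by (intro B_diff B_shrink B_cmult) auto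
    moreover have "g \<in> Cc" unfolding g_def[abs_def] using h e by (intro Cc_diff Cc_shrink Cc_cmult) auto
    ultimately have g: "g \<in> B \<inter> Cc" by simp
    have z: "g x = 0" if "f x = 0" for x using h(2)[of x] that by (auto simp: g_def)
    have le: "\<bar>f x - g x\<bar> \<le> 2 * e" for x
    proof -
      have "\<bar>h x - g x\<bar> \<le> e" using e by (auto simp: g_def max_def abs_if)
      then show ?thesis using h(2)[of x] by linarith
    qed
    have "\<bar>(LINT x|\<mu>. f x) - (LINT x|\<nu>. f x)\<bar>
      \<le> \<bar>(LINT x|\<mu>. f x) - (LINT x|\<mu>. g x)\<bar> + \<bar>(LINT x|\<nu>. f x) - (LINT x|\<nu>. g x)\<bar>"
      unfolding eq[OF g] by linarith
    also have "\<dots> \<le> 2 * e * measure \<mu> ?K + 2 * e * measure \<nu> ?K"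
      using g z le by (intro add_mono est M N) auto
    finally show ?thesis by (simp add: c_def distrib_left)
  qed
  show "(LINT x|\<mu>. f x) = (LINT x|\<nu>. f x)"
  proof (rule ccontr)
    assume ne: "(LINT x|\<mu>. f x) \<noteq> (LINT x|\<nu>. f x)"
    define D where "D = \<bar>(LINT x|\<mu>. f x) - (LINT x|\<nu>. f x)\<bar>"
    have D: "D > 0" using ne by (simp add: D_def)
    have "D \<le> 2 * (D / (4 * (c + 1))) * c" unfolding D_def by (rule small) (use D c in \<open>simp add: D_def\<close>)
    then have "D * (2 * (c + 1)) \<le> D * c" using c by (simp add: field_simps)
    then show False using D c by simp
  qed
qed

text \<open>The measure \<open>gamma u\<close> has the defining integrals by \<open>localized_energy_tendsto\<close>, and
  \<open>radon_measure_eqI_B\<close> makes it the only Radon measure with them.\<close>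

lemma energy_measure_eq_gamma:
  assumes u: "u \<in> B \<inter> Cb"
  shows "energy_measure p m k rs u = gamma u"
  unfolding energy_measure_def
proof (rule the_equality)
  have uD: "u \<in> Db p m k" using Cb_Db u by blast
  have g: "(LINT x|gamma u. \<phi> x) = energy2 p m k rs u (\<lambda>x. u x * \<phi> x)
      - ((p - 1) / p) powr (p - 1) * energy2 p m k rs (\<lambda>x. \<bar>u x\<bar> powr (p / (p - 1))) \<phi>"
    if "\<phi> \<in> B \<inter> Cc" for \<phi>
    using LIMSEQ_unique[OF gamma_tendsto[OF uD] localized_energy_tendsto[OF u that]] that by blast
  then show "radon_measure (gamma u) \<and> (\<forall>\<phi>\<in>B \<inter> Cc. (LINT x|gamma u. \<phi> x) = energy2 p m k rs u (\<lambda>x. u x * \<phi> x)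
      - ((p - 1) / p) powr (p - 1) * energy2 p m k rs (\<lambda>x. \<bar>u x\<bar> powr (p / (p - 1))) \<phi>)"
    using gamma_radon[OF uD] by blast
  show "\<mu> = gamma u" if \<mu>: "radon_measure \<mu> \<and> (\<forall>\<phi>\<in>B \<inter> Cc. (LINT x|\<mu>. \<phi> x) = energy2 p m k rs u (\<lambda>x. u x * \<phi> x)
      - ((p - 1) / p) powr (p - 1) * energy2 p m k rs (\<lambda>x. \<bar>u x\<bar> powr (p / (p - 1))) \<phi>)" for \<mu>
    by (rule radon_measure_eqI_B) (use \<mu> g gamma_radon[OF uD] in auto)
qed

lemma bounded_borel_integrable_gamma:
  assumes "bounded_nonneg_borel \<phi>" "u \<in> Db p m k"
  shows "integrable (gamma u) \<phi>"
proof -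
  interpret finite_measure "gamma u" by (rule gamma_finite[OF assms(2)])
  obtain c where "\<And>x. \<bar>\<phi> x\<bar> \<le> c" using assms(1) by (force simp: bounded_nonneg_borel_def bounded_iff)
  then show ?thesis using assms gamma_sets[OF assms(2)]
    by (intro integrable_const_bound[of _ c]) (auto simp: bounded_nonneg_borel_def cong: measurable_cong_sets)
qed

lemma gamma_integral_nonneg:
  "bounded_nonneg_borel \<phi> \<Longrightarrow> 0 \<le> (LINT x|gamma u. \<phi> x)"
  by (simp add: bounded_nonneg_borel_def)

lemma gamma_integral_le:
  assumes \<phi>: "bounded_nonneg_borel \<phi>" "\<And>x. \<phi> x \<le> c" and u: "u \<in> Db p m k"
  shows "(LINT x|gamma u. \<phi> x) \<le> c * E u"
proof -
  interpret finite_measure "gamma u" by (rule gamma_finite[OF u])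
  have c: "c \<ge> 0" using \<phi> by (auto simp: bounded_nonneg_borel_def intro: order_trans)
  have sp: "space (gamma u) = UNIV" using sets_eq_imp_space_eq[OF gamma_sets[OF u]] by simp
  have "ennreal (measure (gamma u) UNIV) \<le> ennreal (E u)"
    using gamma_mass[OF u] by (simp add: emeasure_eq_measure)
  then have mass: "measure (gamma u) UNIV \<le> E u"
    using energy_tendsto(2)[OF Db_B[OF u]] by (simp add: ennreal_le_iff)
  have "(LINT x|gamma u. \<phi> x) \<le> (LINT x|gamma u. c)"
    by (intro integral_mono bounded_borel_integrable_gamma[OF \<phi>(1) u] \<phi>(2)) simp
  also have "\<dots> = measure (gamma u) UNIV * c" by (simp add: sp)
  also have "\<dots> \<le> E u * c" using mass c by (rule mult_right_mono)
  finally show ?thesis by (simp add: mult.commute)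
qed

text \<open>Closed relations between the integrals of compactly supported functions against finitely many
  energy measures extend to bounded Borel functions.\<close>

lemma gamma_approximating_sequence:
  fixes u :: "nat \<Rightarrow> 'a \<Rightarrow> real"
  assumes "bounded_nonneg_borel \<phi>" "\<And>i. i < n \<Longrightarrow> u i \<in> Db p m k"
  obtains \<psi> :: "nat \<Rightarrow> 'a \<Rightarrow> real" where "\<And>j. \<psi> j \<in> Cc" "\<And>j x. 0 \<le> \<psi> j x"
    "\<And>i. i < n \<Longrightarrow> (\<lambda>j. LINT x|gamma (u i). \<psi> j x) \<longlonglongrightarrow> (LINT x|gamma (u i). \<phi> x)"
proof (rule Cc_approximating_sequence[of n "\<lambda>i. gamma (u i)" \<phi>])
  show "finite_measure (gamma (u i))" if "i < n" for i using assms(2)[OF that] by (rule gamma_finite)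
  show "sets (gamma (u i)) = sets borel" if "i < n" for i using assms(2)[OF that] by (rule gamma_sets)
qed (use locally_compact assms(1) that in blast)+

lemma gamma_integral_difference:
  assumes C: "\<And>a b :: real. abs (\<bar>a\<bar> powr p - \<bar>b\<bar> powr p) \<le> \<eta> * \<bar>b\<bar> powr p + C * \<bar>a - b\<bar> powr p"
    and \<phi>: "bounded_nonneg_borel \<phi>" and u: "u \<in> Db p m k" and v: "v \<in> Db p m k"
  shows "\<bar>(LINT x|gamma u. \<phi> x) - (LINT x|gamma v. \<phi> x)\<bar>
    \<le> \<eta> * (LINT x|gamma v. \<phi> x) + C * (LINT x|gamma (\<lambda>x. u x - v x). \<phi> x)"
proof -
  define d where "d x = u x - v x" for x
  have d: "d \<in> Db p m k" unfolding d_def[abs_def] by (rule Db_diff[OF u v])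
  let ?w = "\<lambda>i::nat. if i = 0 then u else if i = 1 then v else d"
  obtain \<psi> :: "nat \<Rightarrow> 'a \<Rightarrow> real" where \<psi>: "\<And>j. \<psi> j \<in> Cc" "\<And>j x. 0 \<le> \<psi> j x"
    "\<And>i. i < 3 \<Longrightarrow> (\<lambda>j. LINT x|gamma (?w i). \<psi> j x) \<longlonglongrightarrow> (LINT x|gamma (?w i). \<phi> x)"
    by (rule gamma_approximating_sequence[OF \<phi>, of 3 ?w]) (use u v d in auto)
  have lim: "(\<lambda>j. LINT x|gamma u. \<psi> j x) \<longlonglongrightarrow> (LINT x|gamma u. \<phi> x)"
    "(\<lambda>j. LINT x|gamma v. \<psi> j x) \<longlonglongrightarrow> (LINT x|gamma v. \<phi> x)"
    "(\<lambda>j. LINT x|gamma d. \<psi> j x) \<longlonglongrightarrow> (LINT x|gamma d. \<phi> x)"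
    using \<psi>(3)[of 0] \<psi>(3)[of 1] \<psi>(3)[of 2] by simp_all
  have "\<bar>(LINT x|gamma u. \<psi> j x) - (LINT x|gamma v. \<psi> j x)\<bar>
    \<le> \<eta> * (LINT x|gamma v. \<psi> j x) + C * (LINT x|gamma d. \<psi> j x)" for j
  proof (rule LIMSEQ_le)
    show "(\<lambda>n. \<bar>J (\<psi> j) n u - J (\<psi> j) n v\<bar>) \<longlonglongrightarrow> \<bar>(LINT x|gamma u. \<psi> j x) - (LINT x|gamma v. \<psi> j x)\<bar>"
      by (intro tendsto_intros gamma_tendsto u v \<psi>)
    show "(\<lambda>n. \<eta> * J (\<psi> j) n v + C * J (\<psi> j) n d) \<longlonglongrightarrow> \<eta> * (LINT x|gamma v. \<psi> j x) + C * (LINT x|gamma d. \<psi> j x)"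
      by (intro tendsto_intros gamma_tendsto v d \<psi>)
    obtain c where c: "\<And>x. \<bar>\<psi> j x\<bar> \<le> c" using Cc_bounded[OF \<psi>(1)] by blast
    have "\<bar>J (\<psi> j) n u - J (\<psi> j) n v\<bar> \<le> \<eta> * J (\<psi> j) n v + C * J (\<psi> j) n d" for n
      using energy_difference_bound[OF C Db_B[OF u] Db_B[OF v] Cc_measurable[OF \<psi>(1)] c] \<psi>(2)
      by (simp add: d_def[abs_def])
    then show "\<exists>N. \<forall>n\<ge>N. \<bar>J (\<psi> j) n u - J (\<psi> j) n v\<bar> \<le> \<eta> * J (\<psi> j) n v + C * J (\<psi> j) n d" by blast
  qed
  then have "\<bar>(LINT x|gamma u. \<phi> x) - (LINT x|gamma v. \<phi> x)\<bar>
    \<le> \<eta> * (LINT x|gamma v. \<phi> x) + C * (LINT x|gamma d. \<phi> x)"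
    by (intro LIMSEQ_le[OF tendsto_rabs[OF tendsto_diff[OF lim(1,2)]]
        tendsto_add[OF tendsto_mult_left[OF lim(2)] tendsto_mult_left[OF lim(3)]]]) blast
  then show ?thesis by (simp add: d_def[abs_def])
qed

lemma gamma_integral_homogeneous:
  assumes \<phi>: "bounded_nonneg_borel \<phi>" and u: "u \<in> Db p m k"
  shows "(LINT x|gamma (\<lambda>x. a * u x). \<phi> x) = \<bar>a\<bar> powr p * (LINT x|gamma u. \<phi> x)"
proof -
  define v where "v x = a * u x" for x
  have v: "v \<in> Db p m k" unfolding v_def[abs_def] by (rule Db_cmult[OF u])
  obtain \<psi> :: "nat \<Rightarrow> 'a \<Rightarrow> real" where \<psi>: "\<And>j. \<psi> j \<in> Cc" "\<And>j x. 0 \<le> \<psi> j x"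
    "\<And>i. i < (2::nat) \<Longrightarrow> (\<lambda>j. LINT x|gamma (if i = 0 then u else v). \<psi> j x) \<longlonglongrightarrow> (LINT x|gamma (if i = 0 then u else v). \<phi> x)"
    by (rule gamma_approximating_sequence[OF \<phi>, of 2 "\<lambda>i::nat. if i = 0 then u else v"]) (use u v in auto)
  have "(LINT x|gamma v. \<psi> j x) = \<bar>a\<bar> powr p * (LINT x|gamma u. \<psi> j x)" for j
  proof (rule LIMSEQ_unique[OF gamma_tendsto[OF v \<psi>(1)]])
    have "incr v z = a * incr u z" for z by (simp add: v_def incr_def right_diff_distrib)
    then have "J (\<psi> j) n v = \<bar>a\<bar> powr p * J (\<psi> j) n u" for n
      by (simp add: J_def abs_mult powr_mult mult.assoc)
    then show "(\<lambda>n. J (\<psi> j) n v) \<longlonglongrightarrow> \<bar>a\<bar> powr p * (LINT x|gamma u. \<psi> j x)"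
      by (simp add: tendsto_mult_left gamma_tendsto u \<psi>)
  qed
  then have "(\<lambda>j. LINT x|gamma v. \<psi> j x) \<longlonglongrightarrow> \<bar>a\<bar> powr p * (LINT x|gamma u. \<phi> x)"
    using tendsto_mult_left[OF \<psi>(3)[of 0]] by simp
  moreover have "(\<lambda>j. LINT x|gamma v. \<psi> j x) \<longlonglongrightarrow> (LINT x|gamma v. \<phi> x)" using \<psi>(3)[of 1] by simp
  ultimately show ?thesis using LIMSEQ_unique by (auto simp: v_def[abs_def])
qed

section \<open>Contraction properties\<close>

text \<open>At a fixed scale and with a fixed weight \<open>\<psi>\<close> the inequality is \<open>contraction_of_power_integrals\<close> for the
  increments, with the weight absorbed into the measure.  It then passes to the limit twice: along the
  scales, and along an approximation of \<open>\<phi>\<close> that is common to all the measures involved.\<close>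

lemma gamma_contraction:
  fixes T :: "(nat \<Rightarrow> real) \<Rightarrow> nat \<Rightarrow> real" and u :: "nat \<Rightarrow> 'a \<Rightarrow> real"
  assumes n: "1 \<le> n1" "1 \<le> n2" and q1: "0 < q1" "q1 \<le> p" and q2: "ereal p \<le> q2"
    and T0: "\<And>l. l < n2 \<Longrightarrow> T (\<lambda>i. 0) l = 0"
    and T: "\<And>x y. lq_norm q2 n2 (\<lambda>l. T x l - T y l) \<le> lq_norm (ereal q1) n1 (\<lambda>i. x i - y i)"
    and u: "\<And>i. i < n1 \<Longrightarrow> u i \<in> Db p m k" and \<phi>: "bounded_nonneg_borel \<phi>"
  shows "\<And>l. l < n2 \<Longrightarrow> (\<lambda>x. T (\<lambda>i. u i x) l) \<in> Db p m k"
    and "lq_norm q2 n2 (\<lambda>l. (LINT x|gamma (\<lambda>x. T (\<lambda>i. u i x) l). \<phi> x) powr (1 / p))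
      \<le> lq_norm (ereal q1) n1 (\<lambda>i. (LINT x|gamma (u i). \<phi> x) powr (1 / p))"
proof -
  have q2p: "q2 > 0" using q2 p by (metis ereal_less(2) less_le_trans p_pos)
  define w where "w l x = T (\<lambda>i. u i x) l" for l x
  have w: "w l \<in> Db p m k" if l: "l < n2" for l
    unfolding w_def[abs_def]
  proof (rule Db_lipschitz[where T="\<lambda>x. T x l" and L="real n1 powr (1 / q1)" and n=n1])
    fix x y :: "nat \<Rightarrow> real"
    have "\<bar>T x l - T y l\<bar> \<le> lq_norm q2 n2 (\<lambda>l. T x l - T y l)"
      by (rule component_le_lq_norm[OF q2p l, of "\<lambda>l. T x l - T y l"])
    also have "\<dots> \<le> lq_norm (ereal q1) n1 (\<lambda>i. x i - y i)" by (rule T)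
    also have "\<dots> \<le> real n1 powr (1 / q1) * (\<Sum>i<n1. \<bar>x i - y i\<bar>)" by (rule lq_norm_le_sum[OF q1(1)])
    finally show "\<bar>T x l - T y l\<bar> \<le> real n1 powr (1 / q1) * (\<Sum>i<n1. \<bar>x i - y i\<bar>)" .
  qed (use T0[OF l] u in auto)
  then show "\<And>l. l < n2 \<Longrightarrow> (\<lambda>x. T (\<lambda>i. u i x) l) \<in> Db p m k" by (simp add: w_def[abs_def])
  have fixed: "lq_norm q2 n2 (\<lambda>l. (J \<psi> n (w l)) powr (1 / p)) \<le> lq_norm (ereal q1) n1 (\<lambda>i. (J \<psi> n (u i)) powr (1 / p))"
    if \<psi>: "\<psi> \<in> Cc" "\<And>x. 0 \<le> \<psi> x" for \<psi> n
  proof -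
    define D where "D = density (N (rs n)) (\<lambda>z. ennreal (\<psi> (fst z)))"
    have \<psi>m: "(\<lambda>z. \<psi> (fst z)) \<in> borel_measurable (N (rs n))"
      using fst_borel[OF Cc_measurable[OF \<psi>(1)]] by (simp add: measurable_N)
    have D: "incr f \<in> Lp p D" "(LINT z|D. \<bar>incr f z\<bar> powr p) = J \<psi> n f" if f: "f \<in> B" for f
    proof -
      have m: "incr f \<in> borel_measurable (N (rs n))" using incr_borel[OF B_measurable[OF f]] by (simp add: measurable_N)
      then have m': "(\<lambda>z. \<bar>incr f z\<bar> powr p) \<in> borel_measurable (N (rs n))" by measurable
      have "integrable D (\<lambda>z. \<bar>incr f z\<bar> powr p)" unfolding D_def
        using J_integrable[OF f \<psi>(1), of n] \<psi>(2)
        by (subst integrable_density[OF m' \<psi>m]) (auto simp: mult.commute)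
      then show "incr f \<in> Lp p D" using m by (simp add: Lp_iff_integrable D_def)
      show "(LINT z|D. \<bar>incr f z\<bar> powr p) = J \<psi> n f" unfolding D_def J_def
        using \<psi>(2) by (subst integral_density[OF m' \<psi>m]) (auto simp: mult.commute)
    qed
    have "lq_norm q2 n2 (\<lambda>l. (LINT z|D. \<bar>incr (w l) z\<bar> powr p) powr (1 / p))
      \<le> lq_norm (ereal q1) n1 (\<lambda>i. (LINT z|D. \<bar>incr (u i) z\<bar> powr p) powr (1 / p))"
    proof (rule contraction_of_power_integrals[OF p_pos n q1 q2])
      show "lq_norm q2 n2 (\<lambda>l. incr (w l) z) \<le> lq_norm (ereal q1) n1 (\<lambda>i. incr (u i) z)" for z
        using T[of "\<lambda>i. u i (fst z)" "\<lambda>i. u i (snd z)"] by (simp add: incr_def w_def)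
    qed (use D(1) Db_B w u in auto)
    moreover have "lq_norm q2 n2 (\<lambda>l. (LINT z|D. \<bar>incr (w l) z\<bar> powr p) powr (1 / p))
      = lq_norm q2 n2 (\<lambda>l. (J \<psi> n (w l)) powr (1 / p))"
      by (rule lq_norm_cong) (simp add: D(2) Db_B w)
    moreover have "lq_norm (ereal q1) n1 (\<lambda>i. (LINT z|D. \<bar>incr (u i) z\<bar> powr p) powr (1 / p))
      = lq_norm (ereal q1) n1 (\<lambda>i. (J \<psi> n (u i)) powr (1 / p))"
      by (rule lq_norm_cong) (simp add: D(2) Db_B u)
    ultimately show ?thesis by simp
  qed
  have J0: "J \<psi> n f \<ge> 0" if "\<And>x. 0 \<le> \<psi> x" for \<psi> n f using that by (simp add: J_def)
  have Cc_case: "lq_norm q2 n2 (\<lambda>l. (LINT x|gamma (w l). \<psi> x) powr (1 / p))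
      \<le> lq_norm (ereal q1) n1 (\<lambda>i. (LINT x|gamma (u i). \<psi> x) powr (1 / p))"
    if \<psi>: "\<psi> \<in> Cc" "\<And>x. 0 \<le> \<psi> x" for \<psi>
    by (rule lq_norm_le_limit[OF sequentially_bot p_pos n q1(1) q2, where a="\<lambda>n l. J \<psi> n (w l)" and b="\<lambda>n i. J \<psi> n (u i)"])
      (use gamma_tendsto w u \<psi> fixed[OF \<psi>] J0[OF \<psi>(2)] in auto)
  define f where "f i = (if i < n2 then w i else u (i - n2))" for i
  have f: "f i \<in> Db p m k" if "i < n2 + n1" for i using that w u by (auto simp: f_def)
  obtain \<psi> :: "nat \<Rightarrow> 'a \<Rightarrow> real" where \<psi>: "\<And>j. \<psi> j \<in> Cc" "\<And>j x. 0 \<le> \<psi> j x"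
    "\<And>i. i < n2 + n1 \<Longrightarrow> (\<lambda>j. LINT x|gamma (f i). \<psi> j x) \<longlonglongrightarrow> (LINT x|gamma (f i). \<phi> x)"
    by (rule gamma_approximating_sequence[OF \<phi>, of "n2 + n1" f]) (use f in auto)
  have "lq_norm q2 n2 (\<lambda>l. (LINT x|gamma (w l). \<phi> x) powr (1 / p))
      \<le> lq_norm (ereal q1) n1 (\<lambda>i. (LINT x|gamma (u i). \<phi> x) powr (1 / p))"
  proof (rule lq_norm_le_limit[OF sequentially_bot p_pos n q1(1) q2])
    show "(\<lambda>j. LINT x|gamma (w l). \<psi> j x) \<longlonglongrightarrow> (LINT x|gamma (w l). \<phi> x)" if "l < n2" for l
      using \<psi>(3)[of l] that by (simp add: f_def)
    show "(\<lambda>j. LINT x|gamma (u i). \<psi> j x) \<longlonglongrightarrow> (LINT x|gamma (u i). \<phi> x)" if "i < n1" for i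
      using \<psi>(3)[of "n2 + i"] that by (simp add: f_def)
  qed (use \<psi> Cc_case[OF \<psi>(1,2)] in auto)
  then show "lq_norm q2 n2 (\<lambda>l. (LINT x|gamma (\<lambda>x. T (\<lambda>i. u i x) l). \<phi> x) powr (1 / p))
      \<le> lq_norm (ereal q1) n1 (\<lambda>i. (LINT x|gamma (u i). \<phi> x) powr (1 / p))"
    by (simp add: w_def[abs_def])
qed

lemma gamma_generalized_contraction:
  assumes "bounded_nonneg_borel \<phi>"
  shows "generalized_contraction p (\<lambda>u. LINT x|gamma u. \<phi> x) (Db p m k)"
  unfolding generalized_contraction_def
proof (intro allI impI)
  fix n1 n2 :: nat and q1 :: real and q2 :: ereal and T :: "(nat \<Rightarrow> real) \<Rightarrow> nat \<Rightarrow> real" and u :: "nat \<Rightarrow> 'a \<Rightarrow> real"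
  assume *: "1 \<le> n1 \<and> 1 \<le> n2 \<and> 0 < q1 \<and> q1 \<le> p \<and> ereal p \<le> q2 \<and> (\<forall>l<n2. T (\<lambda>i. 0) l = 0) \<and>
      (\<forall>x y. lq_norm q2 n2 (\<lambda>l. T x l - T y l) \<le> lq_norm (ereal q1) n1 (\<lambda>i. x i - y i))"
    and u: "\<forall>i<n1. u i \<in> Db p m k"
  note c = gamma_contraction[of n1 n2 q1 q2 T u \<phi>]
  show "(\<forall>l<n2. (\<lambda>x. T (\<lambda>i. u i x) l) \<in> Db p m k) \<and>
    lq_norm q2 n2 (\<lambda>l. (LINT x|gamma (\<lambda>x. T (\<lambda>i. u i x) l). \<phi> x) powr (1 / p))
      \<le> lq_norm (ereal q1) n1 (\<lambda>i. (LINT x|gamma (u i). \<phi> x) powr (1 / p))"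
    using c(1) c(2) * u assms by blast
qed

lemma gamma_energy_form:
  assumes \<phi>: "bounded_nonneg_borel \<phi>"
  shows "p_energy_form p m (\<lambda>u. LINT x|gamma u. \<phi> x) (Db p m k)"
proof -
  have root: "(\<bar>a\<bar> powr p * b) powr (1 / p) = \<bar>a\<bar> * b powr (1 / p)" if "b \<ge> 0" for a b :: real
    using that p by (simp add: powr_mult powr_powr)
  have add: "(\<lambda>x. u x + v x) \<in> Db p m k" if "u \<in> Db p m k" "v \<in> Db p m k" for u v
    using Db_add[OF that, of 1] by simp
  \<comment> \<open>The triangle inequality is the contraction property of addition, with \<open>q1 = 1\<close> and \<open>q2 = p\<close>.\<close>
  have triangle: "(LINT x|gamma (\<lambda>x. u x + v x). \<phi> x) powr (1 / p)
      \<le> (LINT x|gamma u. \<phi> x) powr (1 / p) + (LINT x|gamma v. \<phi> x) powr (1 / p)"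
    if u: "u \<in> Db p m k" and v: "v \<in> Db p m k" for u v
  proof -
    let ?w = "\<lambda>i::nat. if i = 0 then u else v"
    let ?T = "\<lambda>(x :: nat \<Rightarrow> real) (l :: nat). x 0 + x 1"
    have "lq_norm (ereal p) 1 (\<lambda>l. (LINT x|gamma (\<lambda>x. ?T (\<lambda>i. ?w i x) l). \<phi> x) powr (1 / p))
      \<le> lq_norm (ereal 1) 2 (\<lambda>i. (LINT x|gamma (?w i). \<phi> x) powr (1 / p))"
    proof (rule gamma_contraction(2)[where T="?T"])
      fix x y :: "nat \<Rightarrow> real"
      show "lq_norm (ereal p) 1 (\<lambda>l. ?T x l - ?T y l) \<le> lq_norm (ereal 1) 2 (\<lambda>i. x i - y i)"
        using p by (simp add: lq_norm_ereal powr_powr numeral_2_eq_2)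
    qed (use p u v \<phi> in auto)
    then show ?thesis using p gamma_integral_nonneg[OF \<phi>]
      by (simp add: lq_norm_ereal powr_powr numeral_2_eq_2)
  qed
  have ae: "v \<in> Db p m k \<and> (LINT x|gamma v. \<phi> x) = (LINT x|gamma u. \<phi> x)"
    if u: "u \<in> Db p m k" and v: "v \<in> borel_measurable m" and ae: "AE x in m. u x = v x" for u v
    using Db_cong_AE[OF u v ae] gamma_cong_AE[OF u _ ae] by simp
  show ?thesis
    unfolding p_energy_form_def
  proof (intro conjI ballI allI impI)
    show "Db p m k \<subseteq> borel_measurable m" using Db_B B_measurable by blast
    show "(LINT x|gamma (\<lambda>x. a * u x). \<phi> x) powr (1 / p) = \<bar>a\<bar> * (LINT x|gamma u. \<phi> x) powr (1 / p)"
      if "u \<in> Db p m k" for a u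
      unfolding gamma_integral_homogeneous[OF \<phi> that] by (rule root[OF gamma_integral_nonneg[OF \<phi>]])
  qed (simp_all add: ae Db_zero add Db_cmult gamma_integral_nonneg[OF \<phi>]
      gamma_integral_homogeneous[OF \<phi>] triangle)
qed

section \<open>Characterization by approximation\<close>

lemma energy_swap: "E (\<lambda>x. u x - v x) = E (\<lambda>x. v x - u x)"
proof -
  have "\<bar>(u x - v x) - (u y - v y)\<bar> = \<bar>(v x - u x) - (v y - u y)\<bar>" for x y by linarith
  then show ?thesis by (simp add: energy_def kernel_energy_def)
qed

lemma gamma_integral_convergence:
  assumes u: "u \<in> Db p m k" and us: "\<And>n. us n \<in> Db p m k"
    and lim: "(\<lambda>n. E (\<lambda>x. u x - us n x)) \<longlonglongrightarrow> 0" and \<phi>: "bounded_nonneg_borel \<phi>"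
  shows "(\<lambda>n. LINT x|gamma (us n). \<phi> x) \<longlonglongrightarrow> (LINT x|gamma u. \<phi> x)"
proof (rule LIMSEQ_I)
  fix e :: real assume e: "e > 0"
  obtain c where c: "\<And>x. \<bar>\<phi> x\<bar> \<le> c" using \<phi> by (force simp: bounded_nonneg_borel_def bounded_iff)
  have c': "\<phi> x \<le> c" for x using c[of x] by simp
  define I where "I = (LINT x|gamma u. \<phi> x)"
  have I: "I \<ge> 0" unfolding I_def by (rule gamma_integral_nonneg[OF \<phi>])
  define \<eta> where "\<eta> = e / (2 * (I + 1))"
  have \<eta>: "\<eta> > 0" "\<eta> * I < e / 2" using e I by (simp_all add: \<eta>_def field_simps)
  obtain C where C: "C \<ge> 0" "\<And>a b :: real. abs (\<bar>a\<bar> powr p - \<bar>b\<bar> powr p) \<le> \<eta> * \<bar>b\<bar> powr p + C * \<bar>a - b\<bar> powr p"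
    using powr_increment_bound[OF p_pos \<eta>(1)] by blast
  have "(\<lambda>n. C * (c * E (\<lambda>x. u x - us n x))) \<longlonglongrightarrow> C * (c * 0)" by (intro tendsto_intros lim)
  then have "\<forall>\<^sub>F n in sequentially. C * (c * E (\<lambda>x. u x - us n x)) < e / 2" using e by (intro order_tendstoD(2)) auto
  then have "\<forall>\<^sub>F n in sequentially. norm ((LINT x|gamma (us n). \<phi> x) - (LINT x|gamma u. \<phi> x)) < e"
  proof eventually_elim
    case (elim n)
    have "\<bar>(LINT x|gamma (us n). \<phi> x) - I\<bar> \<le> \<eta> * I + C * (LINT x|gamma (\<lambda>x. us n x - u x). \<phi> x)"
      unfolding I_def by (rule gamma_integral_difference[OF C(2) \<phi> us u])
    also have "\<dots> \<le> \<eta> * I + C * (c * E (\<lambda>x. u x - us n x))"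
      unfolding energy_swap[of u]
      using C(1) c' by (intro add_left_mono mult_left_mono gamma_integral_le \<phi> Db_diff us u) auto
    also have "\<dots> < e" using \<eta>(2) elim by linarith
    finally show ?case by (simp add: I_def)
  qed
  then show "\<exists>no. \<forall>n\<ge>no. norm ((LINT x|gamma (us n). \<phi> x) - (LINT x|gamma u. \<phi> x)) < e"
    by (simp add: eventually_sequentially)
qed

lemma gamma_energy_measure_limit:
  assumes u: "u \<in> Db p m k"
  shows "energy_measure_limit p m k rs u (gamma u)"
  unfolding energy_measure_limit_def
proof (intro allI impI)
  fix us :: "nat \<Rightarrow> 'a \<Rightarrow> real" and \<phi> :: "'a \<Rightarrow> real"
  assume *: "(\<forall>n. us n \<in> B \<inter> Cb) \<and> (\<lambda>n. E (\<lambda>x. u x - us n x)) \<longlonglongrightarrow> 0 \<and> bounded_nonneg_borel \<phi>"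
  then have us: "us n \<in> Db p m k" for n using Cb_Db by blast
  have \<phi>: "bounded_nonneg_borel \<phi>" using * by blast
  have nn: "(\<integral>\<^sup>+x. ennreal (\<phi> x) \<partial>gamma v) = ennreal (LINT x|gamma v. \<phi> x)" if "v \<in> Db p m k" for v
    using bounded_borel_integrable_gamma[OF \<phi> that] \<phi>
    by (intro nn_integral_eq_integral) (auto simp: bounded_nonneg_borel_def)
  have "(\<lambda>n. LINT x|gamma (us n). \<phi> x) \<longlonglongrightarrow> (LINT x|gamma u. \<phi> x)"
    using * by (intro gamma_integral_convergence u us) auto
  moreover have "energy_measure p m k rs (us n) = gamma (us n)" for n
    using * by (intro energy_measure_eq_gamma) blast
  ultimately show "(\<lambda>n. \<integral>\<^sup>+x. ennreal (\<phi> x) \<partial>energy_measure p m k rs (us n)) \<longlonglongrightarrow> (\<integral>\<^sup>+x. ennreal (\<phi> x) \<partial>gamma u)"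
    by (simp add: nn u us tendsto_ennrealI)
qed

text \<open>Any approximating sequence, tested with indicators, determines the measure.\<close>

lemma energy_measure_limit_unique:
  assumes u: "u \<in> Db p m k"
    and M: "radon_measure \<mu>" "energy_measure_limit p m k rs u \<mu>"
    and N: "radon_measure \<nu>" "energy_measure_limit p m k rs u \<nu>"
  shows "\<mu> = \<nu>"
proof (rule measure_eqI)
  show s: "sets \<mu> = sets \<nu>" using M N by (simp add: radon_measure_def)
  have "\<exists>v. v \<in> B \<inter> Cb \<and> 0 \<le> E (\<lambda>x. u x - v x) \<and> E (\<lambda>x. u x - v x) \<le> inverse (real (Suc n))" for n
  proof -
    obtain v where v: "v \<in> B \<inter> Cb" "(\<lambda>x. u x - v x) \<in> B" "\<And>r. r > 0 \<Longrightarrow> en r (\<lambda>x. u x - v x) \<le> inverse (real (Suc n))"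
      using Db_approx[OF u, of "inverse (real (Suc n))"] by auto
    have "E (\<lambda>x. u x - v x) \<le> inverse (real (Suc n))"
      by (rule LIMSEQ_le_const2[OF energy_tendsto(1)[OF v(2)]]) (use v(3)[OF rs_pos] in blast)
    then show ?thesis using v energy_tendsto(2)[OF v(2)] by blast
  qed
  then obtain us where us: "\<And>n. us n \<in> B \<inter> Cb" "\<And>n. 0 \<le> E (\<lambda>x. u x - us n x)"
    "\<And>n. E (\<lambda>x. u x - us n x) \<le> inverse (real (Suc n))" by metis
  have lim: "(\<lambda>n. E (\<lambda>x. u x - us n x)) \<longlonglongrightarrow> 0"
    by (rule tendsto_sandwich[OF _ _ tendsto_const LIMSEQ_inverse_real_of_nat]) (use us in auto)
  fix A assume "A \<in> sets \<mu>"
  then have A: "A \<in> sets \<mu>" "A \<in> sets \<nu>" "A \<in> sets borel" using s M by (auto simp: radon_measure_def)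
  have "bounded_nonneg_borel (indicator A :: 'a \<Rightarrow> real)"
    using A(3) by (auto simp: bounded_nonneg_borel_def bounded_iff indicator_def intro!: exI[of _ 1])
  then have "(\<integral>\<^sup>+x. ennreal (indicator A x) \<partial>\<mu>) = (\<integral>\<^sup>+x. ennreal (indicator A x) \<partial>\<nu>)"
    using M(2) N(2) us(1) lim unfolding energy_measure_limit_def by (meson LIMSEQ_unique)
  then show "emeasure \<mu> A = emeasure \<nu> A" using A by (simp add: ennreal_indicator)
qed

end

theorem theorem4p5:
  fixes p :: real
    and m :: "'a::{metric_space, second_countable_topology} measure"
    and k :: "real \<Rightarrow> 'a \<Rightarrow> 'a \<Rightarrow> ennreal"
    and rs :: "nat \<Rightarrow> real"
  assumes "1 < p"
    and "locally_compact_space (euclidean :: 'a topology)"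
    and "\<exists>x y :: 'a. x \<noteq> y"
    and "sets m = sets borel"
    and "sigma_finite_measure m"
    and "full_support m"
    and "\<And>r. r > 0 \<Longrightarrow> (\<lambda>(x, y). k r x y) \<in> borel_measurable borel"
    and "weak_monotonicity p m k"
    and "asymptotically_local m k"
    and "regular_Bspace p m k"
    and "admissible_scales p m k rs"
  shows "\<exists>\<Gamma> :: ('a \<Rightarrow> real) \<Rightarrow> 'a measure.
    (\<forall>u \<in> Db p m k.
       radon_measure (\<Gamma> u) \<and> energy_measure_limit p m k rs u (\<Gamma> u) \<and>
       (\<forall>\<mu>. radon_measure \<mu> \<and> energy_measure_limit p m k rs u \<mu> \<longrightarrow> \<mu> = \<Gamma> u) \<and>
       emeasure (\<Gamma> u) UNIV \<le> ennreal (energy p m k rs u)) \<and>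
    (\<forall>\<phi>. bounded_nonneg_borel \<phi> \<longrightarrow>
       p_energy_form p m (\<lambda>u. \<integral>x. \<phi> x \<partial>\<Gamma> u) (Db p m k) \<and>
       generalized_contraction p (\<lambda>u. \<integral>x. \<phi> x \<partial>\<Gamma> u) (Db p m k))"
proof -
  interpret energy_setting p m k rs
    by (rule energy_setting.intro) (fact assms)+
  show ?thesis
  proof (rule exI[of _ gamma], intro conjI ballI allI impI)
    fix u assume u: "u \<in> Db p m k"
    show "radon_measure (gamma u)" by (rule gamma_radon[OF u])
    show "energy_measure_limit p m k rs u (gamma u)" by (rule gamma_energy_measure_limit[OF u])
    show "\<mu> = gamma u" if "radon_measure \<mu> \<and> energy_measure_limit p m k rs u \<mu>" for \<mu>
      using that by (intro energy_measure_limit_unique[OF u] gamma_radon[OF u]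
          gamma_energy_measure_limit[OF u]) auto
    show "emeasure (gamma u) UNIV \<le> ennreal (energy p m k rs u)" by (rule gamma_mass[OF u])
  next
    fix \<phi> :: "'a \<Rightarrow> real" assume \<phi>: "bounded_nonneg_borel \<phi>"
    show "p_energy_form p m (\<lambda>u. \<integral>x. \<phi> x \<partial>gamma u) (Db p m k)"
      by (rule gamma_energy_form[OF \<phi>])
    show "generalized_contraction p (\<lambda>u. \<integral>x. \<phi> x \<partial>gamma u) (Db p m k)"
      by (rule gamma_generalized_contraction[OF \<phi>])
  qed
qed

end
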